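(* Let $\mathsf n,t\ge1$, $N=2^{\mathsf n}$, and let \[ \mathcal C_{\mu,t}=\mathbb E_{P\sim\mathcal P_{\mathsf n}}\mathbb E_{\theta\sim(-\pi,\pi)}\big(e^{\mathrm i\theta P/2}\big)^{\otimes t}\otimes\big(e^{-\mathrm i\theta\bar P/2}\big)^{\otimes t},\qquad\mathcal H_t=\int_{\mathrm{SU}(N)}(U\otimes\bar U)^{\otimes t}dU, \] where $P$ is uniform on $\mathcal P_{\mathsf n}=\{\mathbf 1_2,\sigma^x,\sigma^y,\sigma^z\}^{\otimes\mathsf n}\setminus\{\mathbf 1_N\}$, $\theta$ uniform, and $dU$ the Haar probability measure. Then \[ \|\mathcal C_{\mu,t}-\mathcal H_t\|\le1-\frac1{4t}\frac{N^2}{N^2-1}-\frac1{N^2-1}. \] If moreover $t\le N/2$, then \[ \|\mathcal C_{\mu,t}-\mathcal H_t\|\le1-\frac1{2t}\frac{N(N-t+1)}{N^2-1}. \]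
   Context: $\|\cdot\|$ is the operator norm; $\bar P$ is the entrywise complex conjugate. *)

theory Defs
  imports "HOL-Analysis.Analysis" "HOL-Probability.Probability" "Jordan_Normal_Form.Determinant"
begin

definition cconj_mat :: "complex mat \<Rightarrow> complex mat" where
  "cconj_mat A = map_mat cnj A"

definition dagger :: "complex mat \<Rightarrow> complex mat" where
  "dagger A = transpose_mat (cconj_mat A)"

definition kron :: "complex mat \<Rightarrow> complex mat \<Rightarrow> complex mat" where
  "kron A B = mat (dim_row A * dim_row B) (dim_col A * dim_col B)
     (\<lambda>(i,j). A $$ (i div dim_row B, j div dim_col B) * B $$ (i mod dim_row B, j mod dim_col B))"

fun tensor_pow :: "complex mat \<Rightarrow> nat \<Rightarrow> complex mat" where
  "tensor_pow A 0 = 1\<^sub>m 1"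
| "tensor_pow A (Suc k) = kron A (tensor_pow A k)"

definition mat_exp :: "complex mat \<Rightarrow> complex mat" where
  "mat_exp A = mat (dim_row A) (dim_col A) (\<lambda>(i,j). \<Sum>k. (A ^\<^sub>m k) $$ (i,j) / of_nat (fact k))"

definition vnorm :: "complex vec \<Rightarrow> real" where
  "vnorm v = sqrt (\<Sum>i<dim_vec v. (cmod (v $ i))\<^sup>2)"

definition op_norm :: "complex mat \<Rightarrow> real" where
  "op_norm A = Sup {vnorm (A *\<^sub>v v) | v. v \<in> carrier_vec (dim_col A) \<and> vnorm v \<le> 1}"

definition pauli_I :: "complex mat" where "pauli_I = 1\<^sub>m 2"
definition pauli_X :: "complex mat" where
  "pauli_X = mat 2 2 (\<lambda>(i,j). if i \<noteq> j then 1 else 0)"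
definition pauli_Y :: "complex mat" where
  "pauli_Y = mat 2 2 (\<lambda>(i,j). if i = 0 \<and> j = 1 then - \<i> else if i = 1 \<and> j = 0 then \<i> else 0)"
definition pauli_Z :: "complex mat" where
  "pauli_Z = mat 2 2 (\<lambda>(i,j). if i = j then (if i = 0 then 1 else -1) else 0)"

definition pauli_strings :: "nat \<Rightarrow> complex mat set" where
  "pauli_strings n = {foldr kron ps (1\<^sub>m 1) | ps. length ps = n \<and> set ps \<subseteq> {pauli_I, pauli_X, pauli_Y, pauli_Z}}
                     - {1\<^sub>m (2 ^ n)}"

definition pauli_rot_moment :: "nat \<Rightarrow> complex mat \<Rightarrow> real \<Rightarrow> complex mat" where
  "pauli_rot_moment t P \<theta> =
     kron (tensor_pow (mat_exp ((\<i> * of_real \<theta> / 2) \<cdot>\<^sub>m P)) t)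
          (tensor_pow (mat_exp ((- \<i> * of_real \<theta> / 2) \<cdot>\<^sub>m cconj_mat P)) t)"

definition C_mu :: "nat \<Rightarrow> nat \<Rightarrow> complex mat" where
  "C_mu n t = (let D = (2 ^ n) ^ (2 * t) in
     mat D D (\<lambda>(i,j). (1 / of_nat (card (pauli_strings n))) *
        (\<Sum>P\<in>pauli_strings n.
           integral\<^sup>L (uniform_measure lborel {-pi<..<pi}) (\<lambda>\<theta>. pauli_rot_moment t P \<theta> $$ (i,j)))))"

definition SU :: "nat \<Rightarrow> complex mat set" where
  "SU N = {U \<in> carrier_mat N N. U * dagger U = 1\<^sub>m N \<and> Determinant.det U = 1}"

text \<open>Borel sigma-algebra on \<open>SU(N)\<close> (subspace of \<open>\<complex>^{N\<times>N}\<close>): generated by the entry maps.\<close>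
definition SU_borel :: "nat \<Rightarrow> complex mat measure" where
  "SU_borel N = sigma (SU N)
     {(\<lambda>U. U $$ (i,j)) -` B \<inter> SU N | i j B. i < N \<and> j < N \<and> B \<in> sets borel}"

definition haar_SU :: "nat \<Rightarrow> complex mat measure \<Rightarrow> bool" where
  "haar_SU N M \<longleftrightarrow> prob_space M \<and> space M = SU N \<and> sets M = sets (SU_borel N) \<and>
     (\<forall>V\<in>SU N. distr M M (\<lambda>U. V * U) = M)"

definition H_haar :: "complex mat measure \<Rightarrow> nat \<Rightarrow> nat \<Rightarrow> complex mat" where
  "H_haar M N t = (let D = N ^ (2 * t) in
     mat D D (\<lambda>(i,j). integral\<^sup>L M (\<lambda>U. kron (tensor_pow U t) (tensor_pow (cconj_mat U) t) $$ (i,j))))"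

end

theory Submission
  imports Defs "Jordan_Normal_Form.Schur_Decomposition" "Jordan_Normal_Form.Spectral_Radius"
begin

text \<open>Let \<open>T\<close> be the representation \<open>U \<mapsto> U\<^sup>\<otimes>\<^sup>t \<otimes> cnj U\<^sup>\<otimes>\<^sup>t\<close> and \<open>\<tau>\<close> its derivative. Averaging the rotation
  about \<open>P\<close> over the angle gives the projection \<open>K\<^sub>P\<close> onto the kernel of \<open>\<tau> P\<close>, because \<open>\<tau> P / 2\<close> has integral
  eigenvalues. By completeness of the Pauli basis the Casimir operator \<open>Q = N \<Sum>\<^sub>i\<^sub>j \<tau> E\<^sub>i\<^sub>j \<tau> E\<^sub>j\<^sub>i\<close> equals
  \<open>\<Sum>\<^sub>P (\<tau> P)\<^sup>2\<close>. The commutation relations bound \<open>Q\<close> from below by a diagonal operator in the weights, which,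
  after conjugating \<open>P\<close> to a diagonal matrix, dominates \<open>G (\<tau> P)\<^sup>2\<close>. As \<open>Q\<close> commutes with \<open>K\<^sub>P\<close>, this gives
  \<open>Q (1 - K\<^sub>P) \<ge> G (\<tau> P)\<^sup>2\<close>, and summing over \<open>P\<close> yields \<open>Q \<Sum>\<^sub>P (1 - K\<^sub>P) \<ge> G Q\<close>. An eigenvector of
  \<open>C\<^sub>\<mu> - H\<close> with a nonzero eigenvalue is orthogonal to the invariants, on whose complement \<open>Q\<close> is positive, so that
  the eigenvalue is at most \<open>1 - G / (N\<^sup>2 - 1)\<close>.\<close>

text \<open>Comparing 1 - K_P with (\<open>\<tau> P\<close>)^2 alone is too weak: the norm of
  \<open>\<tau> P\<close> is bounded only by 2t, which costs a factor (2t)^2, and the smallest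
  positive eigenvalue of Q does not grow with t, so the resulting gap has order 1/t^2. Multiplying
  by Q before comparing gives order 1/t. On a weight with S = sum of |w_i|,
  (\<open>\<tau> P\<close>)^2 is at most S^2, whereas the diagonal bound of Q is at least S^2 + N^2
  S / 2. As S \<le> 2t, this gives G = 1 + N^2/(4t). Integrality of the weights gives another lower
  bound, N S (N + 1 - S/2), hence G = N (N - t + 1)/(2t) for the second claim. The diagonal
  comparison needs a frame in which P is diagonal; Q is invariant under the group, so a different
  frame may be used for each P. The total weight of every basis vector is 0, since t factors have
  charge 1 and t have charge -1. Hence scalars act trivially, so invariance under SU(N) and under
  all unitaries agree; the identity string contributes nothing to Q; and the weights of
  \<open>\<tau> P\<close> are even.\<close>

unbundle no vec_syntax

subsection \<open>Adjoints, unitary matrices and the Hermitian inner product\<close>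

definition cip :: "complex vec \<Rightarrow> complex vec \<Rightarrow> complex" where
  "cip v w = (\<Sum>i<dim_vec v. cnj (v $ i) * w $ i)"

definition nsq :: "complex vec \<Rightarrow> real" where
  "nsq v = (\<Sum>i<dim_vec v. (cmod (v $ i))\<^sup>2)"

definition unitary_mat :: "nat \<Rightarrow> complex mat \<Rightarrow> bool" where
  "unitary_mat n U \<longleftrightarrow> U \<in> carrier_mat n n \<and> dagger U * U = 1\<^sub>m n \<and> U * dagger U = 1\<^sub>m n"

definition diagm :: "nat \<Rightarrow> (nat \<Rightarrow> complex) \<Rightarrow> complex mat" where
  "diagm n d = mat n n (\<lambda>(i,j). if i = j then d i else 0)"

lemma cconj_carrier [simp]: "cconj_mat A \<in> carrier_mat n m \<longleftrightarrow> A \<in> carrier_mat n m"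
  by (auto simp: cconj_mat_def)

lemma cconj_dim [simp]: "dim_row (cconj_mat A) = dim_row A" "dim_col (cconj_mat A) = dim_col A"
  by (auto simp: cconj_mat_def)

lemma cconj_index [simp]:
  "i < dim_row A \<Longrightarrow> j < dim_col A \<Longrightarrow> cconj_mat A $$ (i,j) = cnj (A $$ (i,j))"
  by (auto simp: cconj_mat_def)

lemma dagger_carrier [simp]: "dagger A \<in> carrier_mat n m \<longleftrightarrow> A \<in> carrier_mat m n"
  by (auto simp: dagger_def)

lemma dagger_dim [simp]: "dim_row (dagger A) = dim_col A" "dim_col (dagger A) = dim_row A"
  by (auto simp: dagger_def)

lemma dagger_index [simp]:
  "i < dim_col A \<Longrightarrow> j < dim_row A \<Longrightarrow> dagger A $$ (i,j) = cnj (A $$ (j,i))"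
  by (auto simp: dagger_def)

lemma dagger_dagger [simp]: "dagger (dagger A) = A"
  by (rule eq_matI) auto

lemma index_mat_mult:
  assumes "A \<in> carrier_mat n m" "B \<in> carrier_mat m k" "i < n" "j < k"
  shows "(A * B) $$ (i,j) = (\<Sum>l<m. A $$ (i,l) * B $$ (l,j))"
  using assms by (auto simp: scalar_prod_def lessThan_atLeast0)

lemma index_mat_vec:
  assumes "A \<in> carrier_mat n m" "v \<in> carrier_vec m" "i < n"
  shows "(A *\<^sub>v v) $ i = (\<Sum>l<m. A $$ (i,l) * v $ l)"
  using assms by (auto simp: scalar_prod_def lessThan_atLeast0)

lemma dagger_mult:
  assumes "A \<in> carrier_mat n m" "B \<in> carrier_mat m k"
  shows "dagger (A * B) = dagger B * dagger A"
proof (rule eq_matI)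
  fix i j assume ij: "i < dim_row (dagger B * dagger A)" "j < dim_col (dagger B * dagger A)"
  then have ij': "i < k" "j < n" using assms by auto
  have "dagger (A * B) $$ (i,j) = cnj ((A * B) $$ (j,i))" using assms ij' by simp
  also have "\<dots> = (\<Sum>l<m. cnj (A $$ (j,l)) * cnj (B $$ (l,i)))"
    using assms ij' by (simp add: index_mat_mult[OF assms] del: index_mult_mat)
  also have "\<dots> = (dagger B * dagger A) $$ (i,j)"
    using assms ij'
    by (subst index_mat_mult[of _ k m _ n]) (auto intro!: sum.cong simp: mult.commute)
  finally show "dagger (A * B) $$ (i,j) = (dagger B * dagger A) $$ (i,j)" .
qed (use assms in auto)

lemma cip_mat_vec:
  assumes A: "A \<in> carrier_mat n m" and v: "v \<in> carrier_vec m" and w: "w \<in> carrier_vec n"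
  shows "cip (A *\<^sub>v v) w = cip v (dagger A *\<^sub>v w)"
proof -
  have "cip (A *\<^sub>v v) w = (\<Sum>i<n. \<Sum>l<m. cnj (A $$ (i,l)) * cnj (v $ l) * w $ i)"
    using assms by (auto simp: cip_def index_mat_vec[OF A v] sum_distrib_right simp del: index_mult_mat_vec
        intro!: sum.cong)
  also have "\<dots> = (\<Sum>l<m. \<Sum>i<n. cnj (A $$ (i,l)) * cnj (v $ l) * w $ i)"
    by (rule sum.swap)
  also have "\<dots> = cip v (dagger A *\<^sub>v w)"
  proof -
    have "dagger A \<in> carrier_mat m n" using A by simp
    from index_mat_vec[OF this w] show ?thesis using A v
      by (auto simp: cip_def sum_distrib_left simp del: index_mult_mat_vec intro!: sum.cong)
  qed
  finally show ?thesis .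
qed

lemma cip_self: "cip v v = of_real (nsq v)"
  by (simp add: cip_def nsq_def complex_norm_square[symmetric] mult.commute)

lemma nsq_nonneg [simp]: "nsq v \<ge> 0"
  by (simp add: nsq_def sum_nonneg)

lemma nsq_eq_0: "nsq v = 0 \<longleftrightarrow> v = 0\<^sub>v (dim_vec v)"
  by (auto simp: nsq_def sum_nonneg_eq_0_iff intro!: eq_vecI)
     (metis index_zero_vec(1))

lemma vnorm_nsq: "vnorm v = sqrt (nsq v)"
  by (simp add: vnorm_def nsq_def)

lemma unitary_matD:
  assumes "unitary_mat n U"
  shows "U \<in> carrier_mat n n" "dagger U * U = 1\<^sub>m n" "U * dagger U = 1\<^sub>m n"
  using assms by (auto simp: unitary_mat_def)

lemma unitary_matI:
  assumes "U \<in> carrier_mat n n" "U * dagger U = 1\<^sub>m n \<or> dagger U * U = 1\<^sub>m n"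
  shows "unitary_mat n U"
  using assms mat_mult_left_right_inverse[of U n "dagger U"] mat_mult_left_right_inverse[of "dagger U" n U]
  by (auto simp: unitary_mat_def)

lemma unitary_dagger: "unitary_mat n U \<Longrightarrow> unitary_mat n (dagger U)"
  by (auto simp: unitary_mat_def)

lemma unitary_mult:
  assumes "unitary_mat n U" "unitary_mat n V"
  shows "unitary_mat n (U * V)"
proof (rule unitary_matI)
  note U = unitary_matD[OF assms(1)] and V = unitary_matD[OF assms(2)]
  show "U * V \<in> carrier_mat n n" using U V by simp
  have "U * V * dagger (U * V) = U * V * (dagger V * dagger U)"
    using U V by (subst dagger_mult) auto
  also have "\<dots> = U * (V * dagger V) * dagger U"
    using U(1) V(1) by (simp add: assoc_mult_mat[of _ n n _ n _ n] del: assoc_mult_mat)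
  also have "\<dots> = 1\<^sub>m n" using U V by simp
  finally show "U * V * dagger (U * V) = 1\<^sub>m n \<or> dagger (U * V) * (U * V) = 1\<^sub>m n" by simp
qed

lemma unitary_cancel:
  assumes "unitary_mat n U" "v \<in> carrier_vec n"
  shows "dagger U *\<^sub>v (U *\<^sub>v v) = v" "U *\<^sub>v (dagger U *\<^sub>v v) = v"
  using unitary_matD[OF assms(1)] assms(2)
    assoc_mult_mat_vec[of U n n "dagger U" n v] assoc_mult_mat_vec[of "dagger U" n n U n v]
  by (metis dagger_carrier one_mult_mat_vec)+

lemma nsq_unitary:
  assumes U: "unitary_mat n U" and v: "v \<in> carrier_vec n"
  shows "nsq (U *\<^sub>v v) = nsq v"
proof -
  note U' = unitary_matD[OF U]
  have "complex_of_real (nsq (U *\<^sub>v v)) = cip v (dagger U *\<^sub>v (U *\<^sub>v v))"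
    using U' v by (simp add: cip_self[symmetric] cip_mat_vec[of U n n])
  also have "dagger U *\<^sub>v (U *\<^sub>v v) = v" using U v by (rule unitary_cancel)
  finally show ?thesis by (simp add: cip_self)
qed

lemma diagm_carrier [simp]: "diagm n d \<in> carrier_mat n n"
  by (simp add: diagm_def)

lemma diagm_dim [simp]: "dim_row (diagm n d) = n" "dim_col (diagm n d) = n"
  by (simp_all add: diagm_def)

lemma diagm_index [simp]: "i < n \<Longrightarrow> j < n \<Longrightarrow> diagm n d $$ (i,j) = (if i = j then d i else 0)"
  by (simp add: diagm_def)

lemma diagm_mult: "diagm n d * diagm n e = diagm n (\<lambda>i. d i * e i)"
proof (rule eq_matI)
  fix i j assume "i < dim_row (diagm n (\<lambda>i. d i * e i))" "j < dim_col (diagm n (\<lambda>i. d i * e i))"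
  then have ij: "i < n" "j < n" by auto
  have "(\<Sum>l<n. diagm n d $$ (i, l) * diagm n e $$ (l, j))
      = (\<Sum>l<n. if l = i then diagm n d $$ (i, l) * diagm n e $$ (l, j) else 0)"
    using ij by (intro sum.cong) auto
  then show "(diagm n d * diagm n e) $$ (i,j) = diagm n (\<lambda>i. d i * e i) $$ (i,j)"
    using ij by (subst index_mat_mult[of _ n n _ n]) (auto simp: sum.delta)
qed auto

lemma diagm_mult_vec:
  assumes "v \<in> carrier_vec n" "i < n"
  shows "(diagm n d *\<^sub>v v) $ i = d i * v $ i"
proof -
  have "(\<Sum>l<n. diagm n d $$ (i, l) * v $ l) = (\<Sum>l<n. if l = i then d i * v $ l else 0)"
    using assms by (intro sum.cong) auto
  then show ?thesis using assms by (subst index_mat_vec[of _ n n]) (auto simp: sum.delta)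
qed

lemma dagger_diagm: "dagger (diagm n d) = diagm n (\<lambda>i. cnj (d i))"
  by (rule eq_matI) auto

lemma diagm_cong: "(\<And>i. i < n \<Longrightarrow> d i = e i) \<Longrightarrow> diagm n d = diagm n e"
  by (rule eq_matI) auto

lemma diagm_one: "diagm n (\<lambda>_. 1) = 1\<^sub>m n"
  by (rule eq_matI) auto

lemma unitary_diagm: "(\<And>i. i < n \<Longrightarrow> cmod (d i) = 1) \<Longrightarrow> unitary_mat n (diagm n d)"
  by (rule unitary_matI)
     (auto simp: dagger_diagm diagm_mult diagm_one[symmetric] complex_norm_square[symmetric] intro!: diagm_cong)

lemma conj_diag_index:
  \<comment> \<open>Entry formula through which the matrix exponential, entrywise conjugation and
    the angle average of a diagonalised matrix are computed.\<close>
  assumes V: "V \<in> carrier_mat n n" and "i < n" "j < n"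
  shows "(V * diagm n d * dagger V) $$ (i,j) = (\<Sum>m<n. V $$ (i,m) * d m * cnj (V $$ (j,m)))"
proof -
  have *: "(V * diagm n d) $$ (i,m) = V $$ (i,m) * d m" if "m < n" for m
  proof -
    have "(\<Sum>l<n. V $$ (i, l) * diagm n d $$ (l, m)) = (\<Sum>l<n. if l = m then V $$ (i, l) * d l else 0)"
      using that by (intro sum.cong) auto
    then show ?thesis using assms that by (subst index_mat_mult[of _ n n _ n]) (auto simp: sum.delta)
  qed
  show ?thesis using assms
    by (subst index_mat_mult[of _ n n _ n]) (auto intro!: sum.cong simp: * simp del: index_mult_mat)
qed

subsection \<open>The spectral theorem for normal matrices\<close>

text \<open>The library version of Gram-Schmidt leaves the columns unnormalised.\<close>
lemma exists_unitary_with_first_column: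
  assumes v: "v \<in> carrier_vec n" and nv: "nsq v = 1"
  shows "\<exists>W. unitary_mat n W \<and> (\<forall>i<n. W $$ (i,0) = v $ i)"
proof -
  interpret cof_vec_space n "TYPE(complex)" .
  have v0: "v \<noteq> 0\<^sub>v n" using nv nsq_eq_0[of v] v by auto
  define b where "b = basis_completion v"
  define ws where "ws = gram_schmidt n b"
  from basis_completion[OF v v0, folded b_def]
  have dist_b: "distinct b" and indep: "\<not> lin_dep (set b)" and b: "set b \<subseteq> carrier_vec n"
    and hdb: "hd b = v" and len_b: "length b = n" by auto
  have n: "n \<noteq> 0" using v v0 by (auto intro!: eq_vecI)
  from hdb len_b n obtain vs where bv: "b = v # vs" by (cases b, auto)
  from gram_schmidt_result[OF b dist_b indep refl, folded ws_def]
  have ws: "set ws \<subseteq> carrier_vec n" "corthogonal ws" "length ws = n" by (auto simp: len_b)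
  from gram_schmidt_hd[OF v, of vs, folded bv] have hdws: "hd ws = v" unfolding ws_def .
  then have ws0: "ws ! 0 = v" using ws(3) n by (metis hd_conv_nth list.size(3))
  have wsc: "ws ! i \<in> carrier_vec n" if "i < n" for i using ws that by auto
  \<comment> \<open>The equivalence carries two facts: distinct vectors are orthogonal, and no
    vector is null, so that the norms \<open>r j\<close> may be divided by.\<close>
  have orth: "cip (ws ! i) (ws ! j) = 0 \<longleftrightarrow> i \<noteq> j" if "i < n" "j < n" for i j
  proof -
    have "cip (ws ! i) (ws ! j) = ws ! j \<bullet>c ws ! i"
      using wsc[OF that(1)] wsc[OF that(2)]
      by (auto simp: cip_def scalar_prod_def mult.commute lessThan_atLeast0)
    then show ?thesis using corthogonalD[OF ws(2), of j i] that ws(3) by auto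
  qed
  define r where "r j = vnorm (ws ! j)" for j
  have r: "r j \<noteq> 0" if "j < n" for j
    using orth[OF that that] by (auto simp: r_def vnorm_nsq cip_self)
  have r0: "r 0 = 1" by (simp add: r_def ws0 vnorm_nsq nv)
  define W where "W = mat n n (\<lambda>(i,j). (ws ! j) $ i / r j)"
  have W: "W \<in> carrier_mat n n" by (simp add: W_def)
  have "dagger W * W = 1\<^sub>m n"
  proof (rule eq_matI)
    fix i j assume "i < dim_row (1\<^sub>m n :: complex mat)" "j < dim_col (1\<^sub>m n :: complex mat)"
    then have ij: "i < n" "j < n" by auto
    have "(dagger W * W) $$ (i,j) = (\<Sum>l<n. cnj ((ws ! i) $ l / r i) * ((ws ! j) $ l / r j))"
      using ij W by (subst index_mat_mult[of _ n n _ n]) (auto simp: W_def)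
    also have "\<dots> = cip (ws ! i) (ws ! j) / (r i * r j)"
      using wsc[OF ij(1)] by (simp add: cip_def sum_divide_distrib)
    also have "\<dots> = (1\<^sub>m n) $$ (i,j)"
    proof (cases "i = j")
      case True
      have "(r i)\<^sup>2 = nsq (ws ! i)" by (simp add: r_def vnorm_nsq)
      then show ?thesis using True r[OF ij(1)] ij
        by (simp add: cip_self) (metis of_real_mult power2_eq_square divide_self_if mult_eq_0_iff of_real_eq_0_iff)
    next
      case False then show ?thesis using orth[OF ij] ij by auto
    qed
    finally show "(dagger W * W) $$ (i,j) = (1\<^sub>m n) $$ (i,j)" .
  qed (use W in auto)
  then have "unitary_mat n W" using W by (intro unitary_matI) auto
  moreover have "\<forall>i<n. W $$ (i,0) = v $ i" using n r0 by (simp add: W_def ws0)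
  ultimately show ?thesis by blast
qed

lemma exists_unit_eigenvector:
  assumes A: "A \<in> carrier_mat n n" and n: "n > 0"
  shows "\<exists>e v. v \<in> carrier_vec n \<and> nsq v = 1 \<and> A *\<^sub>v v = e \<cdot>\<^sub>v v"
proof -
  from spectrum_non_empty[OF A n] obtain e where "eigenvalue A e"
    by (auto simp: spectrum_def)
  then obtain u where u: "u \<in> carrier_vec n" "u \<noteq> 0\<^sub>v n" "A *\<^sub>v u = e \<cdot>\<^sub>v u"
    using A by (auto simp: eigenvalue_def eigenvector_def)
  define c where "c = sqrt (nsq u)"
  have c: "c > 0" using u nsq_eq_0[of u] nsq_nonneg[of u] by (auto simp: c_def order_less_le)
  define v where "v = complex_of_real (1 / c) \<cdot>\<^sub>v u"
  have "nsq v = nsq u / c\<^sup>2" using c u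
    by (simp add: nsq_def v_def norm_divide power_divide sum_divide_distrib norm_mult power_mult_distrib)
  then have "nsq v = 1" using c by (simp add: c_def)
  moreover have "A *\<^sub>v v = e \<cdot>\<^sub>v v" using A u
    by (simp add: v_def mult_mat_vec[of _ n n] smult_smult_assoc mult.commute)
  ultimately show ?thesis using u by (intro exI[of _ e] exI[of _ v]) (auto simp: v_def)
qed

text \<open>Deflation: in a unitary frame that starts with a unit eigenvector the first column is a
  multiple of the first basis vector. Normality clears the first row as well and passes to the
  remaining block, to which the induction hypothesis applies.\<close>

lemma normal_mat_diagonalizable:
  assumes "A \<in> carrier_mat n n" "A * dagger A = dagger A * A"
  shows "\<exists>V d. unitary_mat n V \<and> A = V * diagm n d * dagger V"
  using assms
proof (induction n arbitrary: A)
  case 0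
  then show ?case by (intro exI[of _ "1\<^sub>m 0"]) (auto simp: unitary_mat_def intro!: eq_matI)
next
  case (Suc n)
  note A = Suc.prems(1)
  obtain e v where v: "v \<in> carrier_vec (Suc n)" "nsq v = 1" "A *\<^sub>v v = e \<cdot>\<^sub>v v"
    using exists_unit_eigenvector[OF A] by auto
  obtain W where W: "unitary_mat (Suc n) W" "\<And>i. i < Suc n \<Longrightarrow> W $$ (i,0) = v $ i"
    using exists_unitary_with_first_column[OF v(1,2)] by auto
  note W' = unitary_matD[OF W(1)]
  note assoc = assoc_mult_mat[of _ "Suc n" "Suc n" _ "Suc n" _ "Suc n"]
  define B where "B = dagger W * A * W"
  have B: "B \<in> carrier_mat (Suc n) (Suc n)" using W' A by (simp add: B_def)
  have dB: "dagger B = dagger W * dagger A * W"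
    using W' A by (simp add: B_def dagger_mult[of _ "Suc n" "Suc n" _ "Suc n"] assoc)
  have WW: "W * (dagger W * X) = X" if "X \<in> carrier_mat (Suc n) (Suc n)" for X
    using that W' by (metis assoc_mult_mat dagger_carrier left_mult_one_mat)
  have BB: "B * dagger B = dagger B * B"
  proof -
    have "B * dagger B = dagger W * (A * (W * (dagger W * (dagger A * W))))"
      using W' A by (simp add: dB assoc) (simp add: B_def assoc)
    also have "\<dots> = dagger W * ((A * dagger A) * W)" using W' A by (simp add: WW assoc)
    also have "\<dots> = dagger W * ((dagger A * A) * W)" by (simp add: Suc.prems(2))
    also have "\<dots> = dagger W * (dagger A * (W * (dagger W * (A * W))))"
      using W' A by (simp add: WW assoc)
    also have "\<dots> = dagger B * B"
      using W' A by (simp add: dB assoc) (simp add: B_def assoc)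
    finally show ?thesis .
  qed
  have B0: "B $$ (i,0) = (if i = 0 then e else 0)" if i: "i < Suc n" for i
  proof -
    have AW: "(A * W) $$ (l,0) = e * W $$ (l,0)" if l: "l < Suc n" for l
    proof -
      have "(A * W) $$ (l,0) = (\<Sum>k<Suc n. A $$ (l,k) * v $ k)"
        using l W' A by (subst index_mat_mult[of _ "Suc n" "Suc n" _ "Suc n"])
          (auto intro!: sum.cong simp: W(2) simp del: sum.lessThan_Suc)
      also have "\<dots> = (A *\<^sub>v v) $ l" using l v A by (subst index_mat_vec[of _ "Suc n" "Suc n"]) auto
      also have "\<dots> = e * W $$ (l,0)" using l v W(2) by simp
      finally show ?thesis .
    qed
    have "B = dagger W * (A * W)" using W' A by (simp add: B_def assoc)
    then have "B $$ (i,0) = (\<Sum>l<Suc n. dagger W $$ (i,l) * (A * W) $$ (l,0))"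
      using i W' A by (simp add: index_mat_mult[of _ "Suc n" "Suc n" _ "Suc n"]
          del: index_mult_mat sum.lessThan_Suc)
    also have "\<dots> = e * (\<Sum>l<Suc n. dagger W $$ (i,l) * W $$ (l,0))"
      unfolding sum_distrib_left by (intro sum.cong) (auto simp: AW simp del: index_mult_mat)
    also have "(\<Sum>l<Suc n. dagger W $$ (i,l) * W $$ (l,0)) = (dagger W * W) $$ (i,0)"
      using i W' by (subst index_mat_mult[of _ "Suc n" "Suc n" _ "Suc n"]) auto
    also have "\<dots> = (if i = 0 then 1 else 0)" using i W' by simp
    finally show ?thesis by simp
  qed
  have mm: "(\<Sum>l<Suc n. B $$ (i,l) * cnj (B $$ (j,l))) = (\<Sum>l<Suc n. cnj (B $$ (l,i)) * B $$ (l,j))"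
    if "i < Suc n" "j < Suc n" for i j
  proof -
    have "(B * dagger B) $$ (i,j) = (\<Sum>l<Suc n. B $$ (i,l) * cnj (B $$ (j,l)))"
      using that B by (subst index_mat_mult[of _ "Suc n" "Suc n" _ "Suc n"])
        (auto simp del: sum.lessThan_Suc intro!: sum.cong)
    moreover have "(dagger B * B) $$ (i,j) = (\<Sum>l<Suc n. cnj (B $$ (l,i)) * B $$ (l,j))"
      using that B by (subst index_mat_mult[of _ "Suc n" "Suc n" _ "Suc n"])
        (auto simp del: sum.lessThan_Suc intro!: sum.cong)
    ultimately show ?thesis using BB by simp
  qed
  \<comment> \<open>Entry (0,0) of the normality relation equates the squared norms of the first row
    and the first column. The column contains only \<open>e\<close>, so the rest of the row
    vanishes.\<close>
  have Br: "B $$ (0, Suc j) = 0" if "j < n" for j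
  proof -
    have "complex_of_real (\<Sum>l<n. (cmod (B $$ (0,Suc l)))\<^sup>2) = 0"
      using mm[of 0 0] B0
      by (simp add: sum.lessThan_Suc_shift complex_norm_square mult.commute del: sum.lessThan_Suc of_real_power)
    then have "(\<Sum>l<n. (cmod (B $$ (0,Suc l)))\<^sup>2) = 0" by (simp only: of_real_eq_0_iff)
    then show ?thesis using that by (simp add: sum_nonneg_eq_0_iff)
  qed
  define C where "C = mat n n (\<lambda>(i,j). B $$ (Suc i, Suc j))"
  have C: "C \<in> carrier_mat n n" by (simp add: C_def)
  have "C * dagger C = dagger C * C"
  proof (rule eq_matI)
    fix i j assume "i < dim_row (dagger C * C)" "j < dim_col (dagger C * C)"
    then have ij: "i < n" "j < n" using C by auto
    show "(C * dagger C) $$ (i,j) = (dagger C * C) $$ (i,j)"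
      using mm[of "Suc i" "Suc j"] ij C B0 Br
      by (simp add: index_mat_mult[of _ n n _ n] sum.lessThan_Suc_shift del: index_mult_mat sum.lessThan_Suc)
         (simp add: C_def)
  qed (use C in auto)
  from Suc.IH[OF C this] obtain V d where V: "unitary_mat n V" and CV: "C = V * diagm n d * dagger V"
    by auto
  note V' = unitary_matD[OF V]
  \<comment> \<open>\<open>X\<close> is the block sum of 1 and \<open>V\<close>. The formula
    \<open>Xd\<close> is kept general in \<open>a\<close> and \<open>c\<close> because it serves
    twice: with all entries 1 for unitarity, and with the eigenvalues for \<open>B\<close>.\<close>
  define X where "X = mat (Suc n) (Suc n) (\<lambda>(i,j). case i of 0 \<Rightarrow> (if j = 0 then 1 else 0) |
     Suc i' \<Rightarrow> (case j of 0 \<Rightarrow> 0 | Suc j' \<Rightarrow> V $$ (i',j')))"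
  have X: "X \<in> carrier_mat (Suc n) (Suc n)" by (simp add: X_def)
  have Xi: "X $$ (0,0) = 1" "\<And>j. j < n \<Longrightarrow> X $$ (0,Suc j) = 0" "\<And>j. j < n \<Longrightarrow> X $$ (Suc j,0) = 0"
    "\<And>i j. i < n \<Longrightarrow> j < n \<Longrightarrow> X $$ (Suc i,Suc j) = V $$ (i,j)"
    by (auto simp: X_def)
  have Xd: "(X * diagm (Suc n) (case_nat a c) * dagger X) $$ (i,j) =
      (case i of 0 \<Rightarrow> (if j = 0 then a else 0) | Suc i' \<Rightarrow> (case j of 0 \<Rightarrow> 0 |
        Suc j' \<Rightarrow> (V * diagm n c * dagger V) $$ (i',j')))"
    if "i < Suc n" "j < Suc n" for i j a c
    using that V'(1)
    by (cases i; cases j; subst conj_diag_index[OF X])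
       (auto simp: sum.lessThan_Suc_shift Xi conj_diag_index split: nat.splits
         simp del: index_mult_mat sum.lessThan_Suc)
  have "X * dagger X = 1\<^sub>m (Suc n)"
  proof -
    have one: "diagm (Suc n) (case_nat 1 (\<lambda>_. 1)) = 1\<^sub>m (Suc n)"
      by (auto simp: diagm_one[symmetric] intro!: diagm_cong split: nat.splits)
    have "V * diagm n (\<lambda>_. 1) * dagger V = 1\<^sub>m n" using V' by (simp add: diagm_one)
    then have "(X * diagm (Suc n) (case_nat 1 (\<lambda>_. 1)) * dagger X) $$ (i,j) = 1\<^sub>m (Suc n) $$ (i,j)"
      if "i < Suc n" "j < Suc n" for i j
      using that by (subst Xd) (auto split: nat.splits)
    then have "X * diagm (Suc n) (case_nat 1 (\<lambda>_. 1)) * dagger X = 1\<^sub>m (Suc n)"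
      using X by (intro eq_matI) auto
    then show ?thesis using X by (simp add: one)
  qed
  then have XU: "unitary_mat (Suc n) X" using X by (intro unitary_matI) auto
  have BX: "B = X * diagm (Suc n) (case_nat e d) * dagger X"
  proof (rule eq_matI)
    fix i j assume "i < dim_row (X * diagm (Suc n) (case_nat e d) * dagger X)"
      "j < dim_col (X * diagm (Suc n) (case_nat e d) * dagger X)"
    then have ij: "i < Suc n" "j < Suc n" using X by auto
    have C': "C $$ (a,b) = B $$ (Suc a, Suc b)" if "a < n" "b < n" for a b
      using that by (simp add: C_def)
    show "B $$ (i,j) = (X * diagm (Suc n) (case_nat e d) * dagger X) $$ (i,j)"
      using ij by (cases i; cases j; subst Xd) (auto simp: B0 Br CV[symmetric] C' split: nat.splits)
  qed (use B X in auto)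
  have "A = W * (B * dagger W)"
  proof -
    have "W * (B * dagger W) = W * (dagger W * (A * (W * dagger W)))"
      using W'(1) A by (simp add: B_def assoc)
    also have "\<dots> = A" using W' A by (subst WW) auto
    finally show ?thesis by simp
  qed
  also have "\<dots> = (W * X) * diagm (Suc n) (case_nat e d) * dagger (W * X)"
    using W'(1) X mult_carrier_mat[OF diagm_carrier, of "dagger X" "Suc n" "Suc n" "case_nat e d"]
    by (simp add: BX dagger_mult[of W "Suc n" "Suc n" X "Suc n"] assoc)
  finally show ?case using unitary_mult[OF W(1) XU] by blast
qed

text \<open>Reduces a norm bound to the eigenvalue equation, the only form in which the gap argument
  sees the operator. Each diagonal entry \<open>d i\<close> is an eigenvalue with eigenvector the
  i-th column of \<open>V\<close>.\<close>

lemma normal_mat_vnorm_bound: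
  assumes A: "A \<in> carrier_mat n n" "A * dagger A = dagger A * A"
    and b: "b \<ge> 0"
    and ev: "\<And>e v. v \<in> carrier_vec n \<Longrightarrow> v \<noteq> 0\<^sub>v n \<Longrightarrow> A *\<^sub>v v = e \<cdot>\<^sub>v v \<Longrightarrow> cmod e \<le> b"
    and u: "u \<in> carrier_vec n"
  shows "vnorm (A *\<^sub>v u) \<le> b * vnorm u"
proof -
  obtain V d where V: "unitary_mat n V" and AV: "A = V * diagm n d * dagger V"
    using normal_mat_diagonalizable[OF A] by auto
  note V' = unitary_matD[OF V]
  have A_app: "A *\<^sub>v x = V *\<^sub>v (diagm n d *\<^sub>v (dagger V *\<^sub>v x))" if "x \<in> carrier_vec n" for x
  proof -
    have "A *\<^sub>v x = (V * diagm n d) *\<^sub>v (dagger V *\<^sub>v x)"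
      unfolding AV using V' that by (intro assoc_mult_mat_vec[of _ n n _ n]) auto
    also have "\<dots> = V *\<^sub>v (diagm n d *\<^sub>v (dagger V *\<^sub>v x))"
      using V' that by (intro assoc_mult_mat_vec[of _ n n _ n]) auto
    finally show ?thesis .
  qed
  have d: "cmod (d i) \<le> b" if i: "i < n" for i
  proof -
    define x where "x = V *\<^sub>v unit_vec n i"
    have x: "x \<in> carrier_vec n" using V' by (simp add: x_def)
    have "dagger V *\<^sub>v x = unit_vec n i" unfolding x_def using V by (intro unitary_cancel) auto
    moreover have "diagm n d *\<^sub>v unit_vec n i = d i \<cdot>\<^sub>v unit_vec n i"
    proof (rule eq_vecI)
      fix j assume "j < dim_vec (d i \<cdot>\<^sub>v unit_vec n i)"
      then show "(diagm n d *\<^sub>v unit_vec n i) $ j = (d i \<cdot>\<^sub>v unit_vec n i) $ j"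
        using i by (subst diagm_mult_vec) (auto simp: unit_vec_def)
    qed simp
    ultimately have "A *\<^sub>v x = d i \<cdot>\<^sub>v x"
      using A_app[OF x] V' by (simp add: x_def mult_mat_vec[of _ n n])
    moreover have "x \<noteq> 0\<^sub>v n"
    proof
      assume "x = 0\<^sub>v n"
      then have "unit_vec n i = dagger V *\<^sub>v 0\<^sub>v n" using \<open>dagger V *\<^sub>v x = unit_vec n i\<close> by simp
      also have "\<dots> = 0\<^sub>v n" using V' by (intro eq_vecI) auto
      finally show False using i by (metis index_unit_vec(2) index_zero_vec(1) zero_neq_one)
    qed
    ultimately show ?thesis using ev x by blast
  qed
  define w where "w = dagger V *\<^sub>v u"
  have w: "w \<in> carrier_vec n" using V' u by (simp add: w_def)
  have "nsq (A *\<^sub>v u) = nsq (diagm n d *\<^sub>v w)"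
    using A_app[OF u] w nsq_unitary[OF V mult_mat_vec_carrier[OF diagm_carrier w], of d]
    by (simp add: w_def[symmetric])
  also have "\<dots> = (\<Sum>i<n. (cmod (d i) * cmod (w $ i))\<^sup>2)"
    using w by (simp add: nsq_def diagm_mult_vec norm_mult del: index_mult_mat_vec)
  also have "\<dots> \<le> (\<Sum>i<n. (b * cmod (w $ i))\<^sup>2)"
    using d by (intro sum_mono power_mono mult_right_mono) auto
  also have "\<dots> = b\<^sup>2 * nsq w"
    using w by (simp add: nsq_def sum_distrib_left power_mult_distrib)
  also have "nsq w = nsq u" unfolding w_def using V u by (intro nsq_unitary unitary_dagger)
  finally have "sqrt (nsq (A *\<^sub>v u)) \<le> sqrt (b\<^sup>2 * nsq u)" by (rule real_sqrt_le_mono)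
  then show ?thesis using b by (simp add: vnorm_nsq real_sqrt_mult)
qed

subsection \<open>Kronecker products\<close>

text \<open>An index \<open>k\<close> of a Kronecker product encodes the pair
  \<open>(k div b, k mod b)\<close>; this reindexing is what the mixed-product rule rests
  on.\<close>

lemma sum_div_mod:
  fixes f :: "nat \<Rightarrow> nat \<Rightarrow> 'a::comm_monoid_add"
  shows "(\<Sum>k<a * b. f (k div b) (k mod b)) = (\<Sum>i<a. \<Sum>j<b. f i j)"
proof (cases "b = 0")
  case False
  have "bij_betw (\<lambda>k. (k div b, k mod b)) {..<a * b} ({..<a} \<times> {..<b})"
  proof (rule bij_betw_byWitness[where f' = "\<lambda>(i,j). i * b + j"])
    show "(\<lambda>(i,j). i * b + j) ` ({..<a} \<times> {..<b}) \<subseteq> {..<a * b}"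
    proof clarsimp
      fix i j assume "i < a" "j < b"
      then have "i * b + j < Suc i * b" "Suc i * b \<le> a * b" by (simp, intro mult_right_mono, auto)
      then show "i * b + j < a * b" by linarith
    qed
  qed (use False in \<open>auto simp: less_mult_imp_div_less\<close>)
  from sum.reindex_bij_betw[OF this, of "\<lambda>(i,j). f i j"] show ?thesis
    by (simp add: sum.cartesian_product)
qed simp

lemma kron_dim [simp]:
  "dim_row (kron A B) = dim_row A * dim_row B" "dim_col (kron A B) = dim_col A * dim_col B"
  by (simp_all add: kron_def)

lemma kron_carrier [simp, intro]:
  "A \<in> carrier_mat a b \<Longrightarrow> B \<in> carrier_mat c d \<Longrightarrow> kron A B \<in> carrier_mat (a * c) (b * d)"
  by auto

lemma kron_index:
  assumes "A \<in> carrier_mat a b" "B \<in> carrier_mat c d" "i < a * c" "j < b * d"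
  shows "kron A B $$ (i,j) = A $$ (i div c, j div d) * B $$ (i mod c, j mod d)"
  using assms by (auto simp: kron_def)

lemma div_mod_less:
  fixes x :: nat
  assumes "x < a * b" shows "x div b < a" "x mod b < b"
  using assms by (auto simp: less_mult_imp_div_less) (metis mod_less_divisor mult_0_right neq0_conv not_less0)

lemma kron_mult:
  assumes "A \<in> carrier_mat a b" "B \<in> carrier_mat c d" "A' \<in> carrier_mat b e" "B' \<in> carrier_mat d f"
  shows "kron A B * kron A' B' = kron (A * A') (B * B')"
proof (rule eq_matI)
  fix i j assume "i < dim_row (kron (A * A') (B * B'))" "j < dim_col (kron (A * A') (B * B'))"
  then have ij: "i < a * c" "j < e * f" using assms by auto
  note ij' = div_mod_less[OF ij(1)] div_mod_less[OF ij(2)]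
  have "(kron A B * kron A' B') $$ (i,j) = (\<Sum>k<b * d. (A $$ (i div c, k div d) * A' $$ (k div d, j div f))
     * (B $$ (i mod c, k mod d) * B' $$ (k mod d, j mod f)))"
    using assms ij by (subst index_mat_mult[of _ "a * c" "b * d" _ "e * f"])
      (auto simp: kron_index[OF assms(1,2)] kron_index[OF assms(3,4)] simp del: carrier_matD intro!: sum.cong)
  also have "\<dots> = (\<Sum>k<b. \<Sum>l<d. (A $$ (i div c, k) * A' $$ (k, j div f)) * (B $$ (i mod c, l) * B' $$ (l, j mod f)))"
    by (rule sum_div_mod)
  also have "\<dots> = (A * A') $$ (i div c, j div f) * (B * B') $$ (i mod c, j mod f)"
    using ij' by (simp add: index_mat_mult[OF assms(1,3)] index_mat_mult[OF assms(2,4)] sum_product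
        del: index_mult_mat)
  also have "\<dots> = kron (A * A') (B * B') $$ (i,j)"
    using ij assms by (subst kron_index[of _ a e _ c f]) auto
  finally show "(kron A B * kron A' B') $$ (i,j) = kron (A * A') (B * B') $$ (i,j)" .
qed (use assms in auto)

lemma kron_dagger: "dagger (kron A B) = kron (dagger A) (dagger B)"
proof (rule eq_matI)
  fix i j assume "i < dim_row (kron (dagger A) (dagger B))" "j < dim_col (kron (dagger A) (dagger B))"
  then have ij: "i < dim_col A * dim_col B" "j < dim_row A * dim_row B" by auto
  note ij' = div_mod_less[OF ij(1)] div_mod_less[OF ij(2)]
  show "dagger (kron A B) $$ (i,j) = kron (dagger A) (dagger B) $$ (i,j)"
    using ij ij' by (simp add: kron_def)
qed auto

lemma kron_diagm: "kron (diagm a d) (diagm b e) = diagm (a * b) (\<lambda>x. d (x div b) * e (x mod b))"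
proof (rule eq_matI)
  fix i j assume "i < dim_row (diagm (a * b) (\<lambda>x. d (x div b) * e (x mod b)))"
    "j < dim_col (diagm (a * b) (\<lambda>x. d (x div b) * e (x mod b)))"
  then have ij: "i < a * b" "j < a * b" by auto
  have "i = j" if "i div b = j div b" "i mod b = j mod b" using that by (metis div_mult_mod_eq)
  then show "kron (diagm a d) (diagm b e) $$ (i,j) = diagm (a * b) (\<lambda>x. d (x div b) * e (x mod b)) $$ (i,j)"
    using ij div_mod_less[OF ij(1)] div_mod_less[OF ij(2)]
    by (subst kron_index[of _ a a _ b b]) auto
qed auto

lemma kron_one: "kron (1\<^sub>m a) (1\<^sub>m b) = 1\<^sub>m (a * b)"
  using kron_diagm[of a "\<lambda>_. 1" b "\<lambda>_. 1"] by (simp add: diagm_one)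

subsection \<open>Representations of the unitary group\<close>

text \<open>\<open>g i j\<close> is the image of the matrix unit \<open>E\<^sub>i\<^sub>j\<close> under the complexified derived representation,
  the standard basis consists of weight vectors, and \<open>w x\<close> is the weight of the \<open>x\<close>-th one.\<close>

definition lie_map :: "nat \<Rightarrow> nat \<Rightarrow> (nat \<Rightarrow> nat \<Rightarrow> complex mat) \<Rightarrow> complex mat \<Rightarrow> complex mat" where
  "lie_map N D g X = mat D D (\<lambda>(x,y). \<Sum>i<N. \<Sum>j<N. X $$ (i,j) * g i j $$ (x,y))"

text \<open>These properties hold for the defining and the dual representation and pass to tensor
  products, so mixed tensor powers inherit them by induction. \<open>T_diag\<close> is restricted to
  unimodular \<open>l\<close> because the dual acts by conjugation, which is inversion only there.
  \<open>intertwine\<close> expresses equivariance under conjugation as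
  \<open>U * X = Y * U\<close>, without an inverse. \<open>c\<close> is the common total weight, and
  \<open>d\<close> bounds the sum of absolute weights.\<close>

locale urep =
  fixes N D :: nat and c d :: int
    and T :: "complex mat \<Rightarrow> complex mat" and g :: "nat \<Rightarrow> nat \<Rightarrow> complex mat"
    and w :: "nat \<Rightarrow> nat \<Rightarrow> int"
  assumes T_carrier: "U \<in> carrier_mat N N \<Longrightarrow> T U \<in> carrier_mat D D"
    and T_mult: "U \<in> carrier_mat N N \<Longrightarrow> V \<in> carrier_mat N N \<Longrightarrow> T (U * V) = T U * T V"
    and T_one: "T (1\<^sub>m N) = 1\<^sub>m D"
    and T_dagger: "U \<in> carrier_mat N N \<Longrightarrow> T (dagger U) = dagger (T U)"
    and T_diag: "(\<And>i. i < N \<Longrightarrow> cmod (l i) = 1) \<Longrightarrow>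
      T (diagm N l) = diagm D (\<lambda>x. \<Prod>i<N. l i powi w x i)"
    and g_carrier: "i < N \<Longrightarrow> j < N \<Longrightarrow> g i j \<in> carrier_mat D D"
    and g_dagger: "i < N \<Longrightarrow> j < N \<Longrightarrow> dagger (g i j) = g j i"
    and g_comm: "i < N \<Longrightarrow> j < N \<Longrightarrow> g i j * g j i - g j i * g i j = g i i - g j j"
    and g_diag: "i < N \<Longrightarrow> g i i = diagm D (\<lambda>x. of_int (w x i))"
    and g_shift: "i < N \<Longrightarrow> j < N \<Longrightarrow> x < D \<Longrightarrow> y < D \<Longrightarrow> g i j $$ (x,y) \<noteq> 0 \<Longrightarrow> k < N \<Longrightarrow>
      w x k = w y k + of_bool (k = i) - of_bool (k = j)"
    and intertwine: "unitary_mat N U \<Longrightarrow> X \<in> carrier_mat N N \<Longrightarrow> Y \<in> carrier_mat N N \<Longrightarrow>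
      U * X = Y * U \<Longrightarrow> T U * lie_map N D g X = lie_map N D g Y * T U"
    and charge: "x < D \<Longrightarrow> (\<Sum>i<N. w x i) = c"
    and size: "x < D \<Longrightarrow> (\<Sum>i<N. \<bar>w x i\<bar>) \<le> d"

lemma lie_map_carrier [simp]: "lie_map N D g X \<in> carrier_mat D D"
  by (simp add: lie_map_def)

lemma lie_map_dim [simp]: "dim_row (lie_map N D g X) = D" "dim_col (lie_map N D g X) = D"
  by (simp_all add: lie_map_def)

lemma lie_map_index:
  "x < D \<Longrightarrow> y < D \<Longrightarrow> lie_map N D g X $$ (x,y) = (\<Sum>i<N. \<Sum>j<N. X $$ (i,j) * g i j $$ (x,y))"
  by (simp add: lie_map_def)

section \<open>Matrix units; the defining, dual and trivial representations\<close>

definition mat_unit :: "nat \<Rightarrow> nat \<Rightarrow> nat \<Rightarrow> complex mat" where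
  "mat_unit n i j = mat n n (\<lambda>(x,y). if x = i \<and> y = j then 1 else 0)"

lemma mat_unit_carrier [simp]: "mat_unit n i j \<in> carrier_mat n n"
  by (simp add: mat_unit_def)

lemma mat_unit_index [simp]:
  "x < n \<Longrightarrow> y < n \<Longrightarrow> mat_unit n i j $$ (x,y) = (if x = i \<and> y = j then 1 else 0)"
  by (simp add: mat_unit_def)

lemma mat_unit_mult:
  assumes "j < n"
  shows "mat_unit n i j * mat_unit n j k = mat_unit n i k"
proof (rule eq_matI)
  fix x y assume "x < dim_row (mat_unit n i k)" "y < dim_col (mat_unit n i k)"
  then have xy: "x < n" "y < n" by (auto simp: mat_unit_def)
  have "(\<Sum>l<n. mat_unit n i j $$ (x, l) * mat_unit n j k $$ (l, y))
      = (\<Sum>l<n. if l = j then (if x = i \<and> y = k then 1 else 0) else 0)"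
    using xy by (intro sum.cong) auto
  then show "(mat_unit n i j * mat_unit n j k) $$ (x,y) = mat_unit n i k $$ (x,y)"
    using xy assms by (subst index_mat_mult[of _ n n _ n]) (auto simp: sum.delta)
qed (auto simp: mat_unit_def)

lemma sum_sum_delta:
  fixes f :: "nat \<Rightarrow> nat \<Rightarrow> complex"
  assumes "x < n" "y < n"
  shows "(\<Sum>i<n. \<Sum>j<n. f i j * (if x = i \<and> y = j then 1 else 0)) = f x y"
proof -
  have "(\<Sum>j<n. f i j * (if x = i \<and> y = j then 1 else 0)) = (if i = x then f x y else 0)" for i
    using assms by (cases "i = x") (auto simp: if_distrib[of "\<lambda>u. _ * u"] cong: if_cong)
  then show ?thesis using assms by simp
qed

lemma lie_map_mat_unit:
  assumes "X \<in> carrier_mat n n"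
  shows "lie_map n n (mat_unit n) X = X"
  using assms
  by (intro eq_matI) (auto simp: lie_map_index sum_sum_delta simp del: mult_zero_right mult_1_right)

text \<open>For skew-Hermitian X the entrywise conjugate is the negative transpose, so this is the
  complex-linear extension of the derivative of U \<mapsto> cnj U.\<close>

lemma lie_map_dual_mat_unit:
  assumes "X \<in> carrier_mat n n"
  shows "lie_map n n (\<lambda>i j. - mat_unit n j i) X = - X\<^sup>T"
proof (rule eq_matI)
  fix x y assume "x < dim_row (- X\<^sup>T)" "y < dim_col (- X\<^sup>T)"
  then have xy: "x < n" "y < n" using assms by auto
  have "(\<Sum>i<n. \<Sum>j<n. X $$ (i, j) * (- mat_unit n j i) $$ (x, y))
     = - (\<Sum>i<n. \<Sum>j<n. X $$ (i, j) * (if y = i \<and> x = j then 1 else 0))"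
    using xy by (auto simp: sum_negf[symmetric] mat_unit_def intro!: sum.cong)
  also have "\<dots> = - X $$ (y,x)" using sum_sum_delta[OF xy(2,1), of "\<lambda>i j. X $$ (i,j)"] by simp
  finally show "lie_map n n (\<lambda>i j. - mat_unit n j i) X $$ (x,y) = (- X\<^sup>T) $$ (x,y)"
    using xy assms by (simp add: lie_map_index)
qed (use assms in \<open>auto simp: lie_map_def\<close>)

lemma prod_powi_delta:
  fixes l :: "nat \<Rightarrow> complex"
  assumes "x < n"
  shows "(\<Prod>i<n. l i powi (of_bool (x = i) :: int)) = l x"
    "(\<Prod>i<n. l i powi - (of_bool (x = i) :: int)) = inverse (l x)"
proof -
  have "(\<Prod>i<n. l i powi of_bool (x = i)) = (\<Prod>i<n. if i = x then l i else 1)"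
    by (intro prod.cong) auto
  then show "(\<Prod>i<n. l i powi (of_bool (x = i) :: int)) = l x" using assms by (simp add: prod.delta)
  have "(\<Prod>i<n. l i powi - of_bool (x = i)) = (\<Prod>i<n. if i = x then inverse (l i) else 1)"
    by (intro prod.cong) (auto simp: power_int_minus)
  then show "(\<Prod>i<n. l i powi - (of_bool (x = i) :: int)) = inverse (l x)"
    using assms by (simp add: prod.delta)
qed

lemma urep_defining: "urep N N 1 1 (\<lambda>U. U) (mat_unit N) (\<lambda>x i. of_bool (x = i))"
proof
  show "mat_unit N i j * mat_unit N j i - mat_unit N j i * mat_unit N i j = mat_unit N i i - mat_unit N j j"
    if "i < N" "j < N" for i j
    using that by (simp add: mat_unit_mult)
  show "diagm N l = diagm N (\<lambda>x. \<Prod>i<N. l i powi of_bool (x = i))" for l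
    by (intro diagm_cong) (simp add: prod_powi_delta)
  show "dagger (mat_unit N i j) = mat_unit N j i" for i j
    by (intro eq_matI) (auto simp: mat_unit_def dagger_def cconj_mat_def)
  show "mat_unit N i i = diagm N (\<lambda>x. of_int (of_bool (x = i)))" for i
    by (intro eq_matI) (auto simp: mat_unit_def)
  show "(of_bool (x = k) :: int) = of_bool (y = k) + of_bool (k = i) - of_bool (k = j)"
    if "x < N" "y < N" "mat_unit N i j $$ (x, y) \<noteq> 0" for i j x y k
    using that by (auto split: if_splits)
  show "U * lie_map N N (mat_unit N) X = lie_map N N (mat_unit N) Y * U"
    if "X \<in> carrier_mat N N" "Y \<in> carrier_mat N N" "U * X = Y * U" for U X Y
    using that by (simp add: lie_map_mat_unit)
qed auto

lemma cconj_mult: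
  assumes "A \<in> carrier_mat n m" "B \<in> carrier_mat m k"
  shows "cconj_mat (A * B) = cconj_mat A * cconj_mat B"
proof (rule eq_matI)
  fix i j assume "i < dim_row (cconj_mat A * cconj_mat B)" "j < dim_col (cconj_mat A * cconj_mat B)"
  then have ij: "i < n" "j < k" using assms by auto
  have "cconj_mat (A * B) $$ (i,j) = cnj ((A * B) $$ (i,j))" using ij assms by simp
  also have "\<dots> = (\<Sum>l<m. cconj_mat A $$ (i,l) * cconj_mat B $$ (l,j))"
    using ij assms by (simp add: index_mat_mult[OF assms] del: index_mult_mat)
  also have "\<dots> = (cconj_mat A * cconj_mat B) $$ (i,j)"
    using ij assms by (subst index_mat_mult[of _ n m _ k]) auto
  finally show "cconj_mat (A * B) $$ (i,j) = (cconj_mat A * cconj_mat B) $$ (i,j)" .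
qed (use assms in auto)

lemma urep_conjugate: "urep N N (-1) 1 cconj_mat (\<lambda>i j. - mat_unit N j i) (\<lambda>x i. - of_bool (x = i))"
proof
  show "cconj_mat (U * V) = cconj_mat U * cconj_mat V" if "U \<in> carrier_mat N N" "V \<in> carrier_mat N N" for U V
    using that by (rule cconj_mult)
  show "cconj_mat (1\<^sub>m N) = 1\<^sub>m N" "cconj_mat (dagger U) = dagger (cconj_mat U)" for U
    by (auto intro!: eq_matI simp: cconj_mat_def dagger_def)
  have nn: "(- A) * (- B) = A * B" if "A \<in> carrier_mat N N" "B \<in> carrier_mat N N" for A B :: "complex mat"
    using that by simp
  show "- mat_unit N j i * - mat_unit N i j - - mat_unit N i j * - mat_unit N j i
      = - mat_unit N i i - - mat_unit N j j"
    if "i < N" "j < N" for i j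
    using that by (simp add: nn mat_unit_mult) (auto intro!: eq_matI simp: mat_unit_def)
  show "cconj_mat (diagm N l) = diagm N (\<lambda>x. \<Prod>i<N. l i powi - of_bool (x = i))"
    if l: "\<And>i. i < N \<Longrightarrow> cmod (l i) = 1" for l
  proof -
    have "cnj (l x) = inverse (l x)" if "x < N" for x
    proof -
      have "cmod (l x) = 1" using l[OF that] .
      then have "l x * cnj (l x) = 1" by (simp add: complex_norm_square[symmetric])
      then show ?thesis by (metis inverse_unique)
    qed
    then show ?thesis
      by (intro eq_matI) (auto simp: prod_powi_delta)
  qed
  show "dagger (- mat_unit N j i) = - mat_unit N i j" for i j
    by (intro eq_matI) (auto simp: mat_unit_def dagger_def cconj_mat_def)
  show "- mat_unit N i i = diagm N (\<lambda>x. of_int (- of_bool (x = i)))" for i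
    by (intro eq_matI) (auto simp: mat_unit_def)
  show "(- of_bool (x = k) :: int) = - of_bool (y = k) + of_bool (k = i) - of_bool (k = j)"
    if "x < N" "y < N" "(- mat_unit N j i) $$ (x, y) \<noteq> 0" for i j x y k
    using that by (auto simp: mat_unit_def split: if_splits)
  show "cconj_mat U * lie_map N N (\<lambda>i j. - mat_unit N j i) X
      = lie_map N N (\<lambda>i j. - mat_unit N j i) Y * cconj_mat U"
    if U: "unitary_mat N U" and X: "X \<in> carrier_mat N N" and Y: "Y \<in> carrier_mat N N"
      and UXY: "U * X = Y * U" for U X Y
  proof -
    note U' = unitary_matD[OF U]
    \<comment> \<open>Multiplying by \<open>dagger U\<close> on both sides gives
      \<open>dagger U * Y = X * dagger U\<close>. Its transpose is the required relation, because
      the transpose of \<open>dagger U\<close> is \<open>cconj_mat U\<close>.\<close>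
    have "dagger U * (Y * U) * dagger U = dagger U * (U * X) * dagger U" by (simp add: UXY)
    moreover have "dagger U * (Y * U) * dagger U = dagger U * Y * (U * dagger U)"
      using U'(1) Y by (simp add: assoc_mult_mat[of _ N N _ N _ N])
    moreover have "dagger U * (U * X) * dagger U = (dagger U * U) * (X * dagger U)"
      using U'(1) X by (simp add: assoc_mult_mat[of _ N N _ N _ N])
    ultimately have "dagger U * Y = X * dagger U" using U' X Y by simp
    then have "(X * dagger U)\<^sup>T = (dagger U * Y)\<^sup>T" by simp
    moreover have "(dagger U)\<^sup>T = cconj_mat U" by (simp add: dagger_def)
    ultimately have "cconj_mat U * X\<^sup>T = Y\<^sup>T * cconj_mat U"
      using U' X Y by (simp add: transpose_mult[of _ N N _ N])
    then show ?thesis using U' X Y by (simp add: lie_map_dual_mat_unit)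
  qed
qed (auto simp: sum_negf)

lemma urep_trivial: "urep N 1 0 0 (\<lambda>_. 1\<^sub>m 1) (\<lambda>_ _. 0\<^sub>m 1 1) (\<lambda>_ _. 0)"
proof
  show "1\<^sub>m 1 * lie_map N 1 (\<lambda>_ _. 0\<^sub>m 1 1) X = lie_map N 1 (\<lambda>_ _. 0\<^sub>m 1 1) Y * 1\<^sub>m 1" for X Y
    by (auto intro!: eq_matI simp: lie_map_def)
qed (auto intro!: eq_matI)

section \<open>Tensor products and mixed tensor powers of representations\<close>

lemma kron_sum_mult:
  fixes a a' b b' :: "complex mat"
  assumes a: "a \<in> carrier_mat m m" "a' \<in> carrier_mat m m" and b: "b \<in> carrier_mat n n" "b' \<in> carrier_mat n n"
  shows "(kron a (1\<^sub>m n) + kron (1\<^sub>m m) b) * (kron a' (1\<^sub>m n) + kron (1\<^sub>m m) b')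
     = (kron (a * a') (1\<^sub>m n) + kron a' b) + (kron a b' + kron (1\<^sub>m m) (b * b'))"
proof -
  have c: "kron u v \<in> carrier_mat (m * n) (m * n)" if "u \<in> carrier_mat m m" "v \<in> carrier_mat n n" for u v
    using that by (rule kron_carrier)
  show ?thesis
    using a b
    by (simp add: c kron_mult[of _ m m _ n n _ m _ n] add_mult_distrib_mat[of _ "m * n" "m * n" _ _ "m * n"]
        mult_add_distrib_mat[of _ "m * n" "m * n" _ "m * n"])
qed

lemma lie_map_kron:
  assumes g1: "\<And>i j. i < N \<Longrightarrow> j < N \<Longrightarrow> g1 i j \<in> carrier_mat D1 D1"
    and g2: "\<And>i j. i < N \<Longrightarrow> j < N \<Longrightarrow> g2 i j \<in> carrier_mat D2 D2"
  shows "lie_map N (D1 * D2) (\<lambda>i j. kron (g1 i j) (1\<^sub>m D2) + kron (1\<^sub>m D1) (g2 i j)) X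
    = kron (lie_map N D1 g1 X) (1\<^sub>m D2) + kron (1\<^sub>m D1) (lie_map N D2 g2 X)"
proof (rule eq_matI)
  fix x y assume "x < dim_row (kron (lie_map N D1 g1 X) (1\<^sub>m D2) + kron (1\<^sub>m D1) (lie_map N D2 g2 X))"
    "y < dim_col (kron (lie_map N D1 g1 X) (1\<^sub>m D2) + kron (1\<^sub>m D1) (lie_map N D2 g2 X))"
  then have xy: "x < D1 * D2" "y < D1 * D2" by (auto simp: lie_map_def)
  note b = div_mod_less[OF xy(1)] div_mod_less[OF xy(2)]
  have "(kron (g1 i j) (1\<^sub>m D2) + kron (1\<^sub>m D1) (g2 i j)) $$ (x,y)
     = g1 i j $$ (x div D2, y div D2) * 1\<^sub>m D2 $$ (x mod D2, y mod D2)
      + 1\<^sub>m D1 $$ (x div D2, y div D2) * g2 i j $$ (x mod D2, y mod D2)" if "i < N" "j < N" for i j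
    using xy g1[OF that] g2[OF that]
    by (simp add: kron_index[of _ D1 D1 _ D2 D2] del: index_one_mat(1))
  then show "lie_map N (D1 * D2) (\<lambda>i j. kron (g1 i j) (1\<^sub>m D2) + kron (1\<^sub>m D1) (g2 i j)) X $$ (x,y)
    = (kron (lie_map N D1 g1 X) (1\<^sub>m D2) + kron (1\<^sub>m D1) (lie_map N D2 g2 X)) $$ (x,y)"
    using xy b
    by (simp add: lie_map_index kron_index[of _ D1 D1 _ D2 D2] distrib_left sum.distrib
          sum_distrib_left sum_distrib_right mult.assoc mult.left_commute del: index_one_mat(1))
qed (auto simp: lie_map_def)

text \<open>The derived action follows the Leibniz rule, so weights add. Total charges therefore add
  exactly, and the bounds on absolute weights add by the triangle inequality.\<close>

lemma urep_kron:
  assumes "urep N D1 c1 d1 T1 g1 w1" "urep N D2 c2 d2 T2 g2 w2"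
  shows "urep N (D1 * D2) (c1 + c2) (d1 + d2) (\<lambda>U. kron (T1 U) (T2 U))
    (\<lambda>i j. kron (g1 i j) (1\<^sub>m D2) + kron (1\<^sub>m D1) (g2 i j))
    (\<lambda>x i. w1 (x div D2) i + w2 (x mod D2) i)"
proof -
  interpret a: urep N D1 c1 d1 T1 g1 w1 by fact
  interpret b: urep N D2 c2 d2 T2 g2 w2 by fact
  let ?g = "\<lambda>i j. kron (g1 i j) (1\<^sub>m D2) + kron (1\<^sub>m D1) (g2 i j)"
  let ?w = "\<lambda>x i. w1 (x div D2) i + w2 (x mod D2) i"
  have gd: "dim_row (g1 i j) = D1" "dim_col (g1 i j) = D1" "dim_row (g2 i j) = D2" "dim_col (g2 i j) = D2"
    if "i < N" "j < N" for i j
    using a.g_carrier[OF that] b.g_carrier[OF that] by auto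
  have gi: "?g i j $$ (x,y) = g1 i j $$ (x div D2, y div D2) * of_bool (x mod D2 = y mod D2)
      + of_bool (x div D2 = y div D2) * g2 i j $$ (x mod D2, y mod D2)"
    if "i < N" "j < N" "x < D1 * D2" "y < D1 * D2" for i j x y
    using that a.g_carrier[OF that(1,2)] b.g_carrier[OF that(1,2)]
      div_mod_less[OF that(3)] div_mod_less[OF that(4)]
    by (simp add: kron_index[of _ D1 D1 _ D2 D2])
  have eq: "x = y \<longleftrightarrow> x div D2 = y div D2 \<and> x mod D2 = y mod D2" for x y
    by (metis div_mult_mod_eq)
  show ?thesis
  proof
    show "kron (T1 U) (T2 U) \<in> carrier_mat (D1 * D2) (D1 * D2)" if "U \<in> carrier_mat N N" for U
      using that by (intro kron_carrier a.T_carrier b.T_carrier)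
    show "kron (T1 (U * V)) (T2 (U * V)) = kron (T1 U) (T2 U) * kron (T1 V) (T2 V)"
      if "U \<in> carrier_mat N N" "V \<in> carrier_mat N N" for U V
      using that by (simp add: a.T_mult b.T_mult
          kron_mult[of _ D1 D1 _ D2 D2 _ D1 _ D2] a.T_carrier b.T_carrier)
    show "kron (T1 (1\<^sub>m N)) (T2 (1\<^sub>m N)) = 1\<^sub>m (D1 * D2)"
      by (simp add: a.T_one b.T_one kron_one)
    show "kron (T1 (dagger U)) (T2 (dagger U)) = dagger (kron (T1 U) (T2 U))"
      if "U \<in> carrier_mat N N" for U using that by (simp add: a.T_dagger b.T_dagger kron_dagger)
    show "kron (T1 (diagm N l)) (T2 (diagm N l)) = diagm (D1 * D2) (\<lambda>x. \<Prod>i<N. l i powi ?w x i)"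
      if l: "\<And>i. i < N \<Longrightarrow> cmod (l i) = 1" for l
    proof -
      have "l i \<noteq> 0" if "i < N" for i using l[OF that] by auto
      then have "(\<Prod>i<N. l i powi ?w x i)
          = (\<Prod>i<N. l i powi w1 (x div D2) i) * (\<Prod>i<N. l i powi w2 (x mod D2) i)" for x
        unfolding prod.distrib[symmetric] by (intro prod.cong refl power_int_add) auto
      then show ?thesis
        by (simp only: a.T_diag[of l, OF l] b.T_diag[of l, OF l] kron_diagm)
    qed
    show "?g i j \<in> carrier_mat (D1 * D2) (D1 * D2)" if "i < N" "j < N" for i j
      using a.g_carrier[OF that] b.g_carrier[OF that] by auto
    show "dagger (?g i j) = ?g j i" if "i < N" "j < N" for i j
    proof -
      have ag: "cnj (g1 i j $$ (y,x)) = g1 j i $$ (x,y)" if "x < D1" "y < D1" for x y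
        using a.g_dagger[OF \<open>i < N\<close> \<open>j < N\<close>] a.g_carrier[OF \<open>i < N\<close> \<open>j < N\<close>] that
        by (metis carrier_matD dagger_index)
      have bg: "cnj (g2 i j $$ (y,x)) = g2 j i $$ (x,y)" if "x < D2" "y < D2" for x y
        using b.g_dagger[OF \<open>i < N\<close> \<open>j < N\<close>] b.g_carrier[OF \<open>i < N\<close> \<open>j < N\<close>] that
        by (metis carrier_matD dagger_index)
      note c = a.g_carrier[OF that] b.g_carrier[OF that] a.g_carrier[OF that(2,1)] b.g_carrier[OF that(2,1)]
      show ?thesis
      proof (rule eq_matI)
        fix x y assume "x < dim_row (?g j i)" "y < dim_col (?g j i)"
        then have xy: "x < D1 * D2" "y < D1 * D2" using c by auto
        then have "dagger (?g i j) $$ (x,y) = cnj (?g i j $$ (y,x))"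
          using c by (intro dagger_index) auto
        also have "\<dots> = ?g j i $$ (x,y)"
          using that xy div_mod_less[OF xy(1)] div_mod_less[OF xy(2)]
          by (simp only: gi) (auto simp: ag bg)
        finally show "dagger (?g i j) $$ (x,y) = ?g j i $$ (x,y)" .
      qed (use c in auto)
    qed
    show "?g i j * ?g j i - ?g j i * ?g i j = ?g i i - ?g j j" if ij: "i < N" "j < N" for i j
    proof (rule eq_matI)
      note c = a.g_carrier[OF ij] a.g_carrier[OF ij(2,1)] b.g_carrier[OF ij] b.g_carrier[OF ij(2,1)]
        a.g_carrier[OF ij(1) ij(1)] a.g_carrier[OF ij(2) ij(2)]
        b.g_carrier[OF ij(1) ij(1)] b.g_carrier[OF ij(2) ij(2)]
      fix x y assume "x < dim_row (?g i i - ?g j j)" "y < dim_col (?g i i - ?g j j)"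
      then have xy: "x < D1 * D2" "y < D1 * D2" using c by auto
      note bd = div_mod_less[OF xy(1)] div_mod_less[OF xy(2)]
      let ?x = "x div D2" and ?x' = "x mod D2" and ?y = "y div D2" and ?y' = "y mod D2"
      have A: "(g1 i j * g1 j i) $$ (?x,?y) - (g1 j i * g1 i j) $$ (?x,?y) = g1 i i $$ (?x,?y) - g1 j j $$ (?x,?y)"
        using arg_cong[OF a.g_comm[OF ij], of "\<lambda>m. m $$ (?x,?y)"] c bd by (simp del: index_mult_mat(1))
      have B: "(g2 i j * g2 j i) $$ (?x',?y') - (g2 j i * g2 i j) $$ (?x',?y') = g2 i i $$ (?x',?y') - g2 j j $$ (?x',?y')"
        using arg_cong[OF b.g_comm[OF ij], of "\<lambda>m. m $$ (?x',?y')"] c bd by (simp del: index_mult_mat(1))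
      \<comment> \<open>The mixed terms, in which each tensor factor is hit once, are the same in
        both products and cancel; the commutators of the two factors remain.\<close>
      have "(?g i j * ?g j i - ?g j i * ?g i j) $$ (x,y)
        = ((g1 i j * g1 j i) $$ (?x,?y) - (g1 j i * g1 i j) $$ (?x,?y)) * 1\<^sub>m D2 $$ (?x',?y')
          + 1\<^sub>m D1 $$ (?x,?y) * ((g2 i j * g2 j i) $$ (?x',?y') - (g2 j i * g2 i j) $$ (?x',?y'))"
        unfolding kron_sum_mult[OF c(1,2,3,4)] kron_sum_mult[OF c(2,1,4,3)]
        using c xy by (simp add: kron_index[of _ D1 D1 _ D2 D2] algebra_simps del: index_mult_mat(1) index_one_mat(1))
      also have "\<dots> = (?g i i - ?g j j) $$ (x,y)"
        unfolding A B
        using c xy by (simp add: kron_index[of _ D1 D1 _ D2 D2] algebra_simps del: index_one_mat(1))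
      finally show "(?g i j * ?g j i - ?g j i * ?g i j) $$ (x,y) = (?g i i - ?g j j) $$ (x,y)" .
    qed (use ij in \<open>auto simp: gd\<close>)
    show "?g i i = diagm (D1 * D2) (\<lambda>x. of_int (?w x i))" if "i < N" for i
    proof (rule eq_matI)
      fix x y assume "x < dim_row (diagm (D1 * D2) (\<lambda>x. of_int (?w x i)))"
        "y < dim_col (diagm (D1 * D2) (\<lambda>x. of_int (?w x i)))"
      then have xy: "x < D1 * D2" "y < D1 * D2" by auto
      show "?g i i $$ (x,y) = diagm (D1 * D2) (\<lambda>x. of_int (?w x i)) $$ (x,y)"
        unfolding gi[OF that that xy]
        using div_mod_less[OF xy(1)] div_mod_less[OF xy(2)] xy eq[of x y]
        by (auto simp: a.g_diag[OF that] b.g_diag[OF that])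
    qed (use that in \<open>auto simp: gd\<close>)
    show "?w x k = ?w y k + of_bool (k = i) - of_bool (k = j)"
      if h: "i < N" "j < N" "x < D1 * D2" "y < D1 * D2" "?g i j $$ (x,y) \<noteq> 0" "k < N" for i j x y k
    proof -
      note bd = div_mod_less[OF h(3)] div_mod_less[OF h(4)]
      \<comment> \<open>A nonzero entry comes from one of the two Leibniz terms, in which the index
        of the other factor is unchanged; so only one of the two weights is shifted.\<close>
      have "(g1 i j $$ (x div D2, y div D2) \<noteq> 0 \<and> x mod D2 = y mod D2)
         \<or> (x div D2 = y div D2 \<and> g2 i j $$ (x mod D2, y mod D2) \<noteq> 0)"
        using h(5) unfolding gi[OF h(1-4)] by auto
      then show ?thesis
        using a.g_shift[OF h(1,2) bd(1,3) _ h(6)] b.g_shift[OF h(1,2) bd(2,4) _ h(6)] by auto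
    qed
    show "kron (T1 U) (T2 U) * lie_map N (D1 * D2) ?g X = lie_map N (D1 * D2) ?g Y * kron (T1 U) (T2 U)"
      if "unitary_mat N U" "X \<in> carrier_mat N N" "Y \<in> carrier_mat N N" "U * X = Y * U" for U X Y
    proof -
      have U: "U \<in> carrier_mat N N" using that by (simp add: unitary_mat_def)
      have c: "kron u v \<in> carrier_mat (D1 * D2) (D1 * D2)"
        if "u \<in> carrier_mat D1 D1" "v \<in> carrier_mat D2 D2" for u v
        using that by (rule kron_carrier)
      show ?thesis
        using a.T_carrier[OF U] b.T_carrier[OF U] a.intertwine[OF that] b.intertwine[OF that]
        by (simp add: lie_map_kron a.g_carrier b.g_carrier c kron_mult[of _ D1 D1 _ D2 D2 _ D1 _ D2]
            add_mult_distrib_mat[of _ "D1 * D2" "D1 * D2" _ _ "D1 * D2"]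
            mult_add_distrib_mat[of _ "D1 * D2" "D1 * D2" _ "D1 * D2"])
    qed
    show "(\<Sum>i<N. ?w x i) = c1 + c2" if "x < D1 * D2" for x
      using div_mod_less[OF that] by (simp add: sum.distrib a.charge b.charge)
    show "(\<Sum>i<N. \<bar>?w x i\<bar>) \<le> d1 + d2" if "x < D1 * D2" for x
    proof -
      have "(\<Sum>i<N. \<bar>?w x i\<bar>) \<le> (\<Sum>i<N. \<bar>w1 (x div D2) i\<bar> + \<bar>w2 (x mod D2) i\<bar>)"
        by (intro sum_mono) auto
      also have "\<dots> \<le> d1 + d2"
        using a.size[OF div_mod_less(1)[OF that]] b.size[OF div_mod_less(2)[OF that]]
        by (simp add: sum.distrib)
      finally show ?thesis .
    qed
  qed
qed

lemma urep_tensor_pow: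
  assumes "urep N D c d T g w"
  shows "\<exists>g' w'. urep N (D ^ k) (int k * c) (int k * d) (\<lambda>U. tensor_pow (T U) k) g' w'"
proof (induction k)
  case 0
  show ?case using urep_trivial[of N] by auto
next
  case (Suc k)
  then obtain g' w' where *: "urep N (D ^ k) (int k * c) (int k * d) (\<lambda>U. tensor_pow (T U) k) g' w'" by blast
  have e: "D ^ Suc k = D * D ^ k" "int (Suc k) * c = c + int k * c" "int (Suc k) * d = d + int k * d"
    by (simp_all add: algebra_simps)
  show ?case unfolding tensor_pow.simps(2) e by (rule exI, rule exI, rule urep_kron[OF assms *])
qed

text \<open>Charges t and -t cancel, whereas absolute weights add up to t + t. These two numbers are
  the only information about t that the weight inequalities receive. The choice of \<open>g\<close>
  and \<open>w\<close> does not matter beyond the axioms.\<close>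

lemma urep_mixed_tensor:
  "\<exists>g w. urep N (N ^ (2 * t)) 0 (2 * int t)
     (\<lambda>U. kron (tensor_pow U t) (tensor_pow (cconj_mat U) t)) g w"
proof -
  obtain g1 w1 where 1: "urep N (N ^ t) (int t * 1) (int t * 1) (\<lambda>U. tensor_pow U t) g1 w1"
    using urep_tensor_pow[OF urep_defining] by blast
  obtain g2 w2 where 2: "urep N (N ^ t) (int t * - 1) (int t * 1) (\<lambda>U. tensor_pow (cconj_mat U) t) g2 w2"
    using urep_tensor_pow[OF urep_conjugate] by blast
  have e: "N ^ t * N ^ t = N ^ (2 * t)" "int t * 1 + int t * - 1 = 0" "int t * 1 + int t * 1 = 2 * int t"
    by (simp_all only: mult_2 power_add)
  note 3 = urep_kron[OF 1 2, unfolded e]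
  show ?thesis by (rule exI, rule exI, rule 3)
qed

subsection \<open>The Casimir form\<close>

definition restr :: "(nat \<Rightarrow> bool) \<Rightarrow> complex vec \<Rightarrow> complex vec" where
  "restr P v = vec (dim_vec v) (\<lambda>x. if P x then v $ x else 0)"

lemma restr_carrier [simp]: "restr P v \<in> carrier_vec n \<longleftrightarrow> v \<in> carrier_vec n"
  unfolding carrier_dim_vec by (simp add: restr_def)

lemma restr_index [simp]: "x < dim_vec v \<Longrightarrow> restr P v $ x = (if P x then v $ x else 0)"
  by (simp add: restr_def)

lemma restr_dim [simp]: "dim_vec (restr P v) = dim_vec v"
  by (simp add: restr_def)

lemma restr_add_restr_not: "restr P v + restr (\<lambda>x. \<not> P x) v = v"
  by (rule eq_vecI) auto

lemma cip_add_left: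
  "v \<in> carrier_vec n \<Longrightarrow> v' \<in> carrier_vec n \<Longrightarrow> cip (v + v') u = cip v u + cip v' u"
  by (auto simp: cip_def distrib_right sum.distrib)

lemma cip_add_right:
  "v \<in> carrier_vec n \<Longrightarrow> u \<in> carrier_vec n \<Longrightarrow> u' \<in> carrier_vec n \<Longrightarrow> cip v (u + u') = cip v u + cip v u'"
  by (auto simp: cip_def distrib_left sum.distrib)

lemma cip_cnj: "dim_vec v = dim_vec u \<Longrightarrow> cnj (cip v u) = cip u v"
  by (simp add: cip_def mult.commute)

lemma nsq_mono:
  assumes "dim_vec v = dim_vec u" "\<And>x. x < dim_vec v \<Longrightarrow> cmod (v $ x) \<le> cmod (u $ x)"
  shows "nsq v \<le> nsq u"
  using assms by (auto simp: nsq_def intro!: sum_mono power_mono)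

text \<open>The hypothesis says that columns in \<open>P\<close> feed only rows in \<open>Q\<close>
  and the other columns only the other rows. Restricting the argument thus only deletes rows of the
  product.\<close>

lemma nsq_restr_mult_le:
  assumes A: "A \<in> carrier_mat n n" and v: "v \<in> carrier_vec n"
    and PQ: "\<And>x y. x < n \<Longrightarrow> y < n \<Longrightarrow> A $$ (x,y) \<noteq> 0 \<Longrightarrow> P y \<longleftrightarrow> Q x"
  shows "nsq (A *\<^sub>v restr P v) \<le> nsq (A *\<^sub>v v)"
proof (rule nsq_mono)
  fix x assume "x < dim_vec (A *\<^sub>v restr P v)"
  then have x: "x < n" using A by auto
  have "(A *\<^sub>v restr P v) $ x = (\<Sum>y<n. A $$ (x,y) * restr P v $ y)"
    using A v x by (intro index_mat_vec) auto
  also have "\<dots> = (\<Sum>y<n. if Q x then A $$ (x,y) * v $ y else 0)"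
    using PQ[OF x] v by (intro sum.cong) auto
  also have "\<dots> = (if Q x then (A *\<^sub>v v) $ x else 0)"
    using index_mat_vec[OF A v x] by simp
  finally show "cmod ((A *\<^sub>v restr P v) $ x) \<le> cmod ((A *\<^sub>v v) $ x)" by simp
qed (use A in auto)

context urep
begin

text \<open>The sesquilinear form of the Casimir operator Q, as \<open>g j i\<close> is the adjoint
  of \<open>g i j\<close>. The form suffices throughout, so Q is not built as a matrix.\<close>

definition casimir_form :: "complex vec \<Rightarrow> complex vec \<Rightarrow> complex" where
  "casimir_form v u = of_nat N * (\<Sum>i<N. \<Sum>j<N. cip (g i j *\<^sub>v v) (g i j *\<^sub>v u))"

definition casimir :: "complex vec \<Rightarrow> real" where
  "casimir v = real N * (\<Sum>i<N. \<Sum>j<N. nsq (g i j *\<^sub>v v))"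

text \<open>Up to the factor \<open>N\<close> this is the Casimir eigenvalue of the irreducible
  representation of gl(N) whose highest weight is the decreasing rearrangement of
  \<open>w x\<close>: sum of squares plus the sum of |w_i - w_j| over i < j. Halving accounts for
  ordered pairs.\<close>

definition casimir_weight :: "nat \<Rightarrow> real" where
  "casimir_weight x = real N * ((\<Sum>i<N. (real_of_int (w x i))\<^sup>2) +
     (\<Sum>i<N. \<Sum>j<N. \<bar>real_of_int (w x i - w x j)\<bar>) / 2)"

lemma casimir_form_self: "casimir_form v v = of_real (casimir v)"
  by (simp add: casimir_form_def casimir_def cip_self)

lemma casimir_nonneg: "casimir v \<ge> 0"
  by (simp add: casimir_def sum_nonneg)

text \<open>The difference is the expectation in \<open>u\<close> of the commutator of
  \<open>g j i\<close> and \<open>g i j\<close>, which is \<open>g j j - g i i\<close> and hence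
  diagonal in the weight basis.\<close>

lemma nsq_g_diff:
  assumes ij: "i < N" "j < N" and u: "u \<in> carrier_vec D"
  shows "nsq (g i j *\<^sub>v u) - nsq (g j i *\<^sub>v u)
     = (\<Sum>x<D. real_of_int (w x j - w x i) * (cmod (u $ x))\<^sup>2)"
proof -
  have nn: "complex_of_real (nsq (g i j *\<^sub>v u)) = cip u ((g j i * g i j) *\<^sub>v u)"
    if ij: "i < N" "j < N" for i j
    using g_carrier[OF ij] g_carrier[OF ij(2,1)] u g_dagger[OF ij]
    by (simp add: cip_self[symmetric] cip_mat_vec[of _ D D] assoc_mult_mat_vec[of _ D D _ D])
  note c = g_carrier[OF ij] g_carrier[OF ij(2,1)]
  have "(g j i * g i j) *\<^sub>v u = (g i j * g j i) *\<^sub>v u + diagm D (\<lambda>x. of_int (w x j - w x i)) *\<^sub>v u"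
  proof -
    have "g j i * g i j = g i j * g j i + diagm D (\<lambda>x. of_int (w x j - w x i))"
    proof (rule eq_matI)
      fix x y assume "x < dim_row (g i j * g j i + diagm D (\<lambda>x. of_int (w x j - w x i)))"
        "y < dim_col (g i j * g j i + diagm D (\<lambda>x. of_int (w x j - w x i)))"
      then have xy: "x < D" "y < D" by auto
      then show "(g j i * g i j) $$ (x,y) = (g i j * g j i + diagm D (\<lambda>x. of_int (w x j - w x i))) $$ (x,y)"
        using arg_cong[OF g_comm[OF ij(2,1)], of "\<lambda>m. m $$ (x,y)"] c
        by (simp add: g_diag ij algebra_simps del: index_mult_mat(1) split: if_splits)
    qed (use c in auto)
    then show ?thesis using c u by (simp add: add_mult_distrib_mat_vec[of _ D D])
  qed
  then have "complex_of_real (nsq (g i j *\<^sub>v u)) = complex_of_real (nsq (g j i *\<^sub>v u))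
      + cip u (diagm D (\<lambda>x. of_int (w x j - w x i)) *\<^sub>v u)"
    unfolding nn[OF ij] nn[OF ij(2,1)]
    using c u cip_add_right[of u D "(g i j * g j i) *\<^sub>v u" "diagm D (\<lambda>x. of_int (w x j - w x i)) *\<^sub>v u"]
      mult_mat_vec_carrier[OF mult_carrier_mat[OF c] u] mult_mat_vec_carrier[OF diagm_carrier u]
    by simp
  moreover have "cip u (diagm D (\<lambda>x. of_int (w x j - w x i)) *\<^sub>v u)
      = complex_of_real (\<Sum>x<D. real_of_int (w x j - w x i) * (cmod (u $ x))\<^sup>2)"
    using u by (auto simp: cip_def diagm_mult_vec complex_norm_square mult_ac
        simp del: index_mult_mat_vec of_real_power intro!: sum.cong)
  ultimately have "complex_of_real (nsq (g i j *\<^sub>v u))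
      = complex_of_real (nsq (g j i *\<^sub>v u) + (\<Sum>x<D. real_of_int (w x j - w x i) * (cmod (u $ x))\<^sup>2))"
    by (simp only: of_real_add)
  then show ?thesis by (simp only: of_real_eq_iff)
qed

text \<open>\<open>g i j\<close> raises \<open>w x i - w x j\<close> by 2, so the parts of \<open>v\<close> with negative and with nonnegative
  difference can be treated separately; on each of them the commutator relation gives the bound.\<close>
lemma nsq_root_pair_ge:
  assumes ij: "i < N" "j < N" "i \<noteq> j" and v: "v \<in> carrier_vec D"
  shows "(\<Sum>x<D. \<bar>real_of_int (w x i - w x j)\<bar> * (cmod (v $ x))\<^sup>2)
     \<le> nsq (g i j *\<^sub>v v) + nsq (g j i *\<^sub>v v)"
proof -
  define P where "P x \<longleftrightarrow> w x i - w x j < 0" for x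
  let ?m = "restr P v" and ?p = "restr (\<lambda>x. \<not> P x) v"
  have m: "?m \<in> carrier_vec D" and p: "?p \<in> carrier_vec D" using v by simp_all
  have shift: "w x i - w x j = w y i - w y j + 2" if "x < D" "y < D" "g i j $$ (x,y) \<noteq> 0" for x y
    using g_shift[OF ij(1,2) that ij(1)] g_shift[OF ij(1,2) that ij(2)] ij(3) by auto
  have shift': "w x i - w x j = w y i - w y j - 2" if "x < D" "y < D" "g j i $$ (x,y) \<noteq> 0" for x y
    using g_shift[OF ij(2,1) that ij(1)] g_shift[OF ij(2,1) that ij(2)] ij(3) by auto
  \<comment> \<open>The thresholds 2 and -2 for the rows are the column threshold 0 moved by the
    shift of the respective operator.\<close>
  have "nsq (g i j *\<^sub>v ?m) \<le> nsq (g i j *\<^sub>v v)"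
    using shift by (intro nsq_restr_mult_le[OF g_carrier[OF ij(1,2)] v, where Q = "\<lambda>x. w x i - w x j < 2"])
      (auto simp: P_def)
  moreover have "nsq (g j i *\<^sub>v ?p) \<le> nsq (g j i *\<^sub>v v)"
    using shift' by (intro nsq_restr_mult_le[OF g_carrier[OF ij(2,1)] v, where Q = "\<lambda>x. w x i - w x j \<ge> -2"])
      (auto simp: P_def)
  moreover have "(\<Sum>x<D. \<bar>real_of_int (w x i - w x j)\<bar> * (cmod (?m $ x))\<^sup>2) \<le> nsq (g i j *\<^sub>v ?m)"
  proof -
    have "(\<Sum>x<D. \<bar>real_of_int (w x i - w x j)\<bar> * (cmod (?m $ x))\<^sup>2)
        = (\<Sum>x<D. real_of_int (w x j - w x i) * (cmod (?m $ x))\<^sup>2)"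
      using v by (intro sum.cong) (auto simp: P_def)
    then show ?thesis using nsq_g_diff[OF ij(1,2) m] nsq_nonneg[of "g j i *\<^sub>v ?m"] by linarith
  qed
  moreover have "(\<Sum>x<D. \<bar>real_of_int (w x i - w x j)\<bar> * (cmod (?p $ x))\<^sup>2) \<le> nsq (g j i *\<^sub>v ?p)"
  proof -
    have "(\<Sum>x<D. \<bar>real_of_int (w x i - w x j)\<bar> * (cmod (?p $ x))\<^sup>2)
        = (\<Sum>x<D. real_of_int (w x i - w x j) * (cmod (?p $ x))\<^sup>2)"
      using v by (intro sum.cong) (auto simp: P_def)
    then show ?thesis using nsq_g_diff[OF ij(2,1) p] nsq_nonneg[of "g i j *\<^sub>v ?p"] by linarith
  qed
  moreover have "(\<Sum>x<D. \<bar>real_of_int (w x i - w x j)\<bar> * (cmod (v $ x))\<^sup>2)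
      = (\<Sum>x<D. \<bar>real_of_int (w x i - w x j)\<bar> * (cmod (?m $ x))\<^sup>2)
      + (\<Sum>x<D. \<bar>real_of_int (w x i - w x j)\<bar> * (cmod (?p $ x))\<^sup>2)"
    unfolding sum.distrib[symmetric] using v by (intro sum.cong) auto
  ultimately show ?thesis by linarith
qed

lemma casimir_ge_weights:
  assumes v: "v \<in> carrier_vec D"
  shows "(\<Sum>x<D. casimir_weight x * (cmod (v $ x))\<^sup>2) \<le> casimir v"
proof -
  let ?n = "\<lambda>i j. nsq (g i j *\<^sub>v v)"
  \<comment> \<open>Every pair is counted in both orders; hence the doubled diagonal term and the
    factor 2 in \<open>cw\<close>.\<close>
  define h where "h i j x = \<bar>real_of_int (w x i - w x j)\<bar> + (if i = j then 2 * (real_of_int (w x i))\<^sup>2 else 0)"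
    for i j x
  have le: "(\<Sum>x<D. h i j x * (cmod (v $ x))\<^sup>2) \<le> ?n i j + ?n j i" if ij: "i < N" "j < N" for i j
  proof (cases "i = j")
    case True
    have "?n i i = (\<Sum>x<D. (real_of_int (w x i))\<^sup>2 * (cmod (v $ x))\<^sup>2)"
      using v ij by (simp add: g_diag nsq_def diagm_mult_vec norm_mult power_mult_distrib del: index_mult_mat_vec)
    then show ?thesis using True by (simp add: h_def sum_distrib_left mult.assoc)
  next
    case False
    then show ?thesis using nsq_root_pair_ge[OF ij False v] by (simp add: h_def)
  qed
  have cw: "2 * casimir_weight x = real N * (\<Sum>i<N. \<Sum>j<N. h i j x)" for x
    by (simp add: h_def casimir_weight_def sum.distrib sum_distrib_left distrib_left algebra_simps)
  have "2 * (\<Sum>x<D. casimir_weight x * (cmod (v $ x))\<^sup>2)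
      = real N * (\<Sum>x<D. \<Sum>i<N. \<Sum>j<N. h i j x * (cmod (v $ x))\<^sup>2)"
    unfolding sum_distrib_left[of 2] mult.assoc[symmetric] cw
    by (simp add: sum_distrib_left sum_distrib_right mult.assoc)
  also have "(\<Sum>x<D. \<Sum>i<N. \<Sum>j<N. h i j x * (cmod (v $ x))\<^sup>2)
      = (\<Sum>i<N. \<Sum>x<D. \<Sum>j<N. h i j x * (cmod (v $ x))\<^sup>2)" by (rule sum.swap)
  also have "\<dots> = (\<Sum>i<N. \<Sum>j<N. \<Sum>x<D. h i j x * (cmod (v $ x))\<^sup>2)"
    by (rule sum.cong[OF refl], rule sum.swap)
  also have "real N * \<dots> \<le> real N * (\<Sum>i<N. \<Sum>j<N. ?n i j + ?n j i)"
    using le by (intro mult_left_mono sum_mono) auto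
  also have "(\<Sum>i<N. \<Sum>j<N. ?n i j + ?n j i) = 2 * (\<Sum>i<N. \<Sum>j<N. ?n i j)"
  proof -
    have "(\<Sum>i<N. \<Sum>j<N. ?n j i) = (\<Sum>i<N. \<Sum>j<N. ?n i j)" by (rule sum.swap)
    then show ?thesis by (simp add: sum.distrib)
  qed
  finally show ?thesis by (simp add: casimir_def)
qed

lemma lie_map_mult_vec:
  assumes v: "v \<in> carrier_vec D" and x: "x < D"
  shows "(lie_map N D g X *\<^sub>v v) $ x = (\<Sum>i<N. \<Sum>j<N. X $$ (i,j) * (g i j *\<^sub>v v) $ x)"
proof -
  have "(lie_map N D g X *\<^sub>v v) $ x = (\<Sum>y<D. \<Sum>i<N. \<Sum>j<N. X $$ (i,j) * g i j $$ (x,y) * v $ y)"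
    using x v by (subst index_mat_vec[of _ D D]) (auto simp: lie_map_index sum_distrib_right)
  also have "\<dots> = (\<Sum>i<N. \<Sum>y<D. \<Sum>j<N. X $$ (i,j) * g i j $$ (x,y) * v $ y)" by (rule sum.swap)
  also have "\<dots> = (\<Sum>i<N. \<Sum>j<N. \<Sum>y<D. X $$ (i,j) * g i j $$ (x,y) * v $ y)"
    by (rule sum.cong[OF refl], rule sum.swap)
  also have "\<dots> = (\<Sum>i<N. \<Sum>j<N. X $$ (i,j) * (g i j *\<^sub>v v) $ x)"
    using v x by (intro sum.cong refl)
      (simp add: index_mat_vec[OF g_carrier v] sum_distrib_left mult.assoc del: index_mult_mat_vec)
  finally show ?thesis .
qed

lemma cip_lie_map:
  assumes v: "v \<in> carrier_vec D" and u: "u \<in> carrier_vec D"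
  shows "cip (lie_map N D g X *\<^sub>v v) (lie_map N D g X *\<^sub>v u)
     = (\<Sum>i<N. \<Sum>j<N. \<Sum>k<N. \<Sum>l<N. cnj (X $$ (i,j)) * X $$ (k,l) * cip (g i j *\<^sub>v v) (g k l *\<^sub>v u))"
proof -
  have "cip (lie_map N D g X *\<^sub>v v) (lie_map N D g X *\<^sub>v u)
      = (\<Sum>x<D. (\<Sum>i<N. \<Sum>j<N. cnj (X $$ (i,j)) * cnj ((g i j *\<^sub>v v) $ x))
          * (\<Sum>k<N. \<Sum>l<N. X $$ (k,l) * (g k l *\<^sub>v u) $ x))"
    by (simp add: cip_def lie_map_mult_vec[OF v] lie_map_mult_vec[OF u] del: index_mult_mat_vec)
  also have "\<dots> = (\<Sum>x<D. \<Sum>i<N. \<Sum>j<N. \<Sum>k<N. \<Sum>l<N. cnj (X $$ (i,j)) * cnj ((g i j *\<^sub>v v) $ x)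
          * (X $$ (k,l) * (g k l *\<^sub>v u) $ x))"
    unfolding sum_distrib_right by (simp only: sum_distrib_left)
  also have "\<dots> = (\<Sum>i<N. \<Sum>j<N. \<Sum>k<N. \<Sum>l<N. \<Sum>x<D. cnj (X $$ (i,j)) * cnj ((g i j *\<^sub>v v) $ x)
          * (X $$ (k,l) * (g k l *\<^sub>v u) $ x))"
    by (subst sum.swap, rule sum.cong[OF refl], subst sum.swap, rule sum.cong[OF refl],
        subst sum.swap, rule sum.cong[OF refl], subst sum.swap, rule refl)
  also have "\<dots> = (\<Sum>i<N. \<Sum>j<N. \<Sum>k<N. \<Sum>l<N. cnj (X $$ (i,j)) * X $$ (k,l) * cip (g i j *\<^sub>v v) (g k l *\<^sub>v u))"
  proof (intro sum.cong refl)
    fix i j k l assume "i \<in> {..<N}" "j \<in> {..<N}" "k \<in> {..<N}" "l \<in> {..<N}"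
    then show "(\<Sum>x<D. cnj (X $$ (i,j)) * cnj ((g i j *\<^sub>v v) $ x) * (X $$ (k,l) * (g k l *\<^sub>v u) $ x))
      = cnj (X $$ (i,j)) * X $$ (k,l) * cip (g i j *\<^sub>v v) (g k l *\<^sub>v u)"
      using g_carrier[of i j]
      by (auto simp: cip_def sum_distrib_left mult_ac simp del: index_mult_mat_vec intro!: sum.cong)
  qed
  finally show ?thesis .
qed

text \<open>Independence of the Casimir form from the basis: a family obeying the completeness
  relation with constant \<open>\<kappa>\<close> reproduces the sum over matrix units up to
  \<open>\<kappa>\<close>. It serves for conjugated matrix units, with constant 1, and for Pauli
  strings, with constant \<open>N\<close>.\<close>

lemma sum_cip_lie_map:
  assumes v: "v \<in> carrier_vec D" and u: "u \<in> carrier_vec D"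
    and X: "\<And>i j k l. i < N \<Longrightarrow> j < N \<Longrightarrow> k < N \<Longrightarrow> l < N \<Longrightarrow>
      (\<Sum>a\<in>A. cnj (X a $$ (i,j)) * X a $$ (k,l)) = (if i = k \<and> j = l then \<kappa> else 0)"
  shows "(\<Sum>a\<in>A. cip (lie_map N D g (X a) *\<^sub>v v) (lie_map N D g (X a) *\<^sub>v u))
     = \<kappa> * (\<Sum>i<N. \<Sum>j<N. cip (g i j *\<^sub>v v) (g i j *\<^sub>v u))"
proof -
  let ?c = "\<lambda>i j k l. cip (g i j *\<^sub>v v) (g k l *\<^sub>v u)"
  have "(\<Sum>a\<in>A. cip (lie_map N D g (X a) *\<^sub>v v) (lie_map N D g (X a) *\<^sub>v u))
     = (\<Sum>i<N. \<Sum>j<N. \<Sum>k<N. \<Sum>l<N. \<Sum>a\<in>A. cnj (X a $$ (i,j)) * X a $$ (k,l) * ?c i j k l)"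
    unfolding cip_lie_map[OF v u]
    by (subst sum.swap, rule sum.cong[OF refl], subst sum.swap, rule sum.cong[OF refl],
        subst sum.swap, rule sum.cong[OF refl], subst sum.swap, rule refl)
  also have "\<dots> = (\<Sum>i<N. \<Sum>j<N. \<Sum>k<N. \<Sum>l<N. (\<kappa> * ?c k l k l) * (if i = k \<and> j = l then 1 else 0))"
    unfolding sum_distrib_right[symmetric] using X by (intro sum.cong refl) auto
  also have "\<dots> = (\<Sum>i<N. \<Sum>j<N. \<kappa> * ?c i j i j)"
    using sum_sum_delta[of _ N _ "\<lambda>k l. \<kappa> * ?c k l k l"] by (intro sum.cong refl) blast
  finally show ?thesis by (simp add: sum_distrib_left)
qed

section \<open>Invariance of the Casimir form under the group\<close>

lemma lie_map_mat_unit':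
  assumes "k < N" "l < N"
  shows "lie_map N D g (mat_unit N k l) = g k l"
proof (rule eq_matI)
  fix x y assume "x < dim_row (g k l)" "y < dim_col (g k l)"
  then have xy: "x < D" "y < D" using g_carrier[OF assms] by auto
  have "(\<Sum>i<N. \<Sum>j<N. mat_unit N k l $$ (i, j) * g i j $$ (x, y))
     = (\<Sum>i<N. \<Sum>j<N. g i j $$ (x, y) * (if k = i \<and> l = j then 1 else 0))"
    by (intro sum.cong refl) auto
  then show "lie_map N D g (mat_unit N k l) $$ (x,y) = g k l $$ (x,y)"
    using xy sum_sum_delta[OF assms, of "\<lambda>i j. g i j $$ (x,y)"] by (simp add: lie_map_index)
qed (use g_carrier[OF assms] in auto)

lemma T_unitary: "unitary_mat N U \<Longrightarrow> unitary_mat D (T U)"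
  using T_carrier[of U] T_mult[of U "dagger U"] T_one T_dagger[of U] unitary_matD[of N U]
  by (intro unitary_matI) auto

text \<open>Moving \<open>T U\<close> past \<open>g k l\<close> replaces the matrix unit by its
  conjugate \<open>X k l\<close>. Conjugated matrix units are again orthonormal for the
  Hilbert-Schmidt product, so they define the same form.\<close>

lemma casimir_form_invariant:
  assumes U: "unitary_mat N U" and v: "v \<in> carrier_vec D" and u: "u \<in> carrier_vec D"
  shows "casimir_form (T U *\<^sub>v v) (T U *\<^sub>v u) = casimir_form v u"
proof -
  note U' = unitary_matD[OF U]
  note TU = T_carrier[OF U'(1)]
  define X where "X k l = dagger U * (mat_unit N k l * U)" for k l
  have EU: "mat_unit N k l * U \<in> carrier_mat N N" for k l
    using U'(1) by (rule mult_carrier_mat[OF mat_unit_carrier])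
  have Xi: "X k l $$ (i,j) = cnj (U $$ (k,i)) * U $$ (l,j)" if "i < N" "j < N" "k < N" "l < N" for i j k l
  proof -
    have "(mat_unit N k l * U) $$ (m,j) = (if m = k then U $$ (l,j) else 0)" if "m < N" for m
    proof -
      have "(mat_unit N k l * U) $$ (m,j) = (\<Sum>p<N. mat_unit N k l $$ (m,p) * U $$ (p,j))"
        using U' \<open>j < N\<close> that by (intro index_mat_mult) auto
      also have "\<dots> = (\<Sum>p<N. if p = l then (if m = k then U $$ (l,j) else 0) else 0)"
        using that by (intro sum.cong) auto
      finally show ?thesis using \<open>l < N\<close> by simp
    qed
    moreover have "X k l $$ (i,j) = (\<Sum>m<N. dagger U $$ (i,m) * (mat_unit N k l * U) $$ (m,j))"
      unfolding X_def using U' that EU by (intro index_mat_mult) auto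
    moreover have "(\<Sum>m<N. dagger U $$ (i,m) * (mat_unit N k l * U) $$ (m,j))
        = (\<Sum>m<N. if m = k then cnj (U $$ (k,i)) * U $$ (l,j) else 0)"
      using that U' calculation(1) by (intro sum.cong) (auto simp del: index_mult_mat(1))
    ultimately show ?thesis using that by simp
  qed
  have gcip: "cip (g k l *\<^sub>v (T U *\<^sub>v v)) (g k l *\<^sub>v (T U *\<^sub>v u))
      = cip (lie_map N D g (X k l) *\<^sub>v v) (lie_map N D g (X k l) *\<^sub>v u)" if kl: "k < N" "l < N" for k l
  proof -
    have "U * X k l = U * dagger U * (mat_unit N k l * U)"
      unfolding X_def using U'(1) EU by (intro assoc_mult_mat[symmetric, of _ N N _ N _ N]) auto
    then have "U * X k l = mat_unit N k l * U"
      using U' EU by (simp add: left_mult_one_mat[of _ N N])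
    from intertwine[OF U _ _ this]
    have i: "T U * lie_map N D g (X k l) = g k l * T U"
      using U'(1) kl EU by (simp add: X_def lie_map_mat_unit' mult_carrier_mat[of _ N N])
    have gT: "g k l *\<^sub>v (T U *\<^sub>v z) = T U *\<^sub>v (lie_map N D g (X k l) *\<^sub>v z)" if z: "z \<in> carrier_vec D" for z
    proof -
      have "g k l *\<^sub>v (T U *\<^sub>v z) = (g k l * T U) *\<^sub>v z"
        using g_carrier[OF kl] TU z by (simp add: assoc_mult_mat_vec[of _ D D _ D])
      also have "\<dots> = T U *\<^sub>v (lie_map N D g (X k l) *\<^sub>v z)"
        unfolding i[symmetric] using TU z by (intro assoc_mult_mat_vec[of _ D D _ D]) auto
      finally show ?thesis .
    qed
    let ?a = "lie_map N D g (X k l) *\<^sub>v v" and ?b = "lie_map N D g (X k l) *\<^sub>v u"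
    have "cip (T U *\<^sub>v ?a) (T U *\<^sub>v ?b) = cip ?a (dagger (T U) *\<^sub>v (T U *\<^sub>v ?b))"
      using TU v u by (intro cip_mat_vec[of _ D D] mult_mat_vec_carrier[OF lie_map_carrier]
          mult_mat_vec_carrier[OF TU])
    also have "dagger (T U) *\<^sub>v (T U *\<^sub>v ?b) = ?b"
      using u by (intro unitary_cancel(1)[OF T_unitary[OF U]] mult_mat_vec_carrier[OF lie_map_carrier])
    finally show ?thesis by (simp add: gT[OF v] gT[OF u])
  qed
  have delta: "(\<Sum>k<N. U $$ (k,i) * cnj (U $$ (k,p))) = (if i = p then 1 else 0)" if "i < N" "p < N" for i p
  proof -
    have "(dagger U * U) $$ (p,i) = (\<Sum>k<N. cnj (U $$ (k,p)) * U $$ (k,i))"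
      using U' that by (subst index_mat_mult[of _ N N _ N]) auto
    then show ?thesis using U' that by (auto simp: mult.commute)
  qed
  have ortho: "(\<Sum>a\<in>{..<N} \<times> {..<N}. cnj (X (fst a) (snd a) $$ (i,j)) * X (fst a) (snd a) $$ (p,q))
      = (if i = p \<and> j = q then 1 else 0)" if h: "i < N" "j < N" "p < N" "q < N" for i j p q
  proof -
    have "(\<Sum>a\<in>{..<N} \<times> {..<N}. cnj (X (fst a) (snd a) $$ (i,j)) * X (fst a) (snd a) $$ (p,q))
       = (\<Sum>k<N. \<Sum>l<N. (U $$ (k,i) * cnj (U $$ (k,p))) * cnj (U $$ (l,j) * cnj (U $$ (l,q))))"
      unfolding sum.cartesian_product using h
      by (intro sum.cong) (auto simp: Xi mult_ac)
    also have "\<dots> = (\<Sum>k<N. U $$ (k,i) * cnj (U $$ (k,p))) * cnj (\<Sum>l<N. U $$ (l,j) * cnj (U $$ (l,q)))"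
      unfolding cnj_sum sum_product ..
    finally show ?thesis using delta[OF h(1,3)] delta[OF h(2,4)] by auto
  qed
  have "(\<Sum>k<N. \<Sum>l<N. cip (g k l *\<^sub>v (T U *\<^sub>v v)) (g k l *\<^sub>v (T U *\<^sub>v u)))
     = (\<Sum>a\<in>{..<N} \<times> {..<N}. cip (lie_map N D g (X (fst a) (snd a)) *\<^sub>v v)
          (lie_map N D g (X (fst a) (snd a)) *\<^sub>v u))"
    unfolding sum.cartesian_product by (intro sum.cong) (auto simp: gcip)
  also have "\<dots> = 1 * (\<Sum>i<N. \<Sum>j<N. cip (g i j *\<^sub>v v) (g i j *\<^sub>v u))"
    by (rule sum_cip_lie_map[OF v u]) (rule ortho)
  finally show ?thesis by (simp add: casimir_form_def)
qed

text \<open>For unitary \<open>V\<close>, the orthogonal projection onto the kernel of the derived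
  action of P = V diag(s) \<open>dagger V\<close>: in the frame \<open>T V\<close> that action is
  diagonal with entries \<open>\<Sum>i<N. s i * w x i\<close>.\<close>

definition kernel_proj :: "complex mat \<Rightarrow> (nat \<Rightarrow> int) \<Rightarrow> complex vec \<Rightarrow> complex vec" where
  "kernel_proj V s v = T V *\<^sub>v restr (\<lambda>x. (\<Sum>i<N. s i * w x i) = 0) (dagger (T V) *\<^sub>v v)"

lemma lie_map_diagm: "lie_map N D g (diagm N s) = diagm D (\<lambda>x. \<Sum>i<N. s i * of_int (w x i))"
proof (rule eq_matI)
  fix x y assume "x < dim_row (diagm D (\<lambda>x. \<Sum>i<N. s i * of_int (w x i)))"
    "y < dim_col (diagm D (\<lambda>x. \<Sum>i<N. s i * of_int (w x i)))"
  then have xy: "x < D" "y < D" by auto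
  have "(\<Sum>j<N. diagm N s $$ (i, j) * g i j $$ (x, y)) = s i * (if x = y then of_int (w x i) else 0)"
    if i: "i < N" for i
  proof -
    have "(\<Sum>j<N. diagm N s $$ (i, j) * g i j $$ (x, y)) = (\<Sum>j<N. if j = i then s i * g i i $$ (x,y) else 0)"
      using i by (intro sum.cong) auto
    then show ?thesis using i xy by (simp add: g_diag)
  qed
  then show "lie_map N D g (diagm N s) $$ (x,y) = diagm D (\<lambda>x. \<Sum>i<N. s i * of_int (w x i)) $$ (x,y)"
    using xy by (simp add: lie_map_index)
qed auto

lemma lie_map_conj_diag:
  assumes V: "unitary_mat N V" and v: "v \<in> carrier_vec D"
  shows "lie_map N D g (V * diagm N s * dagger V) *\<^sub>v v
     = T V *\<^sub>v (diagm D (\<lambda>x. \<Sum>i<N. s i * of_int (w x i)) *\<^sub>v (dagger (T V) *\<^sub>v v))"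
proof -
  note V' = unitary_matD[OF V]
  note TV = T_carrier[OF V'(1)]
  define P where "P = V * diagm N s * dagger V"
  define u where "u = dagger (T V) *\<^sub>v v"
  have u: "u \<in> carrier_vec D" using TV v by (simp add: u_def)
  have P: "P \<in> carrier_mat N N" unfolding P_def using V'
    by (intro mult_carrier_mat[of _ N N] diagm_carrier) auto
  have VD: "V * diagm N s \<in> carrier_mat N N" using V' by (intro mult_carrier_mat[of _ N N] diagm_carrier)
  have "P * V = V * diagm N s * (dagger V * V)"
    unfolding P_def using V' by (intro assoc_mult_mat[OF VD]) auto
  then have "V * diagm N s = P * V" using V' VD by simp
  from intertwine[OF V diagm_carrier P this]
  have i: "T V * diagm D (\<lambda>x. \<Sum>i<N. s i * of_int (w x i)) = lie_map N D g P * T V"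
    by (simp add: lie_map_diagm)
  have "lie_map N D g P *\<^sub>v v = lie_map N D g P *\<^sub>v (T V *\<^sub>v u)"
    unfolding u_def using unitary_cancel(2)[OF T_unitary[OF V] v] by simp
  also have "\<dots> = (lie_map N D g P * T V) *\<^sub>v u"
    using TV u by (intro assoc_mult_mat_vec[symmetric, of _ D D _ D]) auto
  also have "\<dots> = T V *\<^sub>v (diagm D (\<lambda>x. \<Sum>i<N. s i * of_int (w x i)) *\<^sub>v u)"
    unfolding i[symmetric] using TV u by (intro assoc_mult_mat_vec[of _ D D _ D]) auto
  finally show ?thesis by (simp add: P_def u_def)
qed

text \<open>Commutation of Q with the kernel projection, in terms of forms. \<open>g i j\<close>
  shifts \<open>\<sigma>\<close> by \<open>s i - s j\<close>, so a row with
  \<open>\<sigma> x = s i - s j\<close> is fed only by the part \<open>\<sigma> = 0\<close> and any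
  other row only by the part \<open>\<sigma> \<noteq> 0\<close>.\<close>

lemma casimir_form_restr_orth:
  fixes s :: "nat \<Rightarrow> int"
  defines "\<sigma> \<equiv> (\<lambda>x. \<Sum>i<N. s i * w x i)"
  assumes u: "u \<in> carrier_vec D" and u': "u' \<in> carrier_vec D"
  shows "casimir_form (restr (\<lambda>x. \<sigma> x \<noteq> 0) u) (restr (\<lambda>x. \<sigma> x = 0) u') = 0"
proof -
  have "cip (g i j *\<^sub>v restr (\<lambda>x. \<sigma> x \<noteq> 0) u) (g i j *\<^sub>v restr (\<lambda>x. \<sigma> x = 0) u') = 0"
    if ij: "i < N" "j < N" for i j
  proof -
    have shift: "\<sigma> x = \<sigma> y + s i - s j" if xy: "x < D" "y < D" "g i j $$ (x,y) \<noteq> 0" for x y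
    proof -
      have *: "s k * w x k = s k * w y k + (if k = i then s k else 0) - (if k = j then s k else 0)"
        if "k < N" for k
        unfolding g_shift[OF ij xy that] by (simp add: algebra_simps)
      have "\<sigma> x = (\<Sum>k<N. s k * w y k + (if k = i then s k else 0) - (if k = j then s k else 0))"
        unfolding \<sigma>_def by (intro sum.cong) (auto simp: *)
      also have "\<dots> = \<sigma> y + s i - s j"
        using ij by (simp add: \<sigma>_def sum.distrib sum_subtractf sum.delta)
      finally show ?thesis .
    qed
    have "cnj ((g i j *\<^sub>v restr (\<lambda>x. \<sigma> x \<noteq> 0) u) $ x) * (g i j *\<^sub>v restr (\<lambda>x. \<sigma> x = 0) u') $ x = 0"
      if x: "x < D" for x
    proof (cases "\<sigma> x = s i - s j")
      case True
      have "(g i j *\<^sub>v restr (\<lambda>x. \<sigma> x \<noteq> 0) u) $ x = (\<Sum>y<D. g i j $$ (x,y) * restr (\<lambda>x. \<sigma> x \<noteq> 0) u $ y)"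
        using u x by (intro index_mat_vec[OF g_carrier[OF ij]]) auto
      also have "\<dots> = 0" using True shift[OF x] u by (intro sum.neutral) fastforce
      finally show ?thesis by simp
    next
      case False
      have "(g i j *\<^sub>v restr (\<lambda>x. \<sigma> x = 0) u') $ x = (\<Sum>y<D. g i j $$ (x,y) * restr (\<lambda>x. \<sigma> x = 0) u' $ y)"
        using u' x by (intro index_mat_vec[OF g_carrier[OF ij]]) auto
      also have "\<dots> = 0" using False shift[OF x] u' by (intro sum.neutral) fastforce
      finally show ?thesis by simp
    qed
    then show ?thesis unfolding cip_def using g_carrier[OF ij] by (intro sum.neutral) auto
  qed
  then show ?thesis by (simp add: casimir_form_def)
qed

lemma casimir_form_add_left:
  assumes v: "v \<in> carrier_vec D" and v': "v' \<in> carrier_vec D"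
  shows "casimir_form (v + v') u = casimir_form v u + casimir_form v' u"
proof -
  have "cip (g i j *\<^sub>v (v + v')) (g i j *\<^sub>v u) = cip (g i j *\<^sub>v v) (g i j *\<^sub>v u) + cip (g i j *\<^sub>v v') (g i j *\<^sub>v u)"
    if ij: "i < N" "j < N" for i j
    using g_carrier[OF ij] v v'
    by (simp add: mult_add_distrib_mat_vec[of _ D D] cip_add_left[of _ D] mult_mat_vec_carrier[OF g_carrier[OF ij]])
  then show ?thesis by (simp add: casimir_form_def sum.distrib distrib_left)
qed

lemma casimir_form_cnj: "casimir_form u v = cnj (casimir_form v u)" 
  by (simp add: casimir_form_def cip_cnj)

text \<open>The form inequality Q K_P \<le> Q - G (\<open>\<tau> P\<close>)^2. In the frame of
  \<open>V\<close> the vector splits orthogonally for the form into \<open>K\<close> and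
  \<open>R\<close>, so the value is \<open>casimir K\<close>, which is
  \<open>casimir v - casimir R\<close>. Since \<open>s\<close> has values 1 and -1,
  |\<open>\<sigma>\<close>| is at most the sum of absolute weights, and the weight bound applies to
  \<open>R\<close>.\<close>

lemma casimir_form_kernel_proj:
  fixes s :: "nat \<Rightarrow> int"
  assumes V: "unitary_mat N V" and s: "\<And>i. i < N \<Longrightarrow> s i \<in> {1,-1}"
    and v: "v \<in> carrier_vec D" and G: "G \<ge> 0"
    and cw: "\<And>x. x < D \<Longrightarrow> G * (\<Sum>i<N. \<bar>real_of_int (w x i)\<bar>)\<^sup>2 \<le> casimir_weight x"
  shows "\<exists>r\<ge>0. r \<le> casimir v - G * nsq (lie_map N D g (V * diagm N (\<lambda>i. of_int (s i)) * dagger V) *\<^sub>v v)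
     \<and> casimir_form v (kernel_proj V s v) = of_real r"
proof -
  note V' = unitary_matD[OF V]
  note TV = T_carrier[OF V'(1)]
  define \<sigma> where "\<sigma> = (\<lambda>x. \<Sum>i<N. s i * w x i)"
  define u where "u = dagger (T V) *\<^sub>v v"
  define K where "K = restr (\<lambda>x. \<sigma> x = 0) u"
  define R where "R = restr (\<lambda>x. \<sigma> x \<noteq> 0) u"
  have u: "u \<in> carrier_vec D" using TV v by (simp add: u_def)
  have K: "K \<in> carrier_vec D" and R: "R \<in> carrier_vec D" using u by (simp_all add: K_def R_def)
  have uKR: "u = K + R" unfolding K_def R_def by (simp add: restr_add_restr_not)
  have vu: "v = T V *\<^sub>v u" unfolding u_def using unitary_cancel(2)[OF T_unitary[OF V] v] by simp
  have RK: "casimir_form R K = 0"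
    unfolding R_def K_def \<sigma>_def by (rule casimir_form_restr_orth[OF u u])
  have uK: "casimir_form u K = casimir K"
    by (subst uKR) (simp add: casimir_form_add_left[OF K R] RK casimir_form_self)
  have uR: "casimir_form u R = casimir R"
    by (subst uKR, subst casimir_form_add_left[OF K R], subst casimir_form_cnj)
       (simp add: RK casimir_form_self)
  have "casimir_form u u = casimir_form K u + casimir_form R u"
    by (subst (1) uKR) (rule casimir_form_add_left[OF K R])
  also have "\<dots> = cnj (casimir_form u K) + cnj (casimir_form u R)"
    by (simp only: casimir_form_cnj[of K u] casimir_form_cnj[of R u])
  finally have "casimir_form u u = of_real (casimir K + casimir R)" by (simp add: uK uR)
  then have cu: "casimir u = casimir K + casimir R" unfolding casimir_form_self of_real_eq_iff .
  have cv: "casimir v = casimir u"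
    using casimir_form_invariant[OF V u u] unfolding vu[symmetric] casimir_form_self of_real_eq_iff .
  have "G * nsq (lie_map N D g (V * diagm N (\<lambda>i. of_int (s i)) * dagger V) *\<^sub>v v)
      = G * nsq (diagm D (\<lambda>x. of_int (\<sigma> x)) *\<^sub>v u)"
    unfolding lie_map_conj_diag[OF V v] u_def[symmetric]
    using nsq_unitary[OF T_unitary[OF V] mult_mat_vec_carrier[OF diagm_carrier u]]
    by (simp add: \<sigma>_def)
  \<comment> \<open>\<open>\<sigma>\<close> vanishes on the support of \<open>K\<close>, so only
    \<open>R\<close> contributes.\<close>
  also have "\<dots> = (\<Sum>x<D. G * (real_of_int (\<sigma> x))\<^sup>2 * (cmod (R $ x))\<^sup>2)"
    using u by (auto simp: nsq_def diagm_mult_vec norm_mult power_mult_distrib sum_distrib_left R_def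
        simp del: index_mult_mat_vec intro!: sum.cong)
  also have "\<dots> \<le> (\<Sum>x<D. casimir_weight x * (cmod (R $ x))\<^sup>2)"
  proof (intro sum_mono mult_right_mono)
    fix x assume "x \<in> {..<D}"
    then have x: "x < D" by simp
    have "\<bar>real_of_int (\<sigma> x)\<bar> \<le> (\<Sum>i<N. \<bar>real_of_int (s i * w x i)\<bar>)"
      unfolding \<sigma>_def of_int_sum by (rule sum_abs)
    also have "\<dots> = (\<Sum>i<N. \<bar>real_of_int (w x i)\<bar>)"
    proof (intro sum.cong refl)
      fix i assume "i \<in> {..<N}"
      then show "\<bar>real_of_int (s i * w x i)\<bar> = \<bar>real_of_int (w x i)\<bar>" using s[of i] by auto
    qed
    finally have "\<bar>real_of_int (\<sigma> x)\<bar> \<le> (\<Sum>i<N. \<bar>real_of_int (w x i)\<bar>)" .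
    then have "(real_of_int (\<sigma> x))\<^sup>2 \<le> (\<Sum>i<N. \<bar>real_of_int (w x i)\<bar>)\<^sup>2"
      by (rule power2_le_iff_abs_le[THEN iffD2, rotated]) (simp add: sum_nonneg)
    then show "G * (real_of_int (\<sigma> x))\<^sup>2 \<le> casimir_weight x"
      by (intro order_trans[OF mult_left_mono[OF _ G] cw[OF x]])
  qed simp
  also have "\<dots> \<le> casimir R" by (rule casimir_ge_weights[OF R])
  finally have "casimir K \<le> casimir v - G * nsq (lie_map N D g (V * diagm N (\<lambda>i. of_int (s i)) * dagger V) *\<^sub>v v)"
    using cu cv by linarith
  moreover have "casimir_form v (kernel_proj V s v) = casimir K"
  proof -
    have "kernel_proj V s v = T V *\<^sub>v K" by (simp add: kernel_proj_def K_def u_def \<sigma>_def)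
    then have "casimir_form v (kernel_proj V s v) = casimir_form (T V *\<^sub>v u) (T V *\<^sub>v K)" using vu by simp
    then show ?thesis using casimir_form_invariant[OF V u K] uK by simp
  qed
  ultimately show ?thesis using casimir_nonneg[of K] by blast
qed

text \<open>In an eigenframe of \<open>U\<close> the diagonal lower bound confines the vector to
  indices with \<open>casimir_weight x = 0\<close>. By \<open>cw\<close> and \<open>G > 0\<close>
  all weights vanish there, and the torus acts trivially.\<close>

lemma casimir_eq_0_invariant:
  assumes G: "G > 0" and cw: "\<And>x. x < D \<Longrightarrow> G * (\<Sum>i<N. \<bar>real_of_int (w x i)\<bar>)\<^sup>2 \<le> casimir_weight x"
    and v: "v \<in> carrier_vec D" "casimir v = 0" and U: "unitary_mat N U"
  shows "T U *\<^sub>v v = v"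
proof -
  note U' = unitary_matD[OF U]
  obtain V l where V: "unitary_mat N V" and UV: "U = V * diagm N l * dagger V"
    using normal_mat_diagonalizable[of U N] U' by auto
  note V' = unitary_matD[OF V]
  note TV = T_carrier[OF V'(1)]
  note assoc = assoc_mult_mat[of _ N N _ N _ N]
  have Ul: "diagm N l = dagger V * (U * V)"
  proof -
    have "dagger V * (U * V) = (dagger V * V) * (diagm N l * (dagger V * V))"
      unfolding UV using V'(1) by (simp add: assoc mult_carrier_mat[of _ N N _ N])
    then show ?thesis using V' by (simp add: right_mult_one_mat[of _ N N] left_mult_one_mat[of _ N N])
  qed
  have "unitary_mat N (diagm N l)" unfolding Ul by (intro unitary_mult unitary_dagger U V)
  then have ll: "diagm N (\<lambda>i. l i * cnj (l i)) = 1\<^sub>m N" by (auto simp: unitary_mat_def dagger_diagm diagm_mult)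
  have l: "cmod (l i) = 1" if "i < N" for i
  proof -
    have "complex_of_real ((cmod (l i))\<^sup>2) = 1"
      using arg_cong[OF ll, of "\<lambda>m. m $$ (i,i)"] that
      by (simp add: complex_norm_square del: of_real_power)
    then have "(cmod (l i))\<^sup>2 = 1" by (simp only: of_real_eq_1_iff)
    then show ?thesis using norm_ge_zero[of "l i"] by (auto simp: power2_eq_1_iff)
  qed
  define u where "u = dagger (T V) *\<^sub>v v"
  have u: "u \<in> carrier_vec D" using TV v by (simp add: u_def)
  have vu: "v = T V *\<^sub>v u" unfolding u_def using unitary_cancel(2)[OF T_unitary[OF V] v(1)] by simp
  have "casimir u = casimir v"
    using casimir_form_invariant[OF V u u] unfolding vu[symmetric] casimir_form_self of_real_eq_iff by simp
  then have "(\<Sum>x<D. casimir_weight x * (cmod (u $ x))\<^sup>2) \<le> 0" using casimir_ge_weights[OF u] v by simp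
  moreover have nonneg: "0 \<le> casimir_weight x" if "x < D" for x
    using cw[OF that] G by (meson dual_order.trans less_imp_le mult_nonneg_nonneg zero_le_power2)
  ultimately have "(\<Sum>x<D. casimir_weight x * (cmod (u $ x))\<^sup>2) = 0"
    by (intro antisym sum_nonneg mult_nonneg_nonneg) auto
  then have z: "casimir_weight x * (cmod (u $ x))\<^sup>2 = 0" if "x < D" for x
    using that nonneg by (subst (asm) sum_nonneg_eq_0_iff) auto
  have fix_u: "(\<Prod>i<N. l i powi w x i) * u $ x = u $ x" if x: "x < D" for x
  proof (cases "u $ x = 0")
    case False
    then have "casimir_weight x = 0" using z[OF x] by simp
    then have "G * (\<Sum>i<N. \<bar>real_of_int (w x i)\<bar>)\<^sup>2 \<le> 0" using cw[OF x] by simp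
    then have "(\<Sum>i<N. \<bar>real_of_int (w x i)\<bar>)\<^sup>2 \<le> 0" using G by (simp add: mult_le_0_iff)
    then have "(\<Sum>i<N. \<bar>real_of_int (w x i)\<bar>) = 0" by simp
    then have "w x i = 0" if "i < N" for i using that by (simp add: sum_nonneg_eq_0_iff)
    then show ?thesis by simp
  qed simp
  have Tl: "T (diagm N l) *\<^sub>v u = u"
    using u fix_u by (intro eq_vecI) (auto simp: T_diag[OF l] diagm_mult_vec simp del: index_mult_mat_vec)
  have "T U = T V * T (diagm N l) * dagger (T V)"
    unfolding UV using V' mult_carrier_mat[OF V'(1) diagm_carrier[of N l]]
    by (simp add: T_mult T_dagger)
  then have "T U *\<^sub>v v = (T V * T (diagm N l)) *\<^sub>v u"
    unfolding u_def using TV v T_carrier[OF diagm_carrier[of N l]]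
    by (simp add: assoc_mult_mat_vec[of _ D D _ D])
  also have "\<dots> = T V *\<^sub>v (T (diagm N l) *\<^sub>v u)"
    using TV u T_carrier[OF diagm_carrier[of N l]] by (intro assoc_mult_mat_vec) auto
  finally show ?thesis using Tl vu by simp
qed

end

subsection \<open>Pauli strings\<close>

lemma involution_diagonalizable:
  assumes P: "P \<in> carrier_mat n n" "dagger P = P" "P * P = 1\<^sub>m n"
  shows "\<exists>V s. unitary_mat n V \<and> (\<forall>i. s i \<in> {1, -1 :: int}) \<and>
    P = V * diagm n (\<lambda>i. of_int (s i)) * dagger V"
proof -
  obtain V d where V: "unitary_mat n V" and PV: "P = V * diagm n d * dagger V"
    using normal_mat_diagonalizable[of P n] P by auto
  note V' = unitary_matD[OF V]
  note assoc = assoc_mult_mat[of _ n n _ n _ n]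
  have X: "V * diagm n d \<in> carrier_mat n n" using V' by (intro mult_carrier_mat[of _ n n] diagm_carrier)
  have VPV: "dagger V * P * V = diagm n d"
  proof -
    have "P * V = V * diagm n d"
    proof -
      have "P * V = V * diagm n d * (dagger V * V)"
        unfolding PV using V' by (intro assoc_mult_mat[OF X]) auto
      then show ?thesis using V' X by simp
    qed
    moreover have "dagger V * (V * diagm n d) = dagger V * V * diagm n d"
      using V'(1) by (intro assoc_mult_mat[symmetric, of _ n n _ n _ n]) auto
    ultimately have "dagger V * (P * V) = dagger V * V * diagm n d" by simp
    then have "dagger V * (P * V) = diagm n d" using V' by (simp add: left_mult_one_mat[of _ n n])
    then show ?thesis using V'(1) P by (simp add: assoc_mult_mat[of "dagger V" n n P n V n])
  qed
  have "diagm n d * diagm n d = dagger V * (P * (V * dagger V) * P) * V"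
    unfolding VPV[symmetric] using V'(1) P(1) by (simp add: assoc mult_carrier_mat[of _ n n])
  also have "\<dots> = 1\<^sub>m n" using V' P by simp
  finally have dd: "diagm n (\<lambda>i. d i * d i) = 1\<^sub>m n" by (simp add: diagm_mult)
  have d: "d i = 1 \<or> d i = -1" if "i < n" for i
    using arg_cong[OF dd, of "\<lambda>m. m $$ (i,i)"] that by (simp add: square_eq_1_iff)
  \<comment> \<open>For \<open>i \<ge> n\<close> nothing is known about \<open>d i\<close>; the
    two-valued definition still keeps \<open>s i\<close> in {1,-1} for every
    \<open>i\<close>.\<close>
  define s :: "nat \<Rightarrow> int" where "s i = (if d i = 1 then 1 else -1)" for i
  have "diagm n d = diagm n (\<lambda>i. of_int (s i))" using d by (intro diagm_cong) (auto simp: s_def)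
  then show ?thesis using V PV by (intro exI[of _ V] exI[of _ s]) (auto simp: s_def)
qed

definition paulis :: "complex mat set" where
  "paulis = {pauli_I, pauli_X, pauli_Y, pauli_Z}"

definition all_pauli_strings :: "nat \<Rightarrow> complex mat set" where
  "all_pauli_strings n = {foldr kron ps (1\<^sub>m 1) | ps. length ps = n \<and> set ps \<subseteq> paulis}"

lemma pauli_strings_eq: "pauli_strings n = all_pauli_strings n - {1\<^sub>m (2 ^ n)}"
  by (simp add: pauli_strings_def all_pauli_strings_def paulis_def)

lemma all_pauli_strings_0: "all_pauli_strings 0 = {1\<^sub>m 1}"
  by (auto simp: all_pauli_strings_def)

lemma all_pauli_strings_Suc:
  "all_pauli_strings (Suc n) = (\<lambda>(A,B). kron A B) ` (paulis \<times> all_pauli_strings n)"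
proof (rule subset_antisym; rule subsetI)
  fix P assume "P \<in> all_pauli_strings (Suc n)"
  then obtain qs where qs: "P = foldr kron qs (1\<^sub>m 1)" "length qs = Suc n" "set qs \<subseteq> paulis"
    unfolding all_pauli_strings_def by blast
  then obtain p ps where "qs = p # ps" by (cases qs) auto
  with qs have P: "P = kron p (foldr kron ps (1\<^sub>m 1))" "p \<in> paulis" "length ps = n" "set ps \<subseteq> paulis"
    by simp_all
  then have "foldr kron ps (1\<^sub>m 1) \<in> all_pauli_strings n"
    unfolding all_pauli_strings_def by blast
  with P(2) have "(p, foldr kron ps (1\<^sub>m 1)) \<in> paulis \<times> all_pauli_strings n" by (rule SigmaI)
  then show "P \<in> (\<lambda>(A,B). kron A B) ` (paulis \<times> all_pauli_strings n)"
    by (rule rev_image_eqI) (simp only: P(1) split_conv)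
next
  fix P assume "P \<in> (\<lambda>(A,B). kron A B) ` (paulis \<times> all_pauli_strings n)"
  then obtain p B where "p \<in> paulis" "B \<in> all_pauli_strings n" "P = kron p B"
    by (elim imageE SigmaE) simp
  then obtain ps where "p \<in> paulis" "P = kron p (foldr kron ps (1\<^sub>m 1))" "length ps = n" "set ps \<subseteq> paulis"
    unfolding all_pauli_strings_def by blast
  then have "P = foldr kron (p # ps) (1\<^sub>m 1)" "length (p # ps) = Suc n" "set (p # ps) \<subseteq> paulis" by simp_all
  then show "P \<in> all_pauli_strings (Suc n)" unfolding all_pauli_strings_def by blast
qed

lemma less_2: "i < 2 \<longleftrightarrow> i = 0 \<or> i = Suc 0"
  by auto

lemma pauli_index:
  "pauli_I $$ (0,0) = 1" "pauli_I $$ (0,Suc 0) = 0" "pauli_I $$ (Suc 0,0) = 0" "pauli_I $$ (Suc 0,Suc 0) = 1"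
  "pauli_X $$ (0,0) = 0" "pauli_X $$ (0,Suc 0) = 1" "pauli_X $$ (Suc 0,0) = 1" "pauli_X $$ (Suc 0,Suc 0) = 0"
  "pauli_Y $$ (0,0) = 0" "pauli_Y $$ (0,Suc 0) = - \<i>" "pauli_Y $$ (Suc 0,0) = \<i>" "pauli_Y $$ (Suc 0,Suc 0) = 0"
  "pauli_Z $$ (0,0) = 1" "pauli_Z $$ (0,Suc 0) = 0" "pauli_Z $$ (Suc 0,0) = 0" "pauli_Z $$ (Suc 0,Suc 0) = -1"
  by (simp_all add: pauli_I_def pauli_X_def pauli_Y_def pauli_Z_def)

lemma pauli_carrier: "P \<in> paulis \<Longrightarrow> P \<in> carrier_mat 2 2"
  by (auto simp: paulis_def pauli_I_def pauli_X_def pauli_Y_def pauli_Z_def)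

lemma pauli_hermitian_involution:
  assumes "P \<in> paulis"
  shows "dagger P = P" "P * P = 1\<^sub>m 2"
proof -
  note c = pauli_carrier[OF assms]
  show "dagger P = P"
  proof (rule eq_matI)
    fix i j assume "i < dim_row P" "j < dim_col P"
    then have "i < 2" "j < 2" using c by auto
    then show "dagger P $$ (i,j) = P $$ (i,j)"
      using c assms by (auto simp: paulis_def less_2 pauli_index)
  qed (use c in auto)
  show "P * P = 1\<^sub>m 2"
  proof (rule eq_matI)
    fix i j assume "i < dim_row (1\<^sub>m 2 :: complex mat)" "j < dim_col (1\<^sub>m 2 :: complex mat)"
    then have ij: "i < 2" "j < 2" by auto
    have "(P * P) $$ (i,j) = P $$ (i,0) * P $$ (0,j) + P $$ (i,Suc 0) * P $$ (Suc 0,j)"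
      using index_mat_mult[OF c c ij] by (simp add: numeral_2_eq_2)
    also have "\<dots> = 1\<^sub>m 2 $$ (i,j)"
      using ij assms by (auto simp: paulis_def less_2 pauli_index)
    finally show "(P * P) $$ (i,j) = 1\<^sub>m 2 $$ (i,j)" .
  qed (use c in auto)
qed

text \<open>A nonzero Kronecker product determines its factors only up to a scalar; no two distinct
  Pauli matrices are proportional, which removes this freedom.\<close>

lemma pauli_proportional:
  assumes "A \<in> paulis" "A' \<in> paulis" "b \<noteq> 0"
    and "\<And>i j. i < 2 \<Longrightarrow> j < 2 \<Longrightarrow> A $$ (i,j) * b = A' $$ (i,j) * b'"
  shows "A = A' \<and> b = b'"
proof -
  have e: "A $$ (0,0) * b = A' $$ (0,0) * b'" "A $$ (0,Suc 0) * b = A' $$ (0,Suc 0) * b'"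
    "A $$ (Suc 0,0) * b = A' $$ (Suc 0,0) * b'" "A $$ (Suc 0,Suc 0) * b = A' $$ (Suc 0,Suc 0) * b'"
    using assms(4) by simp_all
  have b: "b = b' \<Longrightarrow> b = - b' \<Longrightarrow> False" "b = - b' \<Longrightarrow> b = b' \<Longrightarrow> False" using assms(3) by auto
  show ?thesis
    using e b assms(1-3) by (auto simp: paulis_def pauli_index)
qed

lemma pauli_nonzero:
  assumes "A \<in> paulis" shows "\<exists>i<2. \<exists>j<2. A $$ (i,j) \<noteq> 0"
proof -
  have "A $$ (0,0) \<noteq> 0 \<or> A $$ (0,Suc 0) \<noteq> 0"
    using assms by (auto simp: paulis_def pauli_index)
  moreover have "(0::nat) < 2" "Suc 0 < 2" by simp_all
  ultimately show ?thesis by blast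
qed

lemma paulis_distinct:
  "pauli_I \<noteq> pauli_X" "pauli_I \<noteq> pauli_Y" "pauli_I \<noteq> pauli_Z" "pauli_X \<noteq> pauli_Y" "pauli_X \<noteq> pauli_Z"
  "pauli_Y \<noteq> pauli_Z"
proof -
  have ne: "A \<noteq> B" if "A $$ (i,j) \<noteq> B $$ (i,j)" for A B :: "complex mat" and i j using that by auto
  show "pauli_I \<noteq> pauli_X" by (rule ne[of _ 0 0]) (simp add: pauli_index)
  show "pauli_I \<noteq> pauli_Y" by (rule ne[of _ 0 0]) (simp add: pauli_index)
  show "pauli_I \<noteq> pauli_Z" by (rule ne[of _ "Suc 0" "Suc 0"]) (simp add: pauli_index)
  show "pauli_X \<noteq> pauli_Y" by (rule ne[of _ "Suc 0" 0]) (simp add: pauli_index)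
  show "pauli_X \<noteq> pauli_Z" by (rule ne[of _ 0 0]) (simp add: pauli_index)
  show "pauli_Y \<noteq> pauli_Z" by (rule ne[of _ 0 0]) (simp add: pauli_index)
qed

lemma sum_paulis: "(\<Sum>P\<in>paulis. f P) = f pauli_I + f pauli_X + f pauli_Y + (f pauli_Z :: complex)"
  using paulis_distinct by (simp add: paulis_def)

lemma card_paulis: "finite paulis" "card paulis = 4"
  using paulis_distinct by (simp_all add: paulis_def)

lemma paulis_complete:
  assumes "i < 2" "j < 2" "k < 2" "l < 2"
  shows "(\<Sum>P\<in>paulis. cnj (P $$ (i,j)) * P $$ (k,l)) = (if i = k \<and> j = l then 2 else 0)"
  using assms by (auto simp: less_2 sum_paulis pauli_index)

lemma all_pauli_strings_carrier: "P \<in> all_pauli_strings n \<Longrightarrow> P \<in> carrier_mat (2 ^ n) (2 ^ n)"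
proof (induction n arbitrary: P)
  case (Suc n)
  then show ?case by (auto simp: all_pauli_strings_Suc dest: pauli_carrier)
qed (auto simp: all_pauli_strings_0)

lemma all_pauli_strings_hermitian_involution:
  "P \<in> all_pauli_strings n \<Longrightarrow> dagger P = P \<and> P * P = 1\<^sub>m (2 ^ n)"
proof (induction n arbitrary: P)
  case (Suc n)
  then obtain A B where P: "P = kron A B" "A \<in> paulis" "B \<in> all_pauli_strings n"
    by (auto simp: all_pauli_strings_Suc)
  have "P * P = kron (A * A) (B * B)" unfolding P(1)
    using pauli_carrier[OF P(2)] all_pauli_strings_carrier[OF P(3)] by (intro kron_mult)
  then show ?case
    using Suc.IH[OF P(3)] pauli_hermitian_involution[OF P(2)]
    by (simp add: P(1) kron_dagger kron_one)
qed (auto simp: all_pauli_strings_0)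

text \<open>Pauli strings form a set of matrices, so different words must give different matrices
  before strings can be counted or sums over them factorised.\<close>

lemma kron_paulis_inj:
  "inj_on (\<lambda>(A,B). kron A B) (paulis \<times> all_pauli_strings n)"
proof (rule inj_onI, clarsimp)
  fix A B A' B'
  assume A: "A \<in> paulis" and B: "B \<in> all_pauli_strings n"
    and A': "A' \<in> paulis" and B': "B' \<in> all_pauli_strings n" and eq: "kron A B = kron A' B'"
  let ?m = "2 ^ n :: nat"
  note c = pauli_carrier[OF A] all_pauli_strings_carrier[OF B]
    pauli_carrier[OF A'] all_pauli_strings_carrier[OF B']
  have e: "A $$ (i,j) * B $$ (k,l) = A' $$ (i,j) * B' $$ (k,l)"
    if ij: "i < 2" "j < 2" and kl: "k < ?m" "l < ?m" for i j k l
  proof -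
    have le: "i * ?m + k < 2 * ?m" "j * ?m + l < 2 * ?m" using ij kl by (auto simp: less_2)
    have dm: "(i * ?m + k) div ?m = i" "(j * ?m + l) div ?m = j"
      "(i * ?m + k) mod ?m = k" "(j * ?m + l) mod ?m = l" using kl by simp_all
    show ?thesis
      using arg_cong[OF eq, of "\<lambda>M. M $$ (i * ?m + k, j * ?m + l)"]
      unfolding kron_index[OF c(1,2) le] kron_index[OF c(3,4) le] dm .
  qed
  \<comment> \<open>\<open>B\<close> squares to the identity and is therefore not zero.\<close>
  have "\<exists>k<?m. \<exists>l<?m. B $$ (k,l) \<noteq> 0"
  proof (rule ccontr)
    assume "\<not> ?thesis"
    then have "(\<Sum>l<?m. B $$ (0,l) * B $$ (l,0)) = 0" by (intro sum.neutral) simp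
    moreover have "(B * B) $$ (0,0) = (\<Sum>l<?m. B $$ (0,l) * B $$ (l,0))"
      by (rule index_mat_mult[OF c(2,2)]) simp_all
    ultimately have "(1\<^sub>m ?m :: complex mat) $$ (0,0) = 0"
      using all_pauli_strings_hermitian_involution[OF B] by simp
    then show False by simp
  qed
  then obtain k l where kl: "k < ?m" "l < ?m" "B $$ (k,l) \<noteq> 0" by blast
  have AA: "A = A'" using pauli_proportional[OF A A' kl(3), of "B' $$ (k,l)"] e kl by blast
  obtain i j where ij: "i < 2" "j < 2" "A $$ (i,j) \<noteq> 0" using pauli_nonzero[OF A] by blast
  have "B = B'"
    using c e[OF ij(1,2)] ij(3) by (intro eq_matI) (auto simp: AA[symmetric])
  with AA show "A = A' \<and> B = B'" by simp
qed

lemma all_pauli_strings_finite: "finite (all_pauli_strings n)"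
  by (induction n) (auto simp: all_pauli_strings_0 all_pauli_strings_Suc card_paulis)

lemma all_pauli_strings_card: "card (all_pauli_strings n) = 4 ^ n"
  by (induction n)
     (simp_all add: all_pauli_strings_0 all_pauli_strings_Suc card_image[OF kron_paulis_inj]
       card_cartesian_product card_paulis)

lemma one_in_all_pauli_strings: "1\<^sub>m (2 ^ n) \<in> all_pauli_strings n"
proof (induction n)
  case (Suc n)
  have "1\<^sub>m (2 ^ Suc n) = kron pauli_I (1\<^sub>m (2 ^ n))" by (simp add: pauli_I_def kron_one)
  then show ?case using Suc by (auto simp: all_pauli_strings_Suc paulis_def)
qed (simp add: all_pauli_strings_0)

text \<open>The relation is multiplicative under \<open>kron\<close>; each tensor factor contributes
  a constant 2.\<close>

lemma all_pauli_strings_complete: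
  "i < 2 ^ n \<Longrightarrow> j < 2 ^ n \<Longrightarrow> k < 2 ^ n \<Longrightarrow> l < 2 ^ n \<Longrightarrow>
   (\<Sum>P\<in>all_pauli_strings n. cnj (P $$ (i,j)) * P $$ (k,l)) = (if i = k \<and> j = l then of_nat (2 ^ n) else 0)"
proof (induction n arbitrary: i j k l)
  case 0
  then show ?case by (simp add: all_pauli_strings_0)
next
  case (Suc n)
  let ?m = "2 ^ n :: nat"
  have h: "i < 2 * ?m" "j < 2 * ?m" "k < 2 * ?m" "l < 2 * ?m" using Suc.prems by auto
  note b = div_mod_less[OF h(1)] div_mod_less[OF h(2)] div_mod_less[OF h(3)] div_mod_less[OF h(4)]
  have "(\<Sum>P\<in>all_pauli_strings (Suc n). cnj (P $$ (i,j)) * P $$ (k,l))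
     = (\<Sum>(A,B)\<in>paulis \<times> all_pauli_strings n. cnj (kron A B $$ (i,j)) * kron A B $$ (k,l))"
    unfolding all_pauli_strings_Suc by (subst sum.reindex[OF kron_paulis_inj]) (auto intro!: sum.cong)
  also have "\<dots> = (\<Sum>(A,B)\<in>paulis \<times> all_pauli_strings n.
       (cnj (A $$ (i div ?m, j div ?m)) * A $$ (k div ?m, l div ?m))
       * (cnj (B $$ (i mod ?m, j mod ?m)) * B $$ (k mod ?m, l mod ?m)))"
  proof (intro sum.cong refl, clarify)
    fix A B assume AB: "A \<in> paulis" "B \<in> all_pauli_strings n"
    note c = pauli_carrier[OF AB(1)] all_pauli_strings_carrier[OF AB(2)]
    show "cnj (kron A B $$ (i,j)) * kron A B $$ (k,l) = (cnj (A $$ (i div ?m, j div ?m)) * A $$ (k div ?m, l div ?m))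
       * (cnj (B $$ (i mod ?m, j mod ?m)) * B $$ (k mod ?m, l mod ?m))"
      unfolding kron_index[OF c h(1,2)] kron_index[OF c h(3,4)] by simp
  qed
  also have "\<dots> = (\<Sum>A\<in>paulis. cnj (A $$ (i div ?m, j div ?m)) * A $$ (k div ?m, l div ?m))
       * (\<Sum>B\<in>all_pauli_strings n. cnj (B $$ (i mod ?m, j mod ?m)) * B $$ (k mod ?m, l mod ?m))"
    by (simp add: sum_product sum.cartesian_product)
  also have "\<dots> = (if i div ?m = k div ?m \<and> j div ?m = l div ?m then 2 else 0) *
      (if i mod ?m = k mod ?m \<and> j mod ?m = l mod ?m then of_nat ?m else 0)"
    using b by (simp add: paulis_complete Suc.IH)
  also have "\<dots> = (if i = k \<and> j = l then of_nat (2 ^ Suc n) else 0)"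
  proof -
    have e: "x = y \<longleftrightarrow> x div ?m = y div ?m \<and> x mod ?m = y mod ?m" for x y by (metis div_mult_mod_eq)
    show ?thesis unfolding e[of i k] e[of j l] by auto
  qed
  finally show ?case .
qed

lemma pauli_strings_card: "real (card (pauli_strings n)) = real (2 ^ n) ^ 2 - 1"
proof -
  have "card (pauli_strings n) = 4 ^ n - 1"
    using one_in_all_pauli_strings all_pauli_strings_finite
    by (simp add: pauli_strings_eq card_Diff_singleton all_pauli_strings_card)
  moreover have "(4::nat) ^ n \<ge> 1" by simp
  moreover have "(4::real) ^ n = (2 ^ n) ^ 2"
  proof -
    have "(4::real) ^ n = (2 ^ 2) ^ n" by simp
    also have "\<dots> = (2 ^ n) ^ 2" by (simp only: power_mult[symmetric] mult.commute)
    finally show ?thesis .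
  qed
  ultimately show ?thesis by (simp add: of_nat_diff)
qed

lemma pauli_strings_diagonalizable:
  assumes "P \<in> pauli_strings n"
  shows "\<exists>V s. unitary_mat (2 ^ n) V \<and> (\<forall>i. s i \<in> {1, -1 :: int}) \<and>
    P = V * diagm (2 ^ n) (\<lambda>i. of_int (s i)) * dagger V"
  using assms all_pauli_strings_carrier all_pauli_strings_hermitian_involution
  by (intro involution_diagonalizable) (auto simp: pauli_strings_eq)

subsection \<open>Pauli rotations\<close>

lemma conj_diag_power:
  assumes V: "unitary_mat n V"
  shows "(V * diagm n d * dagger V) ^\<^sub>m k = V * diagm n (\<lambda>i. d i ^ k) * dagger V"
proof (induction k)
  case 0
  show ?case using unitary_matD[OF V] by (simp add: diagm_one)
next
  case (Suc k)
  note V' = unitary_matD[OF V]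
  have c: "V * diagm n e \<in> carrier_mat n n" "diagm n e * dagger V \<in> carrier_mat n n" for e
    using V' by (intro mult_carrier_mat[of _ n n] diagm_carrier; simp)+
  have dV: "dagger V \<in> carrier_mat n n" using V' by simp
  have dd: "diagm n e * diagm n f \<in> carrier_mat n n" for e f by (simp add: diagm_mult)
  have "(V * diagm n d * dagger V) ^\<^sub>m Suc k = (V * diagm n (\<lambda>i. d i ^ k) * dagger V) * (V * diagm n d * dagger V)"
    by (simp add: Suc.IH)
  also have "\<dots> = (V * diagm n (\<lambda>i. d i ^ k)) * (dagger V * (V * (diagm n d * dagger V)))"
    using V'(1) c dV by (simp add: assoc_mult_mat[of _ n n _ n _ n])
  also have "dagger V * (V * (diagm n d * dagger V)) = dagger V * V * (diagm n d * dagger V)"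
    using V'(1) c dV by (intro assoc_mult_mat[symmetric, of _ n n _ n _ n])
  also have "\<dots> = diagm n d * dagger V" using V' c by simp
  also have "V * diagm n (\<lambda>i. d i ^ k) * (diagm n d * dagger V) = V * (diagm n (\<lambda>i. d i ^ k) * diagm n d) * dagger V"
    using V'(1) c dV dd by (simp add: assoc_mult_mat[of _ n n _ n _ n])
  finally show ?case by (simp add: diagm_mult mult.commute)
qed

lemma mat_exp_conj_diag:
  assumes V: "unitary_mat n V"
  shows "mat_exp (V * diagm n d * dagger V) = V * diagm n (\<lambda>i. exp (d i)) * dagger V"
proof (rule eq_matI)
  note V' = unitary_matD[OF V]
  fix i j assume "i < dim_row (V * diagm n (\<lambda>i. exp (d i)) * dagger V)"
    "j < dim_col (V * diagm n (\<lambda>i. exp (d i)) * dagger V)"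
  then have ij: "i < n" "j < n" using V' by auto
  have "(\<lambda>k. \<Sum>m<n. V $$ (i,m) * (d m ^ k /\<^sub>R fact k) * cnj (V $$ (j,m)))
      sums (\<Sum>m<n. V $$ (i,m) * exp (d m) * cnj (V $$ (j,m)))"
    by (intro sums_sum sums_mult sums_mult2 exp_converges)
  moreover have "(\<Sum>m<n. V $$ (i,m) * (d m ^ k /\<^sub>R fact k) * cnj (V $$ (j,m)))
      = ((V * diagm n d * dagger V) ^\<^sub>m k) $$ (i,j) / of_nat (fact k)" for k
    unfolding conj_diag_power[OF V] conj_diag_index[OF V'(1) ij] sum_divide_distrib
    by (intro sum.cong refl) (simp add: scaleR_conv_of_real divide_inverse)
  ultimately have "(\<lambda>k. ((V * diagm n d * dagger V) ^\<^sub>m k) $$ (i,j) / of_nat (fact k))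
      sums (\<Sum>m<n. V $$ (i,m) * exp (d m) * cnj (V $$ (j,m)))" by simp
  then show "mat_exp (V * diagm n d * dagger V) $$ (i,j) = (V * diagm n (\<lambda>i. exp (d i)) * dagger V) $$ (i,j)"
    unfolding conj_diag_index[OF V'(1) ij] using ij V'
    by (simp add: mat_exp_def sums_iff)
qed (use unitary_matD[OF V] in \<open>auto simp: mat_exp_def\<close>)

lemma smult_conj_diag:
  assumes "V \<in> carrier_mat n n"
  shows "c \<cdot>\<^sub>m (V * diagm n d * dagger V) = V * diagm n (\<lambda>i. c * d i) * dagger V"
  using assms by (intro eq_matI)
    (auto simp: conj_diag_index sum_distrib_left mult_ac simp del: index_mult_mat(1) intro!: sum.cong)

lemma cconj_conj_diag:
  assumes "V \<in> carrier_mat n n"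
  shows "cconj_mat (V * diagm n d * dagger V) = cconj_mat V * diagm n (\<lambda>i. cnj (d i)) * dagger (cconj_mat V)"
proof (rule eq_matI)
  fix i j assume "i < dim_row (cconj_mat V * diagm n (\<lambda>i. cnj (d i)) * dagger (cconj_mat V))"
    "j < dim_col (cconj_mat V * diagm n (\<lambda>i. cnj (d i)) * dagger (cconj_mat V))"
  then have ij: "i < n" "j < n" using assms by auto
  have c: "cconj_mat V \<in> carrier_mat n n" using assms by simp
  have "cconj_mat (V * diagm n d * dagger V) $$ (i,j) = cnj ((V * diagm n d * dagger V) $$ (i,j))"
    using ij assms by (intro cconj_index) auto
  then show "cconj_mat (V * diagm n d * dagger V) $$ (i,j)
      = (cconj_mat V * diagm n (\<lambda>i. cnj (d i)) * dagger (cconj_mat V)) $$ (i,j)"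
    unfolding conj_diag_index[OF assms ij] conj_diag_index[OF c ij] using ij assms by simp
qed (use assms in auto)

lemma unitary_cconj:
  assumes "unitary_mat n V" shows "unitary_mat n (cconj_mat V)"
proof (rule unitary_matI)
  note V' = unitary_matD[OF assms]
  have d: "dagger (cconj_mat V) = cconj_mat (dagger V)"
    by (intro eq_matI) auto
  have o: "cconj_mat (1\<^sub>m n) = 1\<^sub>m n" by (intro eq_matI) auto
  have "cconj_mat V * dagger (cconj_mat V) = cconj_mat (V * dagger V)"
    unfolding d using V' by (intro cconj_mult[symmetric]) auto
  then show "cconj_mat V * dagger (cconj_mat V) = 1\<^sub>m n \<or> dagger (cconj_mat V) * cconj_mat V = 1\<^sub>m n"
    using V' o by simp
qed (use unitary_matD[OF assms] in simp)

text \<open>The eigenvalues \<open>s\<close> are real, so the exponential in the conjugated slots is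
  the entrywise conjugate of the rotation \<open>U\<close>. The integrand is thus the representation
  evaluated at one unitary.\<close>

lemma pauli_rot_moment_conj_diag:
  fixes s :: "nat \<Rightarrow> int" and \<theta> :: real
  assumes V: "unitary_mat N V"
  defines "U \<equiv> V * diagm N (\<lambda>i. exp (\<i> * of_real \<theta> / 2 * of_int (s i))) * dagger V"
  shows "pauli_rot_moment t (V * diagm N (\<lambda>i. of_int (s i)) * dagger V) \<theta>
     = kron (tensor_pow U t) (tensor_pow (cconj_mat U) t)"
proof -
  note V' = unitary_matD[OF V]
  have cV: "cconj_mat V \<in> carrier_mat N N" using V' by simp
  have "mat_exp ((\<i> * of_real \<theta> / 2) \<cdot>\<^sub>m (V * diagm N (\<lambda>i. of_int (s i)) * dagger V)) = U"
    by (simp only: smult_conj_diag[OF V'(1)] mat_exp_conj_diag[OF V] U_def)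
  moreover have "mat_exp ((- \<i> * of_real \<theta> / 2) \<cdot>\<^sub>m cconj_mat (V * diagm N (\<lambda>i. of_int (s i)) * dagger V)) = cconj_mat U"
    unfolding cconj_conj_diag[OF V'(1)] smult_conj_diag[OF cV] mat_exp_conj_diag[OF unitary_cconj[OF V]] U_def
    by (simp add: exp_cnj)
  ultimately show ?thesis by (simp add: pauli_rot_moment_def)
qed

lemma integral_uniform_exp:
  fixes m :: int
  shows "integral\<^sup>L (uniform_measure lborel {-pi<..<pi}) (\<lambda>\<theta>. exp (\<i> * of_real \<theta> * of_int m))
     = (if m = 0 then 1 else 0)"
    and "integrable (uniform_measure lborel {-pi<..<pi}) (\<lambda>\<theta>. exp (\<i> * of_real \<theta> * of_int m))"
proof -
  let ?M = "uniform_measure lborel {-pi<..<pi}"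
  let ?f = "\<lambda>\<theta>. exp (\<i> * complex_of_real \<theta> * of_int m)"
  have e: "emeasure lborel {-pi<..<pi} = ennreal (2 * pi)" by (simp add: emeasure_lborel_Ioo)
  interpret prob_space ?M by (rule prob_space_uniform_measure) (auto simp: e)
  show "integrable ?M ?f"
    by (rule integrable_const_bound[where B = 1]) auto
  have "?M = density lborel (\<lambda>x. ennreal (indicator {-pi<..<pi} x / (2 * pi)))"
    unfolding uniform_measure_def e
    by (intro density_cong) (auto simp: divide_ennreal[symmetric] ennreal_indicator split: split_indicator)
  then have "integral\<^sup>L ?M ?f = integral\<^sup>L lborel (\<lambda>x. (indicator {-pi<..<pi} x / (2 * pi)) *\<^sub>R ?f x)"
    by (simp only:) (intro integral_density, auto)
  \<comment> \<open>The fundamental theorem of calculus is applied on the closed interval; the two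
    end points are a null set.\<close>
  also have "\<dots> = integral\<^sup>L lborel (\<lambda>x. (1 / (2 * pi)) *\<^sub>R (indicator {-pi..pi} x *\<^sub>R ?f x))"
  proof (rule integral_cong_AE)
    have "AE x in lborel. x \<noteq> pi" "AE x in lborel. x \<noteq> -pi" by (rule AE_lborel_singleton)+
    then show "AE x in lborel. (indicator {-pi<..<pi} x / (2 * pi)) *\<^sub>R ?f x
        = (1 / (2 * pi)) *\<^sub>R (indicator {-pi..pi} x *\<^sub>R ?f x)"
      by eventually_elim (auto split: split_indicator)
  qed auto
  also have "\<dots> = (1 / (2 * pi)) *\<^sub>R integral\<^sup>L lborel (\<lambda>x. indicator {-pi..pi} x *\<^sub>R ?f x)"
    by (rule integral_scaleR_right)
  also have "integral\<^sup>L lborel (\<lambda>x. indicator {-pi..pi} x *\<^sub>R ?f x) = (if m = 0 then 2 * pi else 0)"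
  proof (cases "m = 0")
    case True
    have "integral\<^sup>L lborel (\<lambda>x. indicator {-pi..pi} x *\<^sub>R ?f x) = complex_of_real pi - complex_of_real (-pi)"
      using True
      by (intro integral_FTC_atLeastAtMost) (auto intro!: derivative_eq_intros continuous_intros)
    then show ?thesis using True by simp
  next
    case False
    let ?F = "\<lambda>x. exp (\<i> * complex_of_real x * of_int m) / (\<i> * of_int m)"
    have "integral\<^sup>L lborel (\<lambda>x. indicator {-pi..pi} x *\<^sub>R ?f x) = ?F pi - ?F (-pi)"
    proof (rule integral_FTC_atLeastAtMost)
      fix x :: real
      have "((\<lambda>z. exp (\<i> * z * of_int m) / (\<i> * of_int m)) has_field_derivative ?f x) (at (complex_of_real x))"
        using False by (auto intro!: derivative_eq_intros)
      from has_vector_derivative_real_field[OF this]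
      show "(?F has_vector_derivative ?f x) (at x within {-pi..pi})" by simp
    qed (auto intro!: continuous_intros)
    also have "?F pi - ?F (-pi) = 0"
    proof -
      \<comment> \<open>The exponents differ by m times the period of the exponential.\<close>
      have "exp (\<i> * complex_of_real pi * of_int m) = exp (\<i> * complex_of_real (-pi) * of_int m)"
        unfolding exp_eq by (rule exI[of _ m]) (simp add: algebra_simps)
      then show ?thesis by simp
    qed
    finally show ?thesis using False by simp
  qed
  also have "(1 / (2 * pi)) *\<^sub>R complex_of_real (if m = 0 then 2 * pi else 0) = (if m = 0 then 1 else 0)"
    by (simp add: scaleR_conv_of_real)
  finally show "integral\<^sup>L ?M ?f = (if m = 0 then 1 else 0)" by simp
qed

section \<open>Angle averages as kernel projections\<close>

context urep
begin

definition kernel_proj_mat :: "complex mat \<Rightarrow> (nat \<Rightarrow> int) \<Rightarrow> complex mat" where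
  "kernel_proj_mat V s = T V * diagm D (\<lambda>x. if (\<Sum>i<N. s i * w x i) = 0 then 1 else 0) * dagger (T V)"

lemma kernel_proj_mat_carrier [simp]:
  assumes "unitary_mat N V" shows "kernel_proj_mat V s \<in> carrier_mat D D"
proof -
  have "T V \<in> carrier_mat D D" using assms by (intro T_carrier) (simp add: unitary_mat_def)
  then show ?thesis unfolding kernel_proj_mat_def
    by (intro mult_carrier_mat[of _ D D] diagm_carrier) auto
qed

lemma kernel_proj_mat_mult_vec:
  assumes V: "unitary_mat N V" and v: "v \<in> carrier_vec D"
  shows "kernel_proj_mat V s *\<^sub>v v = kernel_proj V s v"
proof -
  have TV: "T V \<in> carrier_mat D D" using V by (intro T_carrier) (simp add: unitary_mat_def)
  let ?E = "diagm D (\<lambda>x. if (\<Sum>i<N. s i * w x i) = 0 then 1 else 0)"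
  have TE: "T V * ?E \<in> carrier_mat D D" using TV by (intro mult_carrier_mat[of _ D D] diagm_carrier)
  have u: "dagger (T V) *\<^sub>v v \<in> carrier_vec D" using TV v by simp
  have "kernel_proj_mat V s *\<^sub>v v = (T V * ?E) *\<^sub>v (dagger (T V) *\<^sub>v v)"
    unfolding kernel_proj_mat_def using TV v by (intro assoc_mult_mat_vec[OF TE]) auto
  also have "\<dots> = T V *\<^sub>v (?E *\<^sub>v (dagger (T V) *\<^sub>v v))"
    by (rule assoc_mult_mat_vec[OF TV diagm_carrier u])
  also have "?E *\<^sub>v (dagger (T V) *\<^sub>v v) = restr (\<lambda>x. (\<Sum>i<N. s i * w x i) = 0) (dagger (T V) *\<^sub>v v)"
    using TV v by (intro eq_vecI) (auto simp: diagm_mult_vec[OF u] simp del: index_mult_mat_vec)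
  finally show ?thesis by (simp add: kernel_proj_def)
qed

lemma kernel_proj_mat_hermitian:
  assumes V: "unitary_mat N V"
  shows "dagger (kernel_proj_mat V s) = kernel_proj_mat V s"
proof -
  have TV: "T V \<in> carrier_mat D D" using V by (intro T_carrier) (simp add: unitary_mat_def)
  show ?thesis
    using carrier_matD[OF TV] unfolding kernel_proj_mat_def
    by (intro eq_matI) (auto simp: conj_diag_index[OF TV] mult_ac simp del: index_mult_mat(1) intro!: sum.cong)
qed

text \<open>The weights of \<open>V diag(s) V\<^sup>\<dagger>\<close> are even because the total charge vanishes, so the average over
  a single period of \<open>\<theta>\<close> already projects exactly onto the kernel.\<close>
lemma integral_rotation:
  fixes s :: "nat \<Rightarrow> int"
  assumes V: "unitary_mat N V" and s: "\<And>i. s i \<in> {1,-1}" and c0: "c = 0" and xy: "x < D" "y < D"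
  shows "integral\<^sup>L (uniform_measure lborel {-pi<..<pi})
      (\<lambda>\<theta>. T (V * diagm N (\<lambda>i. exp (\<i> * of_real \<theta> / 2 * of_int (s i))) * dagger V) $$ (x,y))
    = kernel_proj_mat V s $$ (x,y)"
proof -
  note V' = unitary_matD[OF V]
  note TV = T_carrier[OF V'(1)]
  define \<sigma> where "\<sigma> z = (\<Sum>i<N. s i * w z i)" for z
  define m where "m z = \<sigma> z div 2" for z
  have \<sigma>m: "\<sigma> z = 2 * m z" if z: "z < D" for z
  proof -
    \<comment> \<open>The added sum is the total charge, which is 0, and the new coefficients
      \<open>s i + 1\<close> are 0 or 2.\<close>
    have "\<sigma> z + (\<Sum>i<N. w z i) = (\<Sum>i<N. (s i + 1) * w z i)"
      by (simp add: \<sigma>_def sum.distrib algebra_simps)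
    moreover have "even (\<Sum>i<N. (s i + 1) * w z i)"
    proof (rule dvd_sum)
      fix i show "2 dvd (s i + 1) * w z i" using s[of i] by auto
    qed
    ultimately have "even (\<sigma> z)" using charge[OF z] c0 by simp
    then show ?thesis by (simp add: m_def)
  qed
  have TU: "T (V * diagm N (\<lambda>i. exp (\<i> * of_real \<theta> / 2 * of_int (s i))) * dagger V) $$ (x,y)
     = (\<Sum>z<D. T V $$ (x,z) * exp (\<i> * of_real \<theta> * of_int (m z)) * cnj (T V $$ (y,z)))" for \<theta> :: real
  proof -
    let ?l = "\<lambda>i. exp (\<i> * of_real \<theta> / 2 * of_int (s i))"
    have l1: "cmod (?l i) = 1" for i by (simp add: norm_exp_eq_Re)
    have Tl: "T (diagm N ?l) = diagm D (\<lambda>z. exp (\<i> * of_real \<theta> * of_int (m z)))"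
      unfolding T_diag[of ?l, OF l1]
    proof (rule diagm_cong)
      fix z assume z: "z < D"
      have "(\<Prod>i<N. ?l i powi w z i) = exp (\<Sum>i<N. \<i> * of_real \<theta> / 2 * of_int (s i * w z i))"
        by (simp add: exp_power_int exp_sum mult_ac)
      also have "(\<Sum>i<N. \<i> * of_real \<theta> / 2 * of_int (s i * w z i)) = \<i> * of_real \<theta> / 2 * of_int (\<sigma> z)"
        by (simp add: \<sigma>_def sum_distrib_left)
      also have "\<dots> = \<i> * of_real \<theta> * of_int (m z)" unfolding \<sigma>m[OF z] by simp
      finally show "(\<Prod>i<N. ?l i powi w z i) = exp (\<i> * of_real \<theta> * of_int (m z))" .
    qed
    have "V * diagm N ?l \<in> carrier_mat N N" using V' by (intro mult_carrier_mat[of _ N N] diagm_carrier)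
    then have "T (V * diagm N ?l * dagger V) = T V * T (diagm N ?l) * dagger (T V)"
      using V' by (simp add: T_mult T_dagger)
    then show ?thesis unfolding Tl by (simp only: conj_diag_index[OF TV xy])
  qed
  have "integral\<^sup>L (uniform_measure lborel {-pi<..<pi})
      (\<lambda>\<theta>. \<Sum>z<D. T V $$ (x,z) * exp (\<i> * of_real \<theta> * of_int (m z)) * cnj (T V $$ (y,z)))
    = (\<Sum>z<D. T V $$ (x,z) * (if m z = 0 then 1 else 0) * cnj (T V $$ (y,z)))"
    using integral_uniform_exp(2)
    by (subst Bochner_Integration.integral_sum) (auto simp: integral_uniform_exp(1))
  also have "\<dots> = kernel_proj_mat V s $$ (x,y)"
    unfolding kernel_proj_mat_def conj_diag_index[OF TV xy] \<sigma>_def[symmetric]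
    by (intro sum.cong) (auto simp: \<sigma>m)
  finally show ?thesis by (simp only: TU)
qed

text \<open>A vector fixed by the torus is supported on weight zero, hence lies in the kernel.\<close>
lemma kernel_proj_fixed:
  assumes V: "unitary_mat N V" and v: "v \<in> carrier_vec D"
    and fixed: "\<And>U. unitary_mat N U \<Longrightarrow> T U *\<^sub>v v = v"
  shows "kernel_proj V s v = v"
proof -
  note V' = unitary_matD[OF V]
  have Tv: "dagger (T V) *\<^sub>v v = v"
    using fixed[OF unitary_dagger[OF V]] T_dagger[OF V'(1)] by simp
  have "v $ x = 0" if x: "x < D" and \<sigma>: "(\<Sum>i<N. s i * w x i) \<noteq> 0" for x
  proof (rule ccontr)
    assume vx: "v $ x \<noteq> 0"
    let ?\<sigma> = "(\<Sum>i<N. s i * w x i)"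
    \<comment> \<open>The angle is chosen so that this torus element multiplies the coordinate
      \<open>x\<close> by -1, although it must fix \<open>v\<close>.\<close>
    define l where "l i = exp (\<i> * of_real (pi / ?\<sigma>) * of_int (s i))" for i
    have l1: "cmod (l i) = 1" for i by (simp add: l_def norm_exp_eq_Re)
    have "(\<Prod>i<N. l i powi w x i) = exp (\<Sum>i<N. \<i> * of_real (pi / ?\<sigma>) * of_int (s i * w x i))"
      by (simp add: l_def exp_power_int exp_sum mult_ac)
    also have "(\<Sum>i<N. \<i> * of_real (pi / ?\<sigma>) * of_int (s i * w x i)) = \<i> * of_real (pi / ?\<sigma>) * of_int ?\<sigma>"
      by (simp only: sum_distrib_left of_int_sum)
    also have "\<dots> = of_real pi * \<i>"
    proof -
      have "\<i> * complex_of_real (pi / of_int k) * of_int k = of_real pi * \<i>" if "k \<noteq> 0" for k :: int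
        using that by (simp add: field_simps)
      then show ?thesis using \<sigma> by blast
    qed
    finally have "(\<Prod>i<N. l i powi w x i) = -1" by simp
    moreover have "(T (diagm N l) *\<^sub>v v) $ x = (\<Prod>i<N. l i powi w x i) * v $ x"
      unfolding T_diag[of l, OF l1] by (rule diagm_mult_vec[OF v x])
    moreover have "T (diagm N l) *\<^sub>v v = v" using l1 by (intro fixed unitary_diagm)
    ultimately show False using vx by simp
  qed
  then have "restr (\<lambda>x. (\<Sum>i<N. s i * w x i) = 0) v = v"
    using v by (intro eq_vecI) auto
  then show ?thesis using fixed[OF V] by (simp add: kernel_proj_def Tv)
qed

end

subsection \<open>Moments of the Haar measure\<close>

lemma det_dagger: "A \<in> carrier_mat n n \<Longrightarrow> Determinant.det (dagger A) = cnj (Determinant.det A)"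
proof -
  assume A: "A \<in> carrier_mat n n"
  interpret comm_ring_hom cnj by unfold_locales auto
  show ?thesis using A by (simp add: dagger_def cconj_mat_def det_transpose[of _ n])
qed

lemma SU_iff: "U \<in> SU N \<longleftrightarrow> unitary_mat N U \<and> Determinant.det U = 1"
  using unitary_matI[of U N] unitary_matD[of N U] by (auto simp: SU_def)

lemma SU_mult:
  assumes "U \<in> SU N" "V \<in> SU N" shows "U * V \<in> SU N"
  using assms unitary_mult[of N U V] by (auto simp: SU_iff det_mult[of U N V] unitary_mat_def)

lemma SU_dagger: "U \<in> SU N \<Longrightarrow> dagger U \<in> SU N"
  by (auto simp: SU_iff unitary_dagger det_dagger[of U N] unitary_mat_def)

lemma prod_powi_const:
  fixes l :: complex and f :: "nat \<Rightarrow> int" and m :: nat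
  assumes "l \<noteq> 0"
  shows "(\<Prod>i<m. l powi f i) = l powi (\<Sum>i<m. f i)"
  using assms by (induction m) (auto simp: power_int_add)

text \<open>\<open>l\<close> is an N-th root of the inverse determinant. This transfers invariance
  from SU(N), where the Haar measure lives, to all unitaries, where the diagonalising matrices
  live.\<close>

lemma unitary_phase:
  assumes U: "unitary_mat N U" and N: "N > 0"
  shows "\<exists>l. cmod l = 1 \<and> U * diagm N (\<lambda>_. l) \<in> SU N"
proof -
  note U' = unitary_matD[OF U]
  let ?d = "Determinant.det U"
  have "?d * cnj ?d = Determinant.det (U * dagger U)"
    using U'(1) det_mult[of U N "dagger U"] by (simp add: det_dagger[of U N])
  then have "complex_of_real ((cmod ?d)\<^sup>2) = 1" using U' by (simp add: complex_norm_square del: of_real_power)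
  then have "(cmod ?d)\<^sup>2 = 1" by (simp only: of_real_eq_1_iff)
  then have "cmod ?d = 1" using norm_ge_zero[of ?d] by (auto simp: power2_eq_1_iff)
  then obtain a where "?d = Complex (cos a) (sin a)" by (rule complex_unimodular_polar)
  then have a: "?d = cis a" by (simp add: complex_eq_iff)
  define l where "l = cis (- a / real N)"
  have "l ^ N = cis (- a)" unfolding l_def Complex.DeMoivre using N by simp
  moreover have "diagm N (\<lambda>_. l) = l \<cdot>\<^sub>m 1\<^sub>m N" by (intro eq_matI) auto
  ultimately have "Determinant.det (U * diagm N (\<lambda>_. l)) = 1"
    using U' by (simp add: det_mult[of U N] a cis_mult)
  moreover have "cmod l = 1" by (simp add: l_def)
  ultimately show ?thesis using unitary_mult[OF U unitary_diagm[of N "\<lambda>_. l"]] by (auto simp: SU_iff)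
qed

text \<open>Rows of a unitary matrix have norm 1. The bound makes the entries of the representation
  integrable.\<close>

lemma unitary_entry_le_1:
  assumes U: "unitary_mat n U" and ij: "i < n" "j < n"
  shows "cmod (U $$ (i,j)) \<le> 1"
proof -
  note U' = unitary_matD[OF U]
  have "(\<Sum>l<n. U $$ (i,l) * dagger U $$ (l,i)) = (U * dagger U) $$ (i,i)"
    using U' ij by (intro index_mat_mult[symmetric]) auto
  also have "\<dots> = 1" using U' ij by simp
  finally have "complex_of_real (\<Sum>l<n. (cmod (U $$ (i,l)))\<^sup>2) = 1"
    using U' ij by (simp add: complex_norm_square del: of_real_power)
  then have "(\<Sum>l<n. (cmod (U $$ (i,l)))\<^sup>2) = 1" by (simp only: of_real_eq_1_iff)
  moreover have "(cmod (U $$ (i,j)))\<^sup>2 \<le> (\<Sum>l<n. (cmod (U $$ (i,l)))\<^sup>2)"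
    using ij by (intro member_le_sum) auto
  ultimately have "(cmod (U $$ (i,j)))\<^sup>2 \<le> 1\<^sup>2" by simp
  then show ?thesis by (rule power2_le_imp_le) simp
qed

lemma tensor_pow_carrier: "A \<in> carrier_mat N N \<Longrightarrow> tensor_pow A k \<in> carrier_mat (N ^ k) (N ^ k)"
  by (induction k) auto

lemma SU_entry_measurable:
  assumes "sets M = sets (SU_borel N)" "space M = SU N" "i < N" "j < N"
  shows "(\<lambda>U. U $$ (i,j)) \<in> borel_measurable M"
proof (rule measurableI)
  let ?G = "{(\<lambda>U. U $$ (i,j)) -` B \<inter> SU N | i j B. i < N \<and> j < N \<and> B \<in> sets (borel :: complex measure)}"
  fix B :: "complex set" assume "B \<in> sets borel"
  then have "(\<lambda>U. U $$ (i,j)) -` B \<inter> SU N \<in> ?G" using assms(3,4) by blast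
  then have "(\<lambda>U. U $$ (i,j)) -` B \<inter> SU N \<in> sigma_sets (SU N) ?G" by (rule sigma_sets.Basic)
  also have "sigma_sets (SU N) ?G = sets M"
    unfolding assms(1) SU_borel_def by (subst sets_measure_of) auto
  finally show "(\<lambda>U. U $$ (i,j)) -` B \<inter> space M \<in> sets M" by (simp add: assms(2))
qed simp

lemma tensor_pow_measurable:
  assumes F: "\<And>U. U \<in> space M \<Longrightarrow> F U \<in> carrier_mat N N"
    and meas: "\<And>i j. i < N \<Longrightarrow> j < N \<Longrightarrow> (\<lambda>U. F U $$ (i,j)) \<in> borel_measurable M"
  shows "x < N ^ k \<Longrightarrow> y < N ^ k \<Longrightarrow> (\<lambda>U. tensor_pow (F U) k $$ (x,y)) \<in> borel_measurable M"
proof (induction k arbitrary: x y)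
  case (Suc k)
  have xy: "x < N * N ^ k" "y < N * N ^ k" using Suc.prems by auto
  note b = div_mod_less[OF xy(1)] div_mod_less[OF xy(2)]
  have "(\<lambda>U. tensor_pow (F U) (Suc k) $$ (x,y)) \<in> borel_measurable M \<longleftrightarrow>
    (\<lambda>U. F U $$ (x div N ^ k, y div N ^ k) * tensor_pow (F U) k $$ (x mod N ^ k, y mod N ^ k)) \<in> borel_measurable M"
  proof (rule measurable_cong)
    fix U assume "U \<in> space M"
    from F[OF this] have "F U \<in> carrier_mat N N" .
    then show "tensor_pow (F U) (Suc k) $$ (x,y)
      = F U $$ (x div N ^ k, y div N ^ k) * tensor_pow (F U) k $$ (x mod N ^ k, y mod N ^ k)"
      unfolding tensor_pow.simps using xy by (intro kron_index tensor_pow_carrier)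
  qed
  then show ?case using meas[OF b(1,3)] Suc.IH[OF b(2,4)] by simp
qed simp

lemma left_mult_measurable:
  assumes M: "sets M = sets (SU_borel N)" "space M = SU N" and V: "V \<in> SU N"
  shows "(\<lambda>U. V * U) \<in> measurable M M"
proof -
  let ?G = "{(\<lambda>U. U $$ (i,j)) -` B \<inter> SU N | i j B. i < N \<and> j < N \<and> B \<in> sets (borel :: complex measure)}"
  have VU: "V * U \<in> SU N" if "U \<in> SU N" for U using V that by (rule SU_mult)
  have "V \<in> carrier_mat N N" using V by (simp add: SU_def)
  have entry: "(\<lambda>U. (V * U) $$ (i,j)) \<in> borel_measurable M" if ij: "i < N" "j < N" for i j
  proof -
    have "(\<lambda>U. (V * U) $$ (i,j)) \<in> borel_measurable M \<longleftrightarrow>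
      (\<lambda>U. \<Sum>l<N. V $$ (i,l) * U $$ (l,j)) \<in> borel_measurable M"
      using \<open>V \<in> carrier_mat N N\<close> ij
      by (intro measurable_cong index_mat_mult) (auto simp: M(2) SU_def)
    moreover have "(\<lambda>U. \<Sum>l<N. V $$ (i,l) * U $$ (l,j)) \<in> borel_measurable M"
      using SU_entry_measurable[OF M _ ij(2)] by (intro borel_measurable_sum borel_measurable_times) auto
    ultimately show ?thesis by simp
  qed
  show ?thesis
  proof (rule measurable_sigma_sets)
    show "sets M = sigma_sets (SU N) ?G"
      unfolding M(1) SU_borel_def by (subst sets_measure_of) auto
    show "?G \<subseteq> Pow (SU N)" by auto
    show "(\<lambda>U. V * U) \<in> space M \<rightarrow> SU N" using VU M(2) by auto
    fix Y assume "Y \<in> ?G"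
    then obtain i j B where ij: "i < N" "j < N" and B: "B \<in> sets (borel :: complex measure)"
      and Y: "Y = (\<lambda>U. U $$ (i,j)) -` B \<inter> SU N" by blast
    have "(\<lambda>U. V * U) -` Y \<inter> space M = (\<lambda>U. (V * U) $$ (i,j)) -` B \<inter> space M"
      using VU M(2) Y by auto
    also have "\<dots> \<in> sets M" using entry[OF ij] B by (rule measurable_sets)
    finally show "(\<lambda>U. V * U) -` Y \<inter> space M \<in> sets M" .
  qed
qed

section \<open>The Haar moment as the orthogonal projection onto the invariants\<close>

abbreviation (input) mixed_tensor :: "nat \<Rightarrow> complex mat \<Rightarrow> complex mat" where
  "mixed_tensor t U \<equiv> kron (tensor_pow U t) (tensor_pow (cconj_mat U) t)"

context urep
begin

text \<open>A scalar \<open>l\<close> acts on every weight vector by \<open>l\<close> to the power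
  of the total charge, which is 0.\<close>

lemma T_phase:
  assumes "U \<in> carrier_mat N N" "cmod l = 1" "c = 0"
  shows "T (U * diagm N (\<lambda>_. l)) = T U"
proof -
  have "l \<noteq> 0" using assms(2) by auto
  have "T (diagm N (\<lambda>_. l)) = 1\<^sub>m D"
    unfolding diagm_one[symmetric] using assms(2)
    by (subst T_diag) (auto intro!: diagm_cong simp: prod_powi_const[OF \<open>l \<noteq> 0\<close>] charge assms(3))
  then show ?thesis using assms(1) T_carrier[OF assms(1)] by (simp add: T_mult)
qed

end

locale haar_moment = urep N "N ^ (2 * t)" 0 d "\<lambda>U. mixed_tensor t U" g w
  for N t d g w +
  fixes M :: "complex mat measure"
  assumes haar: "haar_SU N M" and N: "N > 0"
begin

abbreviation "D \<equiv> N ^ (2 * t)"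
abbreviation "T \<equiv> mixed_tensor t"
abbreviation "H \<equiv> H_haar M N t"

lemma haar': "prob_space M" "space M = SU N" "sets M = sets (SU_borel N)"
  "V \<in> SU N \<Longrightarrow> distr M M (\<lambda>U. V * U) = M"
  using haar by (auto simp: haar_SU_def)

lemma H_carrier: "H \<in> carrier_mat D D"
  by (simp add: H_haar_def Let_def)

lemma H_dim [simp]: "dim_row H = D" "dim_col H = D"
  using H_carrier by auto

lemma H_index: "x < D \<Longrightarrow> y < D \<Longrightarrow> H $$ (x,y) = integral\<^sup>L M (\<lambda>U. T U $$ (x,y))"
  by (simp add: H_haar_def Let_def)

lemma SU_unitary: "U \<in> SU N \<Longrightarrow> unitary_mat N U"
  by (simp add: SU_iff)

lemma T_SU: "U \<in> SU N \<Longrightarrow> T U \<in> carrier_mat D D"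
  by (intro T_carrier) (simp add: SU_def)

lemma T_measurable:
  assumes "x < D" "y < D"
  shows "(\<lambda>U. T U $$ (x,y)) \<in> borel_measurable M"
proof -
  have xy: "x < N ^ t * N ^ t" "y < N ^ t * N ^ t" using assms by (simp_all add: mult_2 power_add)
  note b = div_mod_less[OF xy(1)] div_mod_less[OF xy(2)]
  have c: "U \<in> carrier_mat N N" "cconj_mat U \<in> carrier_mat N N" if "U \<in> space M" for U
    using that by (auto simp: haar'(2) SU_def)
  have e: "(\<lambda>U. U $$ (i,j)) \<in> borel_measurable M" if "i < N" "j < N" for i j
    using SU_entry_measurable[OF haar'(3,2)] that by blast
  have e': "(\<lambda>U. cconj_mat U $$ (i,j)) \<in> borel_measurable M" if ij: "i < N" "j < N" for i j
  proof -
    have "(\<lambda>U. cconj_mat U $$ (i,j)) \<in> borel_measurable M \<longleftrightarrow> (\<lambda>U. cnj (U $$ (i,j))) \<in> borel_measurable M"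
      using c ij by (intro measurable_cong cconj_index) auto
    moreover have "cnj \<in> borel_measurable borel"
      by (intro borel_measurable_continuous_onI continuous_on_cnj continuous_on_id)
    ultimately show ?thesis using measurable_compose[OF e[OF ij]] by simp
  qed
  have "(\<lambda>U. T U $$ (x,y)) \<in> borel_measurable M \<longleftrightarrow>
    (\<lambda>U. tensor_pow U t $$ (x div N ^ t, y div N ^ t) * tensor_pow (cconj_mat U) t $$ (x mod N ^ t, y mod N ^ t))
      \<in> borel_measurable M"
  proof (rule measurable_cong)
    fix U assume "U \<in> space M"
    from tensor_pow_carrier[OF c(1)[OF this]] tensor_pow_carrier[OF c(2)[OF this]]
    show "T U $$ (x,y) = tensor_pow U t $$ (x div N ^ t, y div N ^ t)
        * tensor_pow (cconj_mat U) t $$ (x mod N ^ t, y mod N ^ t)"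
      using xy by (rule kron_index)
  qed
  then show ?thesis
    using tensor_pow_measurable[of M "\<lambda>U. U", OF c(1) e b(1,3)]
      tensor_pow_measurable[of M cconj_mat, OF c(2) e' b(2,4)] by simp
qed

lemma T_integrable:
  assumes "x < D" "y < D"
  shows "integrable M (\<lambda>U. T U $$ (x,y))"
proof -
  interpret prob_space M by (rule haar'(1))
  show ?thesis
  proof (rule integrable_const_bound[where B = 1])
    show "AE U in M. cmod (T U $$ (x,y)) \<le> 1"
    proof (rule AE_I2)
      fix U assume "U \<in> space M"
      then have "unitary_mat N U" by (intro SU_unitary) (simp add: haar'(2))
      from unitary_entry_le_1[OF T_unitary[OF this] assms] show "cmod (T U $$ (x,y)) \<le> 1" .
    qed
  qed (rule T_measurable[OF assms])
qed

lemma T_H_SU: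
  assumes V: "V \<in> SU N"
  shows "T V * H = H"
proof (rule eq_matI)
  have Vc: "V \<in> carrier_mat N N" using V by (simp add: SU_def)
  fix x y assume "x < dim_row H" "y < dim_col H"
  then have xy: "x < D" "y < D" by auto
  have "(T V * H) $$ (x,y) = (\<Sum>z<D. T V $$ (x,z) * integral\<^sup>L M (\<lambda>U. T U $$ (z,y)))"
    unfolding index_mat_mult[OF T_SU[OF V] H_carrier xy] using xy by (intro sum.cong) (auto simp: H_index)
  also have "\<dots> = integral\<^sup>L M (\<lambda>U. \<Sum>z<D. T V $$ (x,z) * T U $$ (z,y))"
    using T_integrable xy by (subst Bochner_Integration.integral_sum) auto
  also have "\<dots> = integral\<^sup>L M (\<lambda>U. T (V * U) $$ (x,y))"
  proof (rule Bochner_Integration.integral_cong[OF refl])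
    fix U assume "U \<in> space M"
    then have U: "U \<in> SU N" by (simp add: haar'(2))
    then have "U \<in> carrier_mat N N" by (simp add: SU_def)
    show "(\<Sum>z<D. T V $$ (x,z) * T U $$ (z,y)) = T (V * U) $$ (x,y)"
      unfolding T_mult[OF Vc \<open>U \<in> carrier_mat N N\<close>] by (rule index_mat_mult[OF T_SU[OF V] T_SU[OF U] xy, symmetric])
  qed
  also have "\<dots> = integral\<^sup>L (distr M M (\<lambda>U. V * U)) (\<lambda>U. T U $$ (x,y))"
    by (rule integral_distr[symmetric, OF left_mult_measurable[OF haar'(3,2) V] T_measurable[OF xy]])
  also have "\<dots> = H $$ (x,y)" using xy by (simp add: haar'(4)[OF V] H_index)
  finally show "(T V * H) $$ (x,y) = H $$ (x,y)" .
qed (use T_SU[OF V] in auto)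

lemma T_H:
  assumes V: "unitary_mat N V"
  shows "T V * H = H"
proof -
  obtain l where "cmod l = 1" "V * diagm N (\<lambda>_. l) \<in> SU N" using unitary_phase[OF V N] by blast
  then show ?thesis using T_H_SU T_phase[of V l] unitary_matD(1)[OF V] by fastforce
qed

text \<open>Averages the identity \<open>dagger (T U) * H = H\<close> over \<open>U\<close>. Since
  the left side is Hermitian, \<open>H\<close> is Hermitian and idempotent at once, from left
  invariance alone and without invariance under inversion.\<close>

lemma H_dagger_H: "dagger H * H = H"
proof (rule eq_matI)
  interpret prob_space M by (rule haar'(1))
  fix x y assume "x < dim_row H" "y < dim_col H"
  then have xy: "x < D" "y < D" by auto
  have "(dagger H * H) $$ (x,y) = (\<Sum>z<D. dagger H $$ (x,z) * H $$ (z,y))"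
    using xy H_carrier by (intro index_mat_mult) auto
  also have "\<dots> = (\<Sum>z<D. integral\<^sup>L M (\<lambda>U. cnj (T U $$ (z,x))) * H $$ (z,y))"
    using xy by (intro sum.cong) (auto simp: H_index)
  also have "\<dots> = integral\<^sup>L M (\<lambda>U. \<Sum>z<D. cnj (T U $$ (z,x)) * H $$ (z,y))"
    using T_integrable xy by (subst Bochner_Integration.integral_sum) auto
  also have "\<dots> = integral\<^sup>L M (\<lambda>U. H $$ (x,y))"
  proof (rule Bochner_Integration.integral_cong[OF refl])
    fix U assume "U \<in> space M"
    then have U: "U \<in> SU N" by (simp add: haar'(2))
    have "(\<Sum>z<D. cnj (T U $$ (z,x)) * H $$ (z,y)) = (\<Sum>z<D. dagger (T U) $$ (x,z) * H $$ (z,y))"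
      using xy carrier_matD[OF T_SU[OF U]] by (intro sum.cong) (auto simp del: kron_dim)
    also have "\<dots> = (dagger (T U) * H) $$ (x,y)"
      using xy T_SU[OF U] H_carrier by (intro index_mat_mult[symmetric]) auto
    also have "dagger (T U) * H = H"
      using T_H_SU[OF SU_dagger[OF U]] T_dagger[of U] U by (simp add: SU_def)
    finally show "(\<Sum>z<D. cnj (T U $$ (z,x)) * H $$ (z,y)) = H $$ (x,y)" .
  qed
  also have "\<dots> = H $$ (x,y)" by (simp add: prob_space)
  finally show "(dagger H * H) $$ (x,y) = H $$ (x,y)" .
qed auto

lemma H_hermitian: "dagger H = H"
proof -
  have "dagger (dagger H * H) = dagger H * dagger (dagger H)"
    using H_carrier by (intro dagger_mult) auto
  then show ?thesis by (simp add: H_dagger_H)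
qed

lemma H_idem: "H * H = H"
  using H_dagger_H by (simp add: H_hermitian)

lemma H_fixed:
  assumes v: "v \<in> carrier_vec D" and fixed: "\<And>U. U \<in> SU N \<Longrightarrow> T U *\<^sub>v v = v"
  shows "H *\<^sub>v v = v"
proof (rule eq_vecI)
  interpret prob_space M by (rule haar'(1))
  fix x assume "x < dim_vec v"
  then have x: "x < D" using v by auto
  have "(H *\<^sub>v v) $ x = (\<Sum>y<D. integral\<^sup>L M (\<lambda>U. T U $$ (x,y)) * v $ y)"
    unfolding index_mat_vec[OF H_carrier v x] using x by (intro sum.cong) (auto simp: H_index)
  also have "\<dots> = integral\<^sup>L M (\<lambda>U. \<Sum>y<D. T U $$ (x,y) * v $ y)"
    using T_integrable x by (subst Bochner_Integration.integral_sum) auto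
  also have "\<dots> = integral\<^sup>L M (\<lambda>U. v $ x)"
  proof (rule Bochner_Integration.integral_cong[OF refl])
    fix U assume "U \<in> space M"
    then have U: "U \<in> SU N" by (simp add: haar'(2))
    show "(\<Sum>y<D. T U $$ (x,y) * v $ y) = v $ x"
      using index_mat_vec[OF T_SU[OF U] v x] fixed[OF U] by simp
  qed
  finally show "(H *\<^sub>v v) $ x = v $ x" by (simp add: prob_space)
qed (use v in simp)

end

subsection \<open>Inequalities for integral weights\<close>

text \<open>The summand 1 is Cauchy-Schwarz for the squares. For the differences, a vanishing total
  gives \<open>(\<Sum>j<N. f i - f j) = int N * f i\<close>, so the double sum is at least
  \<open>N * S\<close>; finally \<open>S\<close> is at least \<open>S\<^sup>2 / (2 * t)\<close>
  because \<open>S \<le> 2 * t\<close>.\<close>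

lemma weight_bound_general:
  fixes f :: "nat \<Rightarrow> int" and N t :: nat
  defines "S \<equiv> (\<Sum>i<N. \<bar>real_of_int (f i)\<bar>)"
  assumes N: "N > 0" and t: "t \<ge> 1" and sum0: "(\<Sum>i<N. f i) = 0" and S: "S \<le> 2 * real t"
  shows "(1 + (real N)\<^sup>2 / (4 * real t)) * S\<^sup>2
     \<le> real N * ((\<Sum>i<N. (real_of_int (f i))\<^sup>2) + (\<Sum>i<N. \<Sum>j<N. \<bar>real_of_int (f i - f j)\<bar>) / 2)"
proof -
  have S0: "S \<ge> 0" by (simp add: S_def sum_nonneg)
  have "S\<^sup>2 \<le> (\<Sum>i<N. \<bar>real_of_int (f i)\<bar>\<^sup>2) * real (card {..<N})"
    unfolding S_def by (rule sum_squared_le_sum_of_squares)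
  then have 1: "S\<^sup>2 \<le> real N * (\<Sum>i<N. (real_of_int (f i))\<^sup>2)" by (simp add: mult.commute)
  have "real N * \<bar>real_of_int (f i)\<bar> \<le> (\<Sum>j<N. \<bar>real_of_int (f i - f j)\<bar>)" for i
  proof -
    have "(\<Sum>j<N. f i - f j) = int N * f i" using sum0 by (simp add: sum_subtractf)
    then have "real N * \<bar>real_of_int (f i)\<bar> = \<bar>\<Sum>j<N. real_of_int (f i - f j)\<bar>"
      unfolding of_int_sum[symmetric] by (simp add: abs_mult)
    also have "\<dots> \<le> (\<Sum>j<N. \<bar>real_of_int (f i - f j)\<bar>)" by (rule sum_abs)
    finally show ?thesis .
  qed
  then have "(\<Sum>i<N. real N * \<bar>real_of_int (f i)\<bar>) \<le> (\<Sum>i<N. \<Sum>j<N. \<bar>real_of_int (f i - f j)\<bar>)"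
    by (rule sum_mono)
  then have 2: "real N * S \<le> (\<Sum>i<N. \<Sum>j<N. \<bar>real_of_int (f i - f j)\<bar>)"
    by (simp add: S_def sum_distrib_left)
  have "S * S \<le> 2 * real t * S" using S S0 by (intro mult_right_mono)
  then have "S\<^sup>2 / (4 * real t) \<le> S / 2" using t by (simp add: field_simps power2_eq_square)
  then have "(real N)\<^sup>2 * (S\<^sup>2 / (4 * real t)) \<le> (real N)\<^sup>2 * (S / 2)" by (intro mult_left_mono) auto
  also have "\<dots> = real N * ((real N * S) / 2)" by (simp add: power2_eq_square)
  also have "\<dots> \<le> real N * ((\<Sum>i<N. \<Sum>j<N. \<bar>real_of_int (f i - f j)\<bar>) / 2)"
    using 2 by (intro mult_left_mono divide_right_mono) auto
  finally show ?thesis using 1 by (simp add: algebra_simps)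
qed

text \<open>Equality if a number is zero or the signs differ, since then |a||b| = -ab. For equal
  signs the left side is |a| + |b| - 2|a||b|, which is at most 0 because nonzero integers have
  absolute value at least 1.\<close>

lemma abs_diff_int_ge:
  fixes a b :: int
  shows "\<bar>a\<bar> + \<bar>b\<bar> - \<bar>a\<bar> * \<bar>b\<bar> - a * b \<le> \<bar>a - b\<bar>"
proof (cases "a = 0 \<or> b = 0")
  case False
  have pos: "x + y - 2 * (x * y) \<le> 0" if "x \<ge> 1" "y \<ge> 1" for x y :: int
  proof -
    have "x * 1 \<le> x * y" "1 * y \<le> x * y" using that by (intro mult_left_mono mult_right_mono; simp)+
    then show ?thesis by simp
  qed
  consider "a > 0" "b > 0" | "a > 0" "b < 0" | "a < 0" "b > 0" | "a < 0" "b < 0" using False by linarith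
  then show ?thesis
  proof cases
    case 1 then show ?thesis using pos[of a b] by simp
  next
    case 4 then show ?thesis using pos[of "-a" "-b"] by simp
  qed auto
qed auto

text \<open>Summing \<open>abs_diff_int_ge\<close> over all pairs, the signed products cancel
  because the total is 0, and the absolute ones add up to \<open>S\<^sup>2\<close>; this leaves
  \<open>2 * N * S - S\<^sup>2\<close>. With |k| \<le> k^2 for integers, the bracket is at least S
  (N + 1 - S/2), and \<open>S \<le> 2 * t\<close> is used in both factors.\<close>

lemma weight_bound_small:
  fixes f :: "nat \<Rightarrow> int" and N t :: nat
  defines "S \<equiv> (\<Sum>i<N. \<bar>real_of_int (f i)\<bar>)"
  assumes t: "t \<ge> 1" "t \<le> N" and sum0: "(\<Sum>i<N. f i) = 0" and S: "S \<le> 2 * real t"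
  shows "real N * (real N - real t + 1) / (2 * real t) * S\<^sup>2
     \<le> real N * ((\<Sum>i<N. (real_of_int (f i))\<^sup>2) + (\<Sum>i<N. \<Sum>j<N. \<bar>real_of_int (f i - f j)\<bar>) / 2)"
proof -
  have S0: "S \<ge> 0" by (simp add: S_def sum_nonneg)
  have "\<bar>k\<bar> \<le> k\<^sup>2" for k :: int
    by (cases "k = 0") (use mult_left_mono[of 1 "\<bar>k\<bar>" "\<bar>k\<bar>"] in \<open>auto simp: power2_eq_square abs_mult_self_eq\<close>)
  then have "\<bar>real_of_int k\<bar> \<le> (real_of_int k)\<^sup>2" for k
    by (metis of_int_abs of_int_le_iff of_int_power)
  then have 1: "S \<le> (\<Sum>i<N. (real_of_int (f i))\<^sup>2)" unfolding S_def by (intro sum_mono)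
  have ab: "\<bar>real_of_int a\<bar> + \<bar>real_of_int b\<bar> - \<bar>real_of_int a\<bar> * \<bar>real_of_int b\<bar> - real_of_int a * real_of_int b
      \<le> \<bar>real_of_int (a - b)\<bar>" for a b
    using abs_diff_int_ge[of a b] unfolding of_int_abs[symmetric] of_int_mult[symmetric] of_int_add[symmetric]
      of_int_diff[symmetric] of_int_le_iff .
  have r0: "(\<Sum>i<N. real_of_int (f i)) = 0" using sum0 by (metis of_int_0 of_int_sum)
  have "2 * real N * S - S\<^sup>2 = (\<Sum>i<N. \<Sum>j<N. \<bar>real_of_int (f i)\<bar> + \<bar>real_of_int (f j)\<bar>
      - \<bar>real_of_int (f i)\<bar> * \<bar>real_of_int (f j)\<bar> - real_of_int (f i) * real_of_int (f j))"
  proof -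
    have "(\<Sum>i<N. \<Sum>j<N. real_of_int (f i) * real_of_int (f j)) = 0"
      unfolding sum_product[symmetric] r0 by simp
    moreover have "(\<Sum>i<N. \<Sum>j<N. \<bar>real_of_int (f i)\<bar> * \<bar>real_of_int (f j)\<bar>) = S\<^sup>2"
      unfolding sum_product[symmetric] S_def power2_eq_square ..
    moreover have "(\<Sum>i<N. \<Sum>j<N. \<bar>real_of_int (f i)\<bar>) = real N * S"
      "(\<Sum>i<N. \<Sum>j<N. \<bar>real_of_int (f j)\<bar>) = real N * S"
      by (simp_all add: S_def sum_distrib_left)
    ultimately show ?thesis by (simp only: sum_subtractf sum.distrib)
  qed
  also have "\<dots> \<le> (\<Sum>i<N. \<Sum>j<N. \<bar>real_of_int (f i - f j)\<bar>)"
    using ab by (intro sum_mono)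
  finally have 2: "2 * real N * S - S\<^sup>2 \<le> (\<Sum>i<N. \<Sum>j<N. \<bar>real_of_int (f i - f j)\<bar>)" .
  have "(real N - real t + 1) / (2 * real t) * S\<^sup>2 \<le> (real N - real t + 1) * S"
  proof -
    have "S * S \<le> 2 * real t * S" using S S0 by (intro mult_right_mono)
    then have "S\<^sup>2 / (2 * real t) \<le> S" using t by (simp add: field_simps power2_eq_square)
    then have "(real N - real t + 1) * (S\<^sup>2 / (2 * real t)) \<le> (real N - real t + 1) * S"
      using t by (intro mult_left_mono) auto
    then show ?thesis by simp
  qed
  also have "\<dots> \<le> (real N - S / 2 + 1) * S" using S S0 by (intro mult_right_mono) auto
  also have "\<dots> = S + (2 * real N * S - S\<^sup>2) / 2" by (simp add: field_simps power2_eq_square)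
  also have "\<dots> \<le> (\<Sum>i<N. (real_of_int (f i))\<^sup>2) + (\<Sum>i<N. \<Sum>j<N. \<bar>real_of_int (f i - f j)\<bar>) / 2"
    using 1 2 by (intro add_mono divide_right_mono) auto
  finally have "real N * ((real N - real t + 1) / (2 * real t) * S\<^sup>2) \<le> real N *
      ((\<Sum>i<N. (real_of_int (f i))\<^sup>2) + (\<Sum>i<N. \<Sum>j<N. \<bar>real_of_int (f i - f j)\<bar>) / 2)"
    by (intro mult_left_mono) auto
  then show ?thesis by simp
qed

subsection \<open>The spectral gap\<close>

context urep
begin

text \<open>The completeness constant of the strings is the factor \<open>N\<close> in
  \<open>casimir\<close>. The identity string may be left out because it acts by the total charge
  0.\<close>

lemma sum_nsq_lie_map_paulis:
  assumes N: "N = 2 ^ n" and c0: "c = 0" and v: "v \<in> carrier_vec D"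
  shows "(\<Sum>P\<in>pauli_strings n. nsq (lie_map N D g P *\<^sub>v v)) = casimir v"
proof -
  have "(\<Sum>P\<in>all_pauli_strings n. cip (lie_map N D g P *\<^sub>v v) (lie_map N D g P *\<^sub>v v))
    = of_nat N * (\<Sum>i<N. \<Sum>j<N. cip (g i j *\<^sub>v v) (g i j *\<^sub>v v))"
    using all_pauli_strings_complete[of _ n] by (intro sum_cip_lie_map v) (simp add: N)
  then have "complex_of_real (\<Sum>P\<in>all_pauli_strings n. nsq (lie_map N D g P *\<^sub>v v)) = of_real (casimir v)"
    by (simp add: cip_self casimir_def)
  then have "(\<Sum>P\<in>all_pauli_strings n. nsq (lie_map N D g P *\<^sub>v v)) = casimir v"
    by (simp only: of_real_eq_iff)
  moreover have "nsq (lie_map N D g (1\<^sub>m N) *\<^sub>v v) = 0"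
  proof -
    have "lie_map N D g (1\<^sub>m N) = diagm D (\<lambda>x. of_int (\<Sum>i<N. w x i))"
      unfolding diagm_one[symmetric] lie_map_diagm by simp
    also have "\<dots> = diagm D (\<lambda>x. 0)" using c0 by (intro diagm_cong) (simp add: charge)
    finally show ?thesis using v by (simp add: nsq_def diagm_mult_vec del: index_mult_mat_vec)
  qed
  ultimately show ?thesis
    using one_in_all_pauli_strings[of n] all_pauli_strings_finite[of n]
    by (simp add: pauli_strings_eq sum_diff1 N)
qed

text \<open>Linearity in the second argument, stated with entries because \<open>C_mu\<close> is an
  entrywise average. Moving both operators \<open>g\<close> to the left argument reduces it to
  linearity of \<open>cip\<close>.\<close>

lemma casimir_form_lincomb:
  assumes v: "v \<in> carrier_vec D" and u: "u \<in> carrier_vec D" and k: "\<And>P. P \<in> A \<Longrightarrow> k P \<in> carrier_vec D"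
    and eq: "\<And>x. x < D \<Longrightarrow> u $ x = a * (\<Sum>P\<in>A. k P $ x)"
  shows "casimir_form v u = a * (\<Sum>P\<in>A. casimir_form v (k P))"
proof -
  have e: "cip (g i j *\<^sub>v v) (g i j *\<^sub>v z) = cip (g j i *\<^sub>v (g i j *\<^sub>v v)) z"
    if ij: "i < N" "j < N" and z: "z \<in> carrier_vec D" for i j z
    using cip_mat_vec[OF g_carrier[OF ij(2,1)] mult_mat_vec_carrier[OF g_carrier[OF ij] v] z]
    by (simp add: g_dagger ij)
  have lin: "cip y u = a * (\<Sum>P\<in>A. cip y (k P))" if y: "y \<in> carrier_vec D" for y
  proof -
    have "cip y u = (\<Sum>x<D. a * (\<Sum>P\<in>A. cnj (y $ x) * k P $ x))"
      using y by (auto simp: cip_def eq sum_distrib_left mult.left_commute intro!: sum.cong)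
    also have "\<dots> = a * (\<Sum>x<D. \<Sum>P\<in>A. cnj (y $ x) * k P $ x)" by (rule sum_distrib_left[symmetric])
    also have "(\<Sum>x<D. \<Sum>P\<in>A. cnj (y $ x) * k P $ x) = (\<Sum>P\<in>A. \<Sum>x<D. cnj (y $ x) * k P $ x)"
      by (rule sum.swap)
    finally show ?thesis using y by (simp add: cip_def)
  qed
  have "cip (g i j *\<^sub>v v) (g i j *\<^sub>v u) = a * (\<Sum>P\<in>A. cip (g i j *\<^sub>v v) (g i j *\<^sub>v k P))"
    if ij: "i < N" "j < N" for i j
  proof -
    have "g j i *\<^sub>v (g i j *\<^sub>v v) \<in> carrier_vec D"
      using mult_mat_vec_carrier[OF g_carrier[OF ij(2,1)] mult_mat_vec_carrier[OF g_carrier[OF ij] v]] .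
    from lin[OF this] show ?thesis using e[OF ij u] e[OF ij k] by (simp cong: sum.cong)
  qed
  then have "casimir_form v u = of_nat N * (\<Sum>i<N. \<Sum>j<N. a * (\<Sum>P\<in>A. cip (g i j *\<^sub>v v) (g i j *\<^sub>v k P)))"
    by (simp add: casimir_form_def)
  also have "\<dots> = a * (of_nat N * (\<Sum>i<N. \<Sum>j<N. \<Sum>P\<in>A. cip (g i j *\<^sub>v v) (g i j *\<^sub>v k P)))"
    by (simp only: sum_distrib_left[symmetric] mult.left_commute)
  also have "(\<Sum>i<N. \<Sum>j<N. \<Sum>P\<in>A. cip (g i j *\<^sub>v v) (g i j *\<^sub>v k P))
      = (\<Sum>i<N. \<Sum>P\<in>A. \<Sum>j<N. cip (g i j *\<^sub>v v) (g i j *\<^sub>v k P))"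
    by (rule sum.cong[OF refl], rule sum.swap)
  also have "\<dots> = (\<Sum>P\<in>A. \<Sum>i<N. \<Sum>j<N. cip (g i j *\<^sub>v v) (g i j *\<^sub>v k P))"
    by (rule sum.swap)
  also have "of_nat N * \<dots> = (\<Sum>P\<in>A. casimir_form v (k P))"
    by (simp add: casimir_form_def sum_distrib_left)
  finally show ?thesis .
qed

end

section \<open>From eigenvalues to the operator norm\<close>

lemma op_norm_le:
  assumes "\<And>v. v \<in> carrier_vec (dim_col A) \<Longrightarrow> vnorm (A *\<^sub>v v) \<le> b * vnorm v" and "b \<ge> 0"
  shows "op_norm A \<le> b"
  unfolding op_norm_def
proof (rule cSup_least)
  have "vnorm (0\<^sub>v (dim_col A)) \<le> 1" by (simp add: vnorm_def)
  then show "{vnorm (A *\<^sub>v v) |v. v \<in> carrier_vec (dim_col A) \<and> vnorm v \<le> 1} \<noteq> {}"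
    using zero_carrier_vec by blast
  fix r assume "r \<in> {vnorm (A *\<^sub>v v) |v. v \<in> carrier_vec (dim_col A) \<and> vnorm v \<le> 1}"
  then obtain v where v: "v \<in> carrier_vec (dim_col A)" "vnorm v \<le> 1" "r = vnorm (A *\<^sub>v v)" by blast
  then show "r \<le> b" using assms(1)[OF v(1)] mult_left_mono[OF v(2) assms(2)] by simp
qed

lemma (in haar_moment) op_norm_gap:
  assumes N2: "N = 2 ^ n" and n: "n \<ge> 1" and G: "G > 0" "G \<le> (real N)\<^sup>2 - 1"
    and cw: "\<And>x. x < D \<Longrightarrow> G * (\<Sum>i<N. \<bar>real_of_int (w x i)\<bar>)\<^sup>2 \<le> casimir_weight x"
  shows "op_norm (C_mu n t - H) \<le> 1 - G / ((real N)\<^sup>2 - 1)"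
proof -
  let ?C = "C_mu n t" and ?PS = "pauli_strings n"
  define q where "q = (real N)\<^sup>2 - 1"
  have q: "q > 0" using G by (simp add: q_def)
  have card: "real (card ?PS) = q" by (simp add: pauli_strings_card q_def N2)
  obtain V s where Vs: "\<And>P. P \<in> ?PS \<Longrightarrow> unitary_mat N (V P)" "\<And>P i. P \<in> ?PS \<Longrightarrow> s P i \<in> {1,-1 :: int}"
    "\<And>P. P \<in> ?PS \<Longrightarrow> P = V P * diagm N (\<lambda>i. of_int (s P i)) * dagger (V P)"
    using pauli_strings_diagonalizable[of _ n] unfolding N2[symmetric] by metis
  define K where "K P = kernel_proj_mat (V P) (s P)" for P
  have K: "K P \<in> carrier_mat D D" if "P \<in> ?PS" for P
    unfolding K_def using Vs(1)[OF that] by simp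
  have D': "(2 ^ n) ^ (2 * t) = D" by (simp add: N2)
  have C: "?C \<in> carrier_mat D D" by (simp add: C_mu_def Let_def D')
  have Ci: "?C $$ (x,y) = 1 / of_real q * (\<Sum>P\<in>?PS. K P $$ (x,y))" if xy: "x < D" "y < D" for x y
  proof -
    have "integral\<^sup>L (uniform_measure lborel {-pi<..<pi}) (\<lambda>\<theta>. pauli_rot_moment t P \<theta> $$ (x,y)) = K P $$ (x,y)"
      if P: "P \<in> ?PS" for P
    proof -
      have "pauli_rot_moment t P \<theta>
          = T (V P * diagm N (\<lambda>i. exp (\<i> * of_real \<theta> / 2 * of_int (s P i))) * dagger (V P))" for \<theta>
        using pauli_rot_moment_conj_diag[OF Vs(1)[OF P], of t "s P" \<theta>] Vs(3)[OF P] by simp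
      then show ?thesis using integral_rotation[OF Vs(1)[OF P] Vs(2)[OF P] refl xy] by (simp add: K_def)
    qed
    moreover have "complex_of_nat (card ?PS) = of_real q" unfolding card[symmetric] by simp
    ultimately show ?thesis using xy by (simp add: C_mu_def Let_def D')
  qed
  have Cv: "(?C *\<^sub>v v) $ x = 1 / of_real q * (\<Sum>P\<in>?PS. (K P *\<^sub>v v) $ x)"
    if v: "v \<in> carrier_vec D" and x: "x < D" for v x
  proof -
    have "(?C *\<^sub>v v) $ x = (\<Sum>y<D. 1 / of_real q * (\<Sum>P\<in>?PS. K P $$ (x,y) * v $ y))"
      unfolding index_mat_vec[OF C v x] using x by (intro sum.cong) (auto simp: Ci sum_distrib_right)
    also have "\<dots> = 1 / of_real q * (\<Sum>y<D. \<Sum>P\<in>?PS. K P $$ (x,y) * v $ y)"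
      by (rule sum_distrib_left[symmetric])
    also have "(\<Sum>y<D. \<Sum>P\<in>?PS. K P $$ (x,y) * v $ y) = (\<Sum>P\<in>?PS. \<Sum>y<D. K P $$ (x,y) * v $ y)"
      by (rule sum.swap)
    also have "\<dots> = (\<Sum>P\<in>?PS. (K P *\<^sub>v v) $ x)"
      using index_mat_vec[OF K v x] by (intro sum.cong) auto
    finally show ?thesis .
  qed
  have C_fixed: "?C *\<^sub>v v = v" if v: "v \<in> carrier_vec D" and fixed: "\<And>U. unitary_mat N U \<Longrightarrow> T U *\<^sub>v v = v" for v
  proof (rule eq_vecI)
    fix x assume "x < dim_vec v"
    then have x: "x < D" using v by auto
    have "K P *\<^sub>v v = v" if P: "P \<in> ?PS" for P
      unfolding K_def kernel_proj_mat_mult_vec[OF Vs(1)[OF P] v] by (rule kernel_proj_fixed[OF Vs(1)[OF P] v fixed])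
    then have "(\<Sum>P\<in>?PS. (K P *\<^sub>v v) $ x) = of_real q * v $ x"
      unfolding card[symmetric] by simp
    then show "(?C *\<^sub>v v) $ x = v $ x" unfolding Cv[OF v x] using q by simp
  qed (use C v in simp)
  \<comment> \<open>Columns of \<open>H\<close> are invariant vectors, hence fixed by every kernel
    projection; \<open>HC\<close> then follows by taking adjoints.\<close>
  have CH: "?C * H = H"
  proof (rule mat_col_eqI)
    fix y assume y: "y < dim_col H"
    have h: "col H y \<in> carrier_vec D" by (rule carrier_vecI) simp
    have "T U *\<^sub>v col H y = col H y" if U: "unitary_mat N U" for U
    proof -
      have "col (T U * H) y = T U *\<^sub>v col H y"
        using T_carrier[OF unitary_matD(1)[OF U]] H_carrier y by (intro col_mult2) auto
      then show ?thesis by (simp only: T_H[OF U])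
    qed
    from C_fixed[OF h this] show "col (?C * H) y = col H y"
      using C H_carrier y by (subst col_mult2[of _ D D _ D]) auto
  qed (use C in auto)
  have Cd: "dagger ?C = ?C"
  proof (rule eq_matI)
    fix x y assume "x < dim_row ?C" "y < dim_col ?C"
    then have xy: "x < D" "y < D" using C by auto
    have "cnj (K P $$ (y,x)) = K P $$ (x,y)" if P: "P \<in> ?PS" for P
    proof -
      have "cnj (K P $$ (y,x)) = dagger (K P) $$ (x,y)"
        using K[OF P] xy by (intro dagger_index[symmetric]) auto
      also have "dagger (K P) = K P" unfolding K_def by (rule kernel_proj_mat_hermitian[OF Vs(1)[OF P]])
      finally show ?thesis .
    qed
    then show "dagger ?C $$ (x,y) = ?C $$ (x,y)" using xy C by (simp add: Ci cong: sum.cong)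
  qed (use C in auto)
  have HC: "H * ?C = H"
    using dagger_mult[OF C H_carrier] by (simp add: CH Cd H_hermitian)
  let ?B = "?C - H"
  have B: "?B \<in> carrier_mat D D" using C H_carrier by auto
  have Bd: "dagger ?B = ?B"
  proof (rule eq_matI)
    fix x y assume "x < dim_row ?B" "y < dim_col ?B"
    then have xy: "x < D" "y < D" using C by auto
    have "dagger ?C $$ (x,y) = ?C $$ (x,y)" "dagger H $$ (x,y) = H $$ (x,y)" by (simp_all only: Cd H_hermitian)
    then show "dagger ?B $$ (x,y) = ?B $$ (x,y)" using xy C by simp
  qed (use C in auto)
  define b where "b = 1 - G / q"
  have b0: "b \<ge> 0" using G q by (simp add: b_def q_def)
  have eigen: "cmod \<beta> \<le> b" if v: "v \<in> carrier_vec D" and v0: "v \<noteq> 0\<^sub>v D" and Bv: "?B *\<^sub>v v = \<beta> \<cdot>\<^sub>v v" for \<beta> v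
  proof (cases "\<beta> = 0")
    case True then show ?thesis using b0 by simp
  next
    case False
    have HHv: "H *\<^sub>v (H *\<^sub>v v) = H *\<^sub>v v" "H *\<^sub>v (?C *\<^sub>v v) = H *\<^sub>v v"
      using assoc_mult_mat_vec[OF H_carrier H_carrier v] assoc_mult_mat_vec[OF H_carrier C v]
      by (simp_all add: H_idem HC)
    have Bv': "?B *\<^sub>v v = ?C *\<^sub>v v - H *\<^sub>v v"
      using C H_carrier v by (intro minus_mult_distrib_mat_vec)
    \<comment> \<open>\<open>H\<close> annihilates the difference, since \<open>H * ?C\<close> and
      \<open>H * H\<close> both equal \<open>H\<close>; a nonzero eigenvalue can be
      cancelled.\<close>
    have Hv: "H *\<^sub>v v = 0\<^sub>v D"
    proof -
      have "H *\<^sub>v (?B *\<^sub>v v) = H *\<^sub>v (?C *\<^sub>v v) - H *\<^sub>v (H *\<^sub>v v)"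
        unfolding Bv' using C H_carrier v by (intro mult_minus_distrib_mat_vec) auto
      also have "\<dots> = 0\<^sub>v D" unfolding HHv using H_carrier v by (intro minus_cancel_vec) auto
      finally have "\<beta> \<cdot>\<^sub>v (H *\<^sub>v v) = 0\<^sub>v D"
        unfolding Bv using mult_mat_vec[OF H_carrier v] by simp
      then have "\<beta> * (H *\<^sub>v v) $ x = 0" if "x < D" for x
        using that by (metis H_dim(1) dim_mult_mat_vec index_smult_vec(1) index_zero_vec(1))
      then show ?thesis using False by (intro eq_vecI) auto
    qed
    have Cb: "?C *\<^sub>v v = \<beta> \<cdot>\<^sub>v v"
      using Bv' Bv C v unfolding Hv by (metis mult_mat_vec_carrier minus_zero_vec)
    \<comment> \<open>Otherwise \<open>v\<close> would be invariant and fixed by \<open>H\<close>,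
      which has just been shown to annihilate it.\<close>
    have pos: "casimir v > 0"
    proof (rule ccontr)
      assume "\<not> casimir v > 0"
      then have z: "casimir v = 0" using casimir_nonneg[of v] by simp
      have "H *\<^sub>v v = v"
        using casimir_eq_0_invariant[OF G(1) cw v z SU_unitary] by (intro H_fixed v)
      then show False using Hv v0 by simp
    qed
    define r where "r P = Re (casimir_form v (K P *\<^sub>v v))" for P
    have r: "0 \<le> r P" "r P \<le> casimir v - G * nsq (lie_map N D g P *\<^sub>v v)"
      "casimir_form v (K P *\<^sub>v v) = of_real (r P)" if P: "P \<in> ?PS" for P
    proof -
      have KP: "K P *\<^sub>v v = kernel_proj (V P) (s P) v"
        unfolding K_def by (rule kernel_proj_mat_mult_vec[OF Vs(1)[OF P] v])
      have PP: "V P * diagm N (\<lambda>i. of_int (s P i)) * dagger (V P) = P"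
        by (rule Vs(3)[OF P, symmetric])
      have "\<exists>r\<ge>0. r \<le> casimir v
            - G * nsq (lie_map N D g (V P * diagm N (\<lambda>i. of_int (s P i)) * dagger (V P)) *\<^sub>v v)
          \<and> casimir_form v (kernel_proj (V P) (s P) v) = of_real r"
        by (rule casimir_form_kernel_proj[OF Vs(1)[OF P] Vs(2)[OF P] v less_imp_le[OF G(1)] cw])
      then obtain r' where "r' \<ge> 0" "r' \<le> casimir v - G * nsq (lie_map N D g P *\<^sub>v v)"
        "casimir_form v (K P *\<^sub>v v) = of_real r'"
        unfolding PP KP by blast
      then show "0 \<le> r P" "r P \<le> casimir v - G * nsq (lie_map N D g P *\<^sub>v v)"
        "casimir_form v (K P *\<^sub>v v) = of_real (r P)" by (simp_all add: r_def)
    qed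
    \<comment> \<open>The eigenvalue equation is paired with \<open>v\<close> in the Casimir form
      instead of the inner product; this is where the weighting by Q enters. The one-element index
      set turns the lemma on linear combinations into homogeneity.\<close>
    have "\<beta> * of_real (casimir v) = casimir_form v (\<beta> \<cdot>\<^sub>v v)"
    proof -
      have "casimir_form v (\<beta> \<cdot>\<^sub>v v) = \<beta> * (\<Sum>P\<in>{()}. casimir_form v v)"
        using v by (intro casimir_form_lincomb) auto
      then show ?thesis by (simp add: casimir_form_self)
    qed
    also have "casimir_form v (\<beta> \<cdot>\<^sub>v v) = 1 / of_real q * (\<Sum>P\<in>?PS. casimir_form v (K P *\<^sub>v v))"
      unfolding Cb[symmetric] using C v Cv[OF v] mult_mat_vec_carrier[OF K v]
      by (intro casimir_form_lincomb) auto
    also have "\<dots> = of_real ((\<Sum>P\<in>?PS. r P) / q)" using r(3) by (simp cong: sum.cong)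
    finally have "\<beta> * of_real (casimir v) = of_real ((\<Sum>P\<in>?PS. r P) / q)" .
    moreover have "complex_of_real (casimir v) \<noteq> 0" using pos by simp
    ultimately have "\<beta> = of_real ((\<Sum>P\<in>?PS. r P) / q) / of_real (casimir v)"
      by (rule eq_divide_imp[rotated])
    then have \<beta>: "\<beta> = of_real ((\<Sum>P\<in>?PS. r P) / q / casimir v)" by (simp only: of_real_divide)
    have "(\<Sum>P\<in>?PS. r P) \<le> (\<Sum>P\<in>?PS. casimir v - G * nsq (lie_map N D g P *\<^sub>v v))"
      using r(2) by (rule sum_mono)
    also have "\<dots> = q * casimir v - G * casimir v"
      using sum_nsq_lie_map_paulis[OF N2 refl v]
      by (simp add: sum_subtractf sum_distrib_left[symmetric] card)
    finally have "(\<Sum>P\<in>?PS. r P) \<le> (q - G) * casimir v" by (simp add: algebra_simps)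
    then have "(\<Sum>P\<in>?PS. r P) / q / casimir v \<le> (q - G) / q"
      using pos q by (simp add: divide_le_eq mult.commute)
    also have "\<dots> = b" using q by (simp add: b_def diff_divide_distrib)
    finally have "(\<Sum>P\<in>?PS. r P) / q / casimir v \<le> b" .
    \<comment> \<open>Nonnegativity turns the upper bound on the real eigenvalue into a bound on its
      modulus.\<close>
    moreover have "0 \<le> (\<Sum>P\<in>?PS. r P) / q / casimir v"
      using r(1) pos q by (intro divide_nonneg_nonneg sum_nonneg) auto
    ultimately show ?thesis unfolding \<beta> norm_of_real by simp
  qed
  have "op_norm ?B \<le> b"
  proof (rule op_norm_le[OF _ b0])
    fix v :: "complex vec" assume "v \<in> carrier_vec (dim_col ?B)"
    then have "v \<in> carrier_vec D" using B by auto
    then show "vnorm (?B *\<^sub>v v) \<le> b * vnorm v"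
      using B Bd b0 eigen by (intro normal_mat_vnorm_bound[of _ D]) auto
  qed
  then show ?thesis by (simp add: b_def q_def)
qed

theorem theorem5p1:
  fixes n t :: nat and M :: "complex mat measure"
  defines "N \<equiv> (2::nat) ^ n"
  assumes "n \<ge> 1" and "t \<ge> 1"
    and "haar_SU N M"
  shows "op_norm (C_mu n t - H_haar M N t)
           \<le> 1 - 1 / (4 * real t) * (real N ^ 2 / (real N ^ 2 - 1)) - 1 / (real N ^ 2 - 1)
       \<and> (2 * t \<le> N \<longrightarrow> op_norm (C_mu n t - H_haar M N t)
           \<le> 1 - 1 / (2 * real t) * (real N * (real N - real t + 1) / (real N ^ 2 - 1)))"
proof -
  obtain g w where rep: "urep N (N ^ (2 * t)) 0 (2 * int t) (\<lambda>U. mixed_tensor t U) g w"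
    using urep_mixed_tensor by blast
  have N2: "2 \<le> real N"
  proof -
    have "(2::real) ^ 1 \<le> 2 ^ n" using assms(2) by (intro power_increasing) auto
    then show ?thesis by (simp add: N_def)
  qed
  interpret haar_moment N t "2 * int t" g w M
    using rep assms(4) N2 by (intro haar_moment.intro haar_moment_axioms.intro) auto
  have size': "(\<Sum>i<N. \<bar>real_of_int (w x i)\<bar>) \<le> 2 * real t" if "x < N ^ (2 * t)" for x
  proof -
    have "real_of_int (\<Sum>i<N. \<bar>w x i\<bar>) \<le> real_of_int (2 * int t)" using size[OF that] by (simp only: of_int_le_iff)
    then show ?thesis by simp
  qed
  have sq: "4 \<le> (real N)\<^sup>2" using power_mono[OF N2, of 2] by simp
  let ?G = "1 + (real N)\<^sup>2 / (4 * real t)"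
  have "op_norm (C_mu n t - H) \<le> 1 - ?G / ((real N)\<^sup>2 - 1)"
  proof (rule op_norm_gap)
    show "?G * (\<Sum>i<N. \<bar>real_of_int (w x i)\<bar>)\<^sup>2 \<le> casimir_weight x" if "x < N ^ (2 * t)" for x
      unfolding casimir_weight_def using N2 assms(3) charge[OF that] size'[OF that]
      by (intro weight_bound_general) auto
    \<comment> \<open>The gap constant must not exceed N^2 - 1, so that the claimed bound is
      nonnegative; N \<ge> 2 makes 1 + N^2/4 small enough.\<close>
    have "(real N)\<^sup>2 / (4 * real t) \<le> (real N)\<^sup>2 / 4" using assms(3) by (intro divide_left_mono) auto
    then show "?G \<le> (real N)\<^sup>2 - 1" using sq by simp
    show "?G > 0" by (intro add_pos_nonneg) auto
  qed (use assms(2) in \<open>simp_all add: N_def\<close>)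
  moreover have "op_norm (C_mu n t - H) \<le> 1 - real N * (real N - real t + 1) / (2 * real t) / ((real N)\<^sup>2 - 1)"
    if tN: "2 * t \<le> N"
  proof (rule op_norm_gap)
    let ?G' = "real N * (real N - real t + 1) / (2 * real t)"
    show "?G' * (\<Sum>i<N. \<bar>real_of_int (w x i)\<bar>)\<^sup>2 \<le> casimir_weight x" if "x < N ^ (2 * t)" for x
      unfolding casimir_weight_def using N2 assms(3) charge[OF that] size'[OF that] tN
      by (intro weight_bound_small) auto
    have t: "real t \<ge> 1" "real t \<le> real N" using assms(3) tN by auto
    show "?G' > 0" using N2 t by (intro divide_pos_pos mult_pos_pos) auto
    have "?G' \<le> real N * real N / 2"
    proof -
      have "real N - real t + 1 \<le> real N * real t"
      proof -
        have "0 \<le> (real N + 1) * (real t - 1)" using t by (intro mult_nonneg_nonneg) auto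
        then show ?thesis by (simp add: algebra_simps)
      qed
      then have "real N * (real N - real t + 1) \<le> real N * (real N * real t)" by (intro mult_left_mono) auto
      then show ?thesis using t by (simp add: field_simps)
    qed
    then show "?G' \<le> (real N)\<^sup>2 - 1" using sq by (simp add: power2_eq_square)
  qed (use assms(2) in \<open>simp_all add: N_def\<close>)
  moreover have "1 - ?G / ((real N)\<^sup>2 - 1)
      = 1 - 1 / (4 * real t) * ((real N)\<^sup>2 / ((real N)\<^sup>2 - 1)) - 1 / ((real N)\<^sup>2 - 1)"
    by (simp add: add_divide_distrib)
  moreover have "real N * (real N - real t + 1) / (2 * real t) / ((real N)\<^sup>2 - 1)
      = 1 / (2 * real t) * (real N * (real N - real t + 1) / ((real N)\<^sup>2 - 1))"
    by simp
  ultimately show ?thesis by (intro conjI impI) (simp_all only: simp_thms)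
qed

end
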